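(* Let $\varphi_0\in(0,\pi)$ and let $\mathcal K_{\varphi_0}$ be the solid cone of points with spherical coordinates $\rho>0$, $\theta\in(0,2\pi]$, $\varphi\in[0,\varphi_0]$. Let $\boldsymbol F=\rho^{-3}\bigl(X(\varphi)\boldsymbol e_\rho+Y(\varphi)\boldsymbol e_\varphi\bigr)$ be an axisymmetric, swirl-free vector field on $\mathcal K_{\varphi_0}$, of class $C^1$ and homogeneous of degree $-3$. For $\lambda\in\mathbb R$ consider the system $$-\Delta\boldsymbol u+(\boldsymbol u\cdot\nabla)\boldsymbol u+\nabla p=\lambda\boldsymbol F,\qquad \operatorname{div}\boldsymbol u=0\quad\text{in the interior of }\mathcal K_{\varphi_0},\qquad \boldsymbol u=0\ \text{ on }\partial\mathcal K_{\varphi_0}\setminus\{0\}.\qquad(\mathrm{NS}_\lambda)$$ There exist $\underline\lambda\in[-\infty,0)$ and $\overline\lambda\in(0,+\infty]$ such that: for every $\lambda\in(\underline\lambda,\overline\lambda)$ the system $(\mathrm{NS}_\lambda)$ admits a unique axisymmetric self-similar solution $(\boldsymbol u,p)$, and it satisfies $\boldsymbol u\in C^{2,\alpha}_{\mathrm{loc}}(\overline{\mathcal K_{\varphi_0}}\setminus\{0\})$, $p\in C^{1,\alpha}_{\mathrm{loc}}(\overline{\mathcal K_{\varphi_0}}\setminus\{0\})$ for every $\alpha\in(0,1)$; whereas for every real $\lambda\notin(\underline\lambda,\overline\lambda)$ the system $(\mathrm{NS}_\lambda)$ admits no axisymmetric self-similar solution. Moreover, define for $\varphi\in[0,\varphi_0]$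 $$\mathcal N_{\varphi_0}(\varphi)=\int_0^\varphi\bigl(G(\tau)+2\mathcal C_{\varphi_0}\bigr)\sin\tau\,(\cos\varphi-\cos\tau)\,d\tau,$$ where $$G(\varphi)=X(\varphi)+2\int_0^\varphi Y(\tau)\,d\tau,\qquad \mathcal C_{\varphi_0}=-\frac1{(1-\cos\varphi_0)^2}\int_0^{\varphi_0}G(\tau)\sin\tau\,(\cos\tau-\cos\varphi_0)\,d\tau .$$ Then: (1) if $\mathcal N_{\varphi_0}\ge0$ and $\mathcal N_{\varphi_0}\not\equiv0$, then $\underline\lambda\in(-\infty,0)$ and $\overline\lambda=+\infty$; (2) if $\mathcal N_{\varphi_0}\le0$ and $\mathcal N_{\varphi_0}\not\equiv0$, then $\underline\lambda=-\infty$ and $\overline\lambda\in(0,+\infty)$; (3) if $\mathcal N_{\varphi_0}$ changes sign, then $\underline\lambda\in(-\infty,0)$ and $\overline\lambda\in(0,+\infty)$; (4) if $\mathcal N_{\varphi_0}\equiv0$, then $\underline\lambda=-\infty$ and $\overline\lambda=+\infty$.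
   Context: Spherical coordinates: $\boldsymbol x=(\rho\sin\varphi\cos\theta,\rho\sin\varphi\sin\theta,\rho\cos\varphi)$, with orthonormal basis $\boldsymbol e_\rho=\boldsymbol x/\rho$, $\boldsymbol e_\theta=(-\sin\theta,\cos\theta,0)$, $\boldsymbol e_\varphi=\boldsymbol e_\theta\times\boldsymbol e_\rho$. A vector field $\boldsymbol v=v^\rho\boldsymbol e_\rho+v^\varphi\boldsymbol e_\varphi+v^\theta\boldsymbol e_\theta$ is axisymmetric if its components depend only on $(\rho,\varphi)$, and swirl-free if $v^\theta\equiv0$. A scalar function is axisymmetric if it depends only on $(\rho,\varphi)$. The set $\mathcal K_{\varphi_0}=\overline{\mathcal K_{\varphi_0}}\setminus\{0\}$ contains its lateral boundary $\{\varphi=\varphi_0\}$ but not the origin. An axisymmetric self-similar solution is a pair $(\boldsymbol u,p)$ with $\boldsymbol u\in C^2(\overline{\mathcal K_{\varphi_0}}\setminus\{0\})$, $p\in C^1(\overline{\mathcal K_{\varphi_0}}\setminus\{0\})$, both axisymmetric, solving the system pointwise and satisfying $\boldsymbol u(\mu x)=\mu^{-1}\boldsymbol u(x)$, $p(\mu x)=\mu^{-2}p(x)$ for all $\mu>0$. In particular $\boldsymbol u=\rho^{-1}(f(\varphi)\boldsymbol e_\rho+g(\varphi)\boldsymbol e_\varphi+h(\varphi)\boldsymbol e_\theta)$ with angular profiles $f,g,h$ bounded on $[0,\varphi_0]$ (a "bounded-profile" solution). "$\mathcal N_{\varphi_0}$ changes sign" means that it takes both strictly positive and strictly negative values. *)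

theory Defs
  imports "HOL-Analysis.Analysis"
begin

section \<open>Spherical coordinates, the solid cone and axisymmetric fields\<close>

definition spherical :: "real \<Rightarrow> real \<Rightarrow> real \<Rightarrow> real^3" where
  "spherical \<rho> \<phi> \<theta> = vector [\<rho> * sin \<phi> * cos \<theta>, \<rho> * sin \<phi> * sin \<theta>, \<rho> * cos \<phi>]"

text \<open>The unit vector \<open>x / \<rho>\<close> depends only on the two angles; see \<open>e_rho_eq\<close> below.\<close>

definition e_rho :: "real \<Rightarrow> real \<Rightarrow> real^3" where
  "e_rho \<phi> \<theta> = spherical 1 \<phi> \<theta>"

definition e_theta :: "real \<Rightarrow> real^3" where
  "e_theta \<theta> = vector [- sin \<theta>, cos \<theta>, 0]"

definition e_phi :: "real \<Rightarrow> real \<Rightarrow> real^3" where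
  "e_phi \<phi> \<theta> = cross3 (e_theta \<theta>) (e_rho \<phi> \<theta>)"

lemma e_rho_eq: "\<rho> > 0 \<Longrightarrow> e_rho \<phi> \<theta> = spherical \<rho> \<phi> \<theta> /\<^sub>R \<rho>"
  by (simp add: e_rho_def spherical_def vec_eq_iff forall_3)

lemma e_phi_eq: "e_phi \<phi> \<theta> = vector [cos \<phi> * cos \<theta>, cos \<phi> * sin \<theta>, - sin \<phi>]"
proof -
  have "sin \<phi> * ((sin \<theta>)\<^sup>2 + (cos \<theta>)\<^sup>2) = sin \<phi>"
    by simp
  then have "cos \<theta> * (cos \<theta> * sin \<phi>) + sin \<phi> * (sin \<theta> * sin \<theta>) = sin \<phi>"
    unfolding power2_eq_square by argo
  then show ?thesis
    by (simp add: e_phi_def e_rho_def e_theta_def spherical_def cross3_def vec_eq_iff forall_3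
        mult.commute) argo
qed

text \<open>Triples are ordered \<open>(\<rho>, \<phi>, \<theta>)\<close>, with \<open>\<phi>\<close> the polar angle.\<close>

definition cone_coords :: "real \<Rightarrow> (real \<times> real \<times> real) set" where
  "cone_coords \<phi>0 = {(\<rho>, \<phi>, \<theta>). 0 < \<rho> \<and> 0 \<le> \<phi> \<and> \<phi> \<le> \<phi>0 \<and> 0 < \<theta> \<and> \<theta> \<le> 2 * pi}"

text \<open>The cone contains its lateral boundary \<open>\<phi> = \<phi>0\<close>, but not its vertex.\<close>

definition solid_cone :: "real \<Rightarrow> (real^3) set" where
  "solid_cone \<phi>0 = (\<lambda>(\<rho>, \<phi>, \<theta>). spherical \<rho> \<phi> \<theta>) ` cone_coords \<phi>0"

text \<open>On the axis \<open>\<phi> = 0\<close> the vectors \<open>e_phi\<close> and \<open>e_theta\<close> still vary with \<open>\<theta>\<close>, so there the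
  condition says that the field is parallel to the axis.\<close>

definition axisymmetric_vector :: "real \<Rightarrow> (real^3 \<Rightarrow> real^3) \<Rightarrow> bool" where
  "axisymmetric_vector \<phi>0 v \<longleftrightarrow>
     (\<exists>a b c :: real \<Rightarrow> real \<Rightarrow> real. \<forall>(\<rho>, \<phi>, \<theta>)\<in>cone_coords \<phi>0.
        v (spherical \<rho> \<phi> \<theta>) =
          a \<rho> \<phi> *\<^sub>R e_rho \<phi> \<theta> + b \<rho> \<phi> *\<^sub>R e_phi \<phi> \<theta> + c \<rho> \<phi> *\<^sub>R e_theta \<theta>)"

definition swirl_free :: "real \<Rightarrow> (real^3 \<Rightarrow> real^3) \<Rightarrow> bool" where
  "swirl_free \<phi>0 v \<longleftrightarrow>
     (\<forall>(\<rho>, \<phi>, \<theta>)\<in>cone_coords \<phi>0. v (spherical \<rho> \<phi> \<theta>) \<bullet> e_theta \<theta> = 0)"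

definition axisymmetric_scalar :: "real \<Rightarrow> (real^3 \<Rightarrow> real) \<Rightarrow> bool" where
  "axisymmetric_scalar \<phi>0 p \<longleftrightarrow>
     (\<exists>q :: real \<Rightarrow> real \<Rightarrow> real. \<forall>(\<rho>, \<phi>, \<theta>)\<in>cone_coords \<phi>0. p (spherical \<rho> \<phi> \<theta>) = q \<rho> \<phi>)"

definition homogeneous_on :: "(real^3) set \<Rightarrow> int \<Rightarrow> (real^3 \<Rightarrow> 'b::real_normed_vector) \<Rightarrow> bool" where
  "homogeneous_on S d v \<longleftrightarrow> (\<forall>x\<in>S. \<forall>\<mu>>0. v (\<mu> *\<^sub>R x) = (\<mu> powi d) *\<^sub>R v x)"

section \<open>Differential operators\<close>

definition pdiff_at :: "3 \<Rightarrow> (real^3 \<Rightarrow> 'b::real_normed_vector) \<Rightarrow> real^3 \<Rightarrow> bool" where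
  "pdiff_at i f x \<longleftrightarrow> (\<lambda>t. f (x + t *\<^sub>R axis i 1)) differentiable (at 0)"

definition pderiv_at :: "3 \<Rightarrow> (real^3 \<Rightarrow> 'b::real_normed_vector) \<Rightarrow> real^3 \<Rightarrow> 'b" where
  "pderiv_at i f x = vector_derivative (\<lambda>t. f (x + t *\<^sub>R axis i 1)) (at 0)"

definition laplacian :: "(real^3 \<Rightarrow> 'b::real_normed_vector) \<Rightarrow> real^3 \<Rightarrow> 'b" where
  "laplacian f x = (\<Sum>i\<in>UNIV. pderiv_at i (pderiv_at i f) x)"

definition convection :: "(real^3 \<Rightarrow> real^3) \<Rightarrow> (real^3 \<Rightarrow> real^3) \<Rightarrow> real^3 \<Rightarrow> real^3" where
  "convection u v x = (\<Sum>i\<in>UNIV. (u x $ i) *\<^sub>R pderiv_at i v x)"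

definition grad :: "(real^3 \<Rightarrow> real) \<Rightarrow> real^3 \<Rightarrow> real^3" where
  "grad p x = (\<chi> i. pderiv_at i p x)"

definition divergence :: "(real^3 \<Rightarrow> real^3) \<Rightarrow> real^3 \<Rightarrow> real" where
  "divergence u x = (\<Sum>i\<in>UNIV. pderiv_at i (\<lambda>y. u y $ i) x)"

section \<open>Regularity up to the boundary\<close>

text \<open>\<open>f\<close> is of class \<open>C\<^sup>k\<close> on \<open>S\<close> (a set contained in the closure of its interior): all partial
  derivatives up to order \<open>k\<close> exist in the interior of \<open>S\<close> and extend continuously to \<open>S\<close>.
  The function \<open>g\<close> is the continuous extension of the partial derivative.\<close>

primrec C_upto :: "nat \<Rightarrow> (real^3) set \<Rightarrow> (real^3 \<Rightarrow> 'b::real_normed_vector) \<Rightarrow> bool" where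
  "C_upto 0 S f \<longleftrightarrow> continuous_on S f"
| "C_upto (Suc k) S f \<longleftrightarrow> continuous_on S f \<and>
     (\<forall>i. (\<forall>x\<in>interior S. pdiff_at i f x) \<and>
          (\<exists>g. C_upto k S g \<and> (\<forall>x\<in>interior S. g x = pderiv_at i f x)))"

definition loc_holder :: "real \<Rightarrow> (real^3) set \<Rightarrow> (real^3 \<Rightarrow> 'b::real_normed_vector) \<Rightarrow> bool" where
  "loc_holder \<alpha> S f \<longleftrightarrow>
     (\<forall>C. compact C \<and> C \<subseteq> S \<longrightarrow> (\<exists>M. \<forall>x\<in>C. \<forall>y\<in>C. norm (f x - f y) \<le> M * dist x y powr \<alpha>))"

text \<open>The class \<open>C\<^sup>k\<^sup>,\<^sup>\<alpha>\<close>, locally on \<open>S\<close>: in addition the extensions to \<open>S\<close> of the derivatives of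
  order \<open>k\<close> are Hoelder continuous on compact subsets of \<open>S\<close>.\<close>

primrec C_holder_upto ::
  "nat \<Rightarrow> real \<Rightarrow> (real^3) set \<Rightarrow> (real^3 \<Rightarrow> 'b::real_normed_vector) \<Rightarrow> bool" where
  "C_holder_upto 0 \<alpha> S f \<longleftrightarrow> continuous_on S f \<and> loc_holder \<alpha> S f"
| "C_holder_upto (Suc k) \<alpha> S f \<longleftrightarrow> continuous_on S f \<and>
     (\<forall>i. (\<forall>x\<in>interior S. pdiff_at i f x) \<and>
          (\<exists>g. C_holder_upto k \<alpha> S g \<and> (\<forall>x\<in>interior S. g x = pderiv_at i f x)))"

section \<open>Self-similar solutions and the angular quantities\<close>

text \<open>Only the values of \<open>u\<close> and \<open>p\<close> on the cone matter.\<close>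

definition axisym_selfsimilar_solution ::
  "real \<Rightarrow> (real^3 \<Rightarrow> real^3) \<Rightarrow> real \<Rightarrow> (real^3 \<Rightarrow> real^3) \<Rightarrow> (real^3 \<Rightarrow> real) \<Rightarrow> bool" where
  "axisym_selfsimilar_solution \<phi>0 F lam u p \<longleftrightarrow>
     C_upto 2 (solid_cone \<phi>0) u \<and> C_upto 1 (solid_cone \<phi>0) p \<and>
     axisymmetric_vector \<phi>0 u \<and> axisymmetric_scalar \<phi>0 p \<and>
     homogeneous_on (solid_cone \<phi>0) (-1) u \<and> homogeneous_on (solid_cone \<phi>0) (-2) p \<and>
     (\<forall>x\<in>interior (solid_cone \<phi>0).
        - laplacian u x + convection u u x + grad p x = lam *\<^sub>R F x \<and> divergence u x = 0) \<and>
     (\<forall>x\<in>frontier (solid_cone \<phi>0) - {0}. u x = 0)"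

definition G_profile :: "(real \<Rightarrow> real) \<Rightarrow> (real \<Rightarrow> real) \<Rightarrow> real \<Rightarrow> real" where
  "G_profile X Y \<phi> = X \<phi> + 2 * integral {0..\<phi>} Y"

definition C_const :: "real \<Rightarrow> (real \<Rightarrow> real) \<Rightarrow> (real \<Rightarrow> real) \<Rightarrow> real" where
  "C_const \<phi>0 X Y =
     - (1 / (1 - cos \<phi>0)\<^sup>2) *
       integral {0..\<phi>0} (\<lambda>\<tau>. G_profile X Y \<tau> * sin \<tau> * (cos \<tau> - cos \<phi>0))"

definition N_fun :: "real \<Rightarrow> (real \<Rightarrow> real) \<Rightarrow> (real \<Rightarrow> real) \<Rightarrow> real \<Rightarrow> real" where
  "N_fun \<phi>0 X Y \<phi> =
     integral {0..\<phi>} (\<lambda>\<tau>. (G_profile X Y \<tau> + 2 * C_const \<phi>0 X Y) * sin \<tau> * (cos \<phi> - cos \<tau>))"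

end

theory Submission
  imports Defs
begin

text \<open>
  Put \<open>s = cos \<phi>\<close> and \<open>x0 = cos \<phi>0\<close>. The divergence equation expresses \<open>f\<close> through \<open>y = g / sin \<phi>\<close>, a
  linear second-order equation with zero boundary values forces \<open>h = 0\<close>, and the momentum equation, after
  elimination of the pressure and two integrations, becomes the Riccati problem
  \<open>y' = \<lambda> n - y\<^sup>2 / 2\<close>, \<open>y x0 = 0\<close> on \<open>[x0, 1]\<close> with \<open>n = N / (1 - s\<^sup>2)\<^sup>2\<close>. The no-slip condition for
  \<open>f\<close> fixes one constant of integration as \<open>\<lambda> C_const\<close>.

  A bounded subsolution suffices for solvability, so the solvable \<open>\<lambda>\<close> form an open interval around 0, by
  stability and by convexity of the square. It contains every \<open>\<lambda>\<close> with \<open>\<lambda> n \<ge> 0\<close>, whereas the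
  solution blows down when \<open>\<lambda> n\<close> is very negative on some interval.

  The solution built from \<open>y\<close> is as regular at the axis as away from it because its profiles are Lipschitz
  continuous in \<open>sqrt (1 - s)\<close>, that is, in \<open>\<phi>\<close>; the second derivatives of the velocity and
  the first ones of the pressure are then even locally Lipschitz.
\<close>

section \<open>The Riccati equation\<close>

text \<open>The Riccati form comes from the stream function \<open>\<psi> = (1 - s^2) y\<close>:
  incompressibility says that the radial profile \<open>f\<close> equals \<open>\<psi>'\<close>. The
  balance along \<open>e_phi\<close> integrates to the pressure, up to a constant \<open>k\<close>.
  Inserted into the radial balance, it gives \<open>\<Phi>' = - (\<lambda> G + 2 k)\<close> with
  \<open>\<Phi> = (1 - s^2) f' + \<psi> f + 2 \<psi>\<close>. As \<open>f\<close> is Lipschitz in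
  \<open>sqrt (1 - s)\<close>, \<open>\<Phi>\<close> tends to 0 at the axis, which removes the next
  constant. Moreover \<open>\<Phi>\<close> is the derivative of \<open>(1 - s^2) f + 2 s \<psi> +
  \<psi>^2 / 2 = (1 - s^2)^2 (y' + y^2 / 2)\<close>, hence the denominator of \<open>n\<close>. This
  expression vanishes at \<open>s = 1\<close>, and by no-slip also at \<open>x0\<close>, which
  determines \<open>k\<close>. Conversely, once \<open>N\<close> vanishes at \<open>x0\<close>, the
  initial value \<open>y x0 = 0\<close> yields both no-slip conditions, so blow-down before the axis
  is the only obstruction to existence. The obstacle in the regularity proof is the axis:
  \<open>n\<close> is continuous at \<open>s = 1\<close> but need not be differentiable there, so
  second derivatives of profiles are controlled only after multiplication by
  \<open>1 - s^2\<close>.\<close>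

lemma ode_lower_barrier:
  fixes d :: "real \<Rightarrow> real"
  assumes cont: "continuous_on {a..b} d" and a: "0 \<le> d a"
    and deriv: "\<And>t. a < t \<Longrightarrow> t < b \<Longrightarrow> d t < 0 \<Longrightarrow> \<exists>D. (d has_real_derivative D) (at t) \<and> L * d t \<le> D"
    and t: "t \<in> {a..b}"
  shows "0 \<le> d t"
proof (rule ccontr)
  assume neg: "\<not> 0 \<le> d t"
  let ?T = "{a..t} \<inter> d -` {0..}"
  have ct: "continuous_on {a..t} d"
    using cont by (rule continuous_on_subset) (use t in auto)
  then have "closed ?T"
    by (intro continuous_closed_preimage) auto
  then have "compact ?T"
    using bounded_Int[of "{a..t}"] by (auto simp: compact_eq_bounded_closed)
  moreover have "?T \<noteq> {}" using a t by auto
  ultimately have "\<exists>r\<in>?T. \<forall>q\<in>?T. q \<le> r" by (rule compact_attains_sup)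
  \<comment> \<open>\<open>r\<close> is the last time up to \<open>t\<close> at which
    \<open>d\<close> is nonnegative. After \<open>r\<close> the hypothesis applies throughout and
    makes \<open>exp (- L * q) * d q\<close> nondecreasing, so it cannot become negative.\<close>
  then obtain r where r: "r \<in> ?T" and max: "\<And>q. q \<in> ?T \<Longrightarrow> q \<le> r"
    by blast
  have below: "d q < 0" if "r < q" "q \<le> t" for q
    using max[of q] that r t by force
  have "exp (- L * r) * d r \<le> exp (- L * t) * d t"
  proof (rule DERIV_nonneg_imp_increasing_open[where f = "\<lambda>t. exp (- L * t) * d t"])
    show "r \<le> t" using r by auto
    show "continuous_on {r..t} (\<lambda>t. exp (- L * t) * d t)"
      using r by (intro continuous_intros continuous_on_subset[OF ct]) auto
    fix q assume q: "r < q" "q < t"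
    obtain D where D: "(d has_real_derivative D) (at q)" "L * d q \<le> D"
      using deriv[of q] below[of q] q r t by auto
    have "((\<lambda>t. exp (- L * t) * d t) has_real_derivative exp (- L * q) * (D - L * d q)) (at q)"
      by (auto intro!: derivative_eq_intros D(1) simp: algebra_simps)
    then show "\<exists>y. ((\<lambda>t. exp (- L * t) * d t) has_real_derivative y) (at q) \<and> 0 \<le> y"
      using D(2) by fastforce
  qed
  moreover have "0 \<le> exp (- L * r) * d r" using r by simp
  moreover have "exp (- L * t) * d t < 0" using neg by (simp add: mult_less_0_iff)
  ultimately show False by linarith
qed

text \<open>The Picard operator is a contraction of the bounded continuous functions once the unknown is
  rescaled by the weight \<open>exp (- 2 L t)\<close>, so no continuation argument is needed.\<close>

lemma global_ode_existence:
  fixes F :: "real \<Rightarrow> real \<Rightarrow> real"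
  assumes "a \<le> b" and "0 < L"
    and cont: "\<And>y. continuous_on {a..b} y \<Longrightarrow> continuous_on {a..b} (\<lambda>t. F t (y t))"
    and lip: "\<And>t y z. t \<in> {a..b} \<Longrightarrow> \<bar>F t y - F t z\<bar> \<le> L * \<bar>y - z\<bar>"
  obtains y where "y a = 0"
    and "\<And>t. t \<in> {a..b} \<Longrightarrow> (y has_real_derivative F t (y t)) (at t within {a..b})"
proof -
  \<comment> \<open>The elements of \<open>bcontfun\<close> are functions on the whole line, so
    everything on \<open>{a..b}\<close> is extended by constants through
    \<open>clamp\<close>.\<close>
  define clamp where "clamp t = max a (min b t)" for t :: real
  define wt where "wt t = exp (2 * L * t)" for t
  define T where "T v t = integral {a..clamp t} (\<lambda>r. F r (wt r * v r)) / wt (clamp t)"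
    for v and t
  have cl: "clamp t \<in> {a..b}" for t using \<open>a \<le> b\<close> by (auto simp: clamp_def)
  have clid: "clamp t = t" if "t \<in> {a..b}" for t using that by (auto simp: clamp_def)
  have cl_cont: "continuous_on UNIV clamp"
    unfolding clamp_def by (intro continuous_intros)
  have Fc: "continuous_on {a..b} (\<lambda>r. F r (wt r * apply_bcontfun v r))" for v
    unfolding wt_def by (intro cont continuous_intros continuous_on_apply_bcontfun)
  have Ic: "continuous_on {a..b} (\<lambda>t. integral {a..t} (\<lambda>r. F r (wt r * apply_bcontfun v r)) / wt t)" for v
    unfolding wt_def
    by (intro continuous_intros indefinite_integral_continuous_1 integrable_continuous_interval
        Fc[unfolded wt_def]) auto
  have TB: "T (apply_bcontfun v) \<in> bcontfun" for v
  proof -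
    have eq: "T (apply_bcontfun v) =
        (\<lambda>t. integral {a..t} (\<lambda>r. F r (wt r * apply_bcontfun v r)) / wt t) \<circ> clamp"
      by (auto simp: T_def)
    have "continuous_on UNIV (T (apply_bcontfun v))"
      unfolding eq using cl
      by (intro continuous_on_compose cl_cont continuous_on_subset[OF Ic]) auto
    moreover have "range (T (apply_bcontfun v)) \<subseteq>
       (\<lambda>t. integral {a..t} (\<lambda>r. F r (wt r * apply_bcontfun v r)) / wt t) ` {a..b}"
      unfolding eq using cl by auto
    then have "bounded (range (T (apply_bcontfun v)))"
      using compact_continuous_image[OF Ic] compact_imp_bounded bounded_subset
      by (metis compact_Icc)
    ultimately show ?thesis by (simp add: bcontfun_def)
  qed
  define TT where "TT v = Bcontfun (T (apply_bcontfun v))" for v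
  have TT: "apply_bcontfun (TT v) = T (apply_bcontfun v)" for v
    using TB by (simp add: TT_def Bcontfun_inverse)
  have "dist (TT v) (TT w) \<le> 1/2 * dist v w" for v w
  proof (rule dist_bound)
    fix t
    let ?c = "clamp t"
    let ?f = "\<lambda>v r. F r (wt r * apply_bcontfun v r)"
    have sub: "{a..?c} \<subseteq> {a..b}" using cl[of t] by auto
    have i: "?f v integrable_on {a..?c}" for v
      by (intro integrable_continuous_interval continuous_on_subset[OF Fc sub])
    \<comment> \<open>\<open>wt\<close> grows at rate \<open>2 * L\<close>, so the integral of
      \<open>L * wt\<close> is half the increment of \<open>wt\<close>. After division by
      \<open>wt\<close> this is the contraction factor \<open>1/2\<close>.\<close>
    have ex: "((\<lambda>r. L * (wt r * dist v w)) has_integral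
        (wt ?c * dist v w / 2 - wt a * dist v w / 2)) {a..?c}"
    proof (rule fundamental_theorem_of_calculus)
      show "a \<le> ?c" using cl[of t] by simp
      show "((\<lambda>r. wt r * dist v w / 2) has_vector_derivative L * (wt r * dist v w)) (at r within {a..?c})" for r
        unfolding wt_def has_real_derivative_iff_has_vector_derivative[symmetric]
        by (auto intro!: derivative_eq_intros)
    qed
    have "\<bar>integral {a..?c} (\<lambda>r. ?f v r - ?f w r)\<bar> \<le> integral {a..?c} (\<lambda>r. L * (wt r * dist v w))"
    proof (rule order_trans[OF _ integral_norm_bound_integral])
      show "(\<lambda>r. ?f v r - ?f w r) integrable_on {a..?c}" by (intro integrable_diff i)
      show "(\<lambda>r. L * (wt r * dist v w)) integrable_on {a..?c}" using ex by blast
      fix r assume "r \<in> {a..?c}"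
      then have r: "r \<in> {a..b}" using sub by auto
      have "\<bar>?f v r - ?f w r\<bar> \<le> L * \<bar>wt r * apply_bcontfun v r - wt r * apply_bcontfun w r\<bar>"
        by (rule lip[OF r])
      also have "\<dots> = L * (wt r * dist (apply_bcontfun v r) (apply_bcontfun w r))"
        by (simp add: dist_real_def wt_def abs_mult flip: right_diff_distrib)
      also have "\<dots> \<le> L * (wt r * dist v w)"
        using \<open>0 < L\<close> dist_bounded[of v r w] by (intro mult_left_mono) (auto simp: wt_def)
      finally show "norm (?f v r - ?f w r) \<le> L * (wt r * dist v w)" by simp
    qed auto
    also have "\<dots> \<le> wt ?c * (1/2 * dist v w)"
      using integral_unique[OF ex] by (simp add: wt_def)
    finally have "\<bar>integral {a..?c} (?f v) - integral {a..?c} (?f w)\<bar> \<le> wt ?c * (1/2 * dist v w)"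
      by (simp add: integral_diff i)
    then show "dist (apply_bcontfun (TT v) t) (apply_bcontfun (TT w) t) \<le> 1/2 * dist v w"
      unfolding TT T_def dist_real_def
      by (simp add: wt_def field_simps flip: diff_divide_distrib)
  qed
  then obtain v where v: "TT v = v"
    using banach_fix_type[of "1/2" TT] by auto
  define y where "y t = wt t * apply_bcontfun v t" for t
  have y_eq: "y t = integral {a..t} (\<lambda>r. F r (y r))" if "t \<in> {a..b}" for t
  proof -
    have "apply_bcontfun v t = T (apply_bcontfun v) t" using TT[of v] v by simp
    then show ?thesis
      using clid[OF that] by (simp add: y_def T_def wt_def)
  qed
  show ?thesis
  proof
    show "y a = 0" using y_eq[of a] \<open>a \<le> b\<close> by simp
    fix t assume t: "t \<in> {a..b}"
    have "((\<lambda>u. integral {a..u} (\<lambda>r. F r (y r))) has_real_derivative F t (y t)) (at t within {a..b})"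
      unfolding has_real_derivative_iff_has_vector_derivative
      using integral_has_vector_derivative[OF Fc[of v] t] by (simp add: y_def)
    then show "(y has_real_derivative F t (y t)) (at t within {a..b})"
      by (rule has_field_derivative_transform_within[OF _ zero_less_one t]) (use y_eq in auto)
  qed
qed

section \<open>Comparison, solvability and thresholds for the Riccati problem\<close>

definition riccati :: "real \<Rightarrow> real \<Rightarrow> (real \<Rightarrow> real) \<Rightarrow> real \<Rightarrow> (real \<Rightarrow> real) \<Rightarrow> bool" where
  "riccati a b n l y \<longleftrightarrow> y a = 0 \<and>
     (\<forall>s\<in>{a..b}. (y has_real_derivative l * n s - (y s)\<^sup>2 / 2) (at s within {a..b}))"

lemma riccati_continuous: "riccati a b n l y \<Longrightarrow> continuous_on {a..b} y"
  unfolding riccati_def by (intro DERIV_continuous_on) auto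

lemma riccati_deriv_at:
  assumes "riccati a b n l y" "a < s" "s < b"
  shows "(y has_real_derivative l * n s - (y s)\<^sup>2 / 2) (at s)"
  using assms unfolding riccati_def
  by (metis at_within_Icc_at atLeastAtMost_iff less_eq_real_def)

lemma continuous_abs_bound:
  fixes f :: "real \<Rightarrow> real"
  assumes "continuous_on {a..b} f"
  obtains M where "1 \<le> M" "\<And>s. s \<in> {a..b} \<Longrightarrow> \<bar>f s\<bar> \<le> M"
proof -
  have "bounded (f ` {a..b})"
    using assms by (intro compact_imp_bounded compact_continuous_image) auto
  then obtain B where B: "\<And>s. s \<in> {a..b} \<Longrightarrow> \<bar>f s\<bar> \<le> B"
    unfolding bounded_iff by (metis image_eqI real_norm_def)
  show ?thesis by (rule that[of "max 1 B"]) (use B in \<open>auto simp: le_max_iff_disj\<close>)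
qed

text \<open>For bounded functions the quadratic term is one-sidedly Lipschitz:
  \<open>v^2 - w^2 = (v - w) (v + w)\<close> and \<open>v + w \<ge> - 2 R\<close>, so
  \<open>ode_lower_barrier\<close> applies to \<open>w - v\<close>. The interval is half-open
  because the profiles of a given flow are quotients that are not controlled on the axis.\<close>

lemma riccati_comparison:
  fixes v w g :: "real \<Rightarrow> real"
  assumes cont: "continuous_on {a..<b} v" "continuous_on {a..<b} w" and "v a \<le> w a"
    and bound: "\<And>s. s \<in> {a..<b} \<Longrightarrow> \<bar>v s\<bar> \<le> R" "\<And>s. s \<in> {a..<b} \<Longrightarrow> \<bar>w s\<bar> \<le> R"
    and v: "\<And>s. a < s \<Longrightarrow> s < b \<Longrightarrow> \<exists>D. (v has_real_derivative D) (at s) \<and> D \<le> g s - (v s)\<^sup>2 / 2"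
    and w: "\<And>s. a < s \<Longrightarrow> s < b \<Longrightarrow> \<exists>D. (w has_real_derivative D) (at s) \<and> g s - (w s)\<^sup>2 / 2 \<le> D"
    and t: "t \<in> {a..<b}"
  shows "v t \<le> w t"
proof -
  have "0 \<le> w t - v t"
  proof (rule ode_lower_barrier[where d = "\<lambda>s. w s - v s" and a = a and b = t and L = R])
    have "{a..t} \<subseteq> {a..<b}" using t by auto
    then show "continuous_on {a..t} (\<lambda>s. w s - v s)"
      using cont by (intro continuous_intros) (auto intro: continuous_on_subset)
    fix s assume s: "a < s" "s < t" and neg: "w s - v s < 0"
    obtain D E where D: "(v has_real_derivative D) (at s)" "D \<le> g s - (v s)\<^sup>2 / 2"
      and E: "(w has_real_derivative E) (at s)" "g s - (w s)\<^sup>2 / 2 \<le> E"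
      using v[of s] w[of s] s t by auto
    have "-2 * R \<le> w s + v s" using bound[of s] s t by auto
    then have "0 \<le> (v s - w s) * (w s + v s + 2 * R)"
      using neg by (intro mult_nonneg_nonneg) auto
    then have "R * (w s - v s) \<le> (v s)\<^sup>2 / 2 - (w s)\<^sup>2 / 2"
      by (simp add: power2_eq_square algebra_simps)
    then have "R * (w s - v s) \<le> E - D" using D E by linarith
    then show "\<exists>D. ((\<lambda>s. w s - v s) has_real_derivative D) (at s) \<and> R * (w s - v s) \<le> D"
      using DERIV_diff[OF E(1) D(1)] by blast
  qed (use assms in auto)
  then show ?thesis by simp
qed

text \<open>The quadratic term is truncated at a level that the solution never reaches, because it stays
  above the subsolution and grows at most linearly.\<close>

lemma riccati_of_subsolution:
  fixes v n :: "real \<Rightarrow> real"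
  assumes "a < b" and n: "continuous_on {a..b} n"
    and v: "continuous_on {a..<b} v" "v a \<le> 0" and bound: "\<And>s. s \<in> {a..<b} \<Longrightarrow> \<bar>v s\<bar> \<le> B"
    and sub: "\<And>s. a < s \<Longrightarrow> s < b \<Longrightarrow>
      \<exists>D. (v has_real_derivative D) (at s) \<and> D \<le> l * n s - (v s)\<^sup>2 / 2"
  shows "\<exists>y. riccati a b n l y"
proof -
  have "continuous_on {a..b} (\<lambda>s. l * n s)" by (intro continuous_intros n)
  then obtain M where "1 \<le> M" and M: "\<And>s. s \<in> {a..b} \<Longrightarrow> \<bar>l * n s\<bar> \<le> M"
    using continuous_abs_bound by metis
  \<comment> \<open>The level exceeds both the bound of the subsolution and the growth
    \<open>M * (b - a)\<close> of a function that starts at 0 with slope at most \<open>M\<close>;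
    the 1 makes the second inequality strict.\<close>
  define R where "R = \<bar>B\<bar> + M * (b - a) + 1"
  have MR: "0 \<le> M * (b - a)" using \<open>1 \<le> M\<close> \<open>a < b\<close> by simp
  then have R: "0 < R" "M * (b - a) < R" by (auto simp: R_def)
  have vR: "\<bar>v s\<bar> \<le> R" if "s \<in> {a..<b}" for s
    using bound[OF that] MR by (simp add: R_def)
  define cut where "cut z = max (-R) (min R z)" for z
  have cut_lip: "\<bar>(cut y)\<^sup>2 / 2 - (cut z)\<^sup>2 / 2\<bar> \<le> R * \<bar>y - z\<bar>" for y z
  proof -
    have "\<bar>cut y + cut z\<bar> \<le> 2 * R" "\<bar>cut y - cut z\<bar> \<le> \<bar>y - z\<bar>"
      using \<open>0 < R\<close> by (auto simp: cut_def max_def min_def)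
    then have "\<bar>cut y + cut z\<bar> * \<bar>cut y - cut z\<bar> \<le> 2 * R * \<bar>y - z\<bar>"
      by (intro mult_mono) auto
    moreover have "(cut y)\<^sup>2 / 2 - (cut z)\<^sup>2 / 2 = (cut y + cut z) * (cut y - cut z) / 2"
      by (simp add: power2_eq_square field_simps)
    then have "\<bar>(cut y)\<^sup>2 / 2 - (cut z)\<^sup>2 / 2\<bar> = \<bar>cut y + cut z\<bar> * \<bar>cut y - cut z\<bar> / 2"
      by (simp only: abs_divide abs_mult)
    ultimately show ?thesis by simp
  qed
  obtain y where y0: "y a = 0" and y: "\<And>s. s \<in> {a..b} \<Longrightarrow>
      (y has_real_derivative l * n s - (cut (y s))\<^sup>2 / 2) (at s within {a..b})"
  proof (rule global_ode_existence[where a = a and b = b and L = R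
        and F = "\<lambda>s z. l * n s - (cut z)\<^sup>2 / 2"])
    show "continuous_on {a..b} (\<lambda>t. l * n t - (cut (y t))\<^sup>2 / 2)" if "continuous_on {a..b} y" for y
      unfolding cut_def by (intro continuous_intros n that) auto
    show "\<bar>l * n t - (cut y)\<^sup>2 / 2 - (l * n t - (cut z)\<^sup>2 / 2)\<bar> \<le> R * \<bar>y - z\<bar>" for t y z
      using cut_lip[of z y] by (simp add: abs_minus_commute)
  qed (use \<open>a < b\<close> \<open>0 < R\<close> in auto)
  have y_at: "(y has_real_derivative l * n s - (cut (y s))\<^sup>2 / 2) (at s)" if "a < s" "s < b" for s
    using y[of s] that by (simp add: at_within_Icc_at)
  have yc: "continuous_on {a..b} y" using y by (rule DERIV_continuous_on)
  have upper: "y t < R" if t: "t \<in> {a..b}" for t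
  proof -
    have "0 \<le> M * (t - a) - y t"
    proof (rule ode_lower_barrier[where d = "\<lambda>s. M * (s - a) - y s" and a = a and b = b and L = 0])
      show "continuous_on {a..b} (\<lambda>s. M * (s - a) - y s)" by (intro continuous_intros yc)
      fix s assume s: "a < s" "s < b"
      have "((\<lambda>s. M * (s - a) - y s) has_real_derivative
          M - (l * n s - (cut (y s))\<^sup>2 / 2)) (at s)"
        by (auto intro!: derivative_eq_intros y_at s)
      moreover have "\<bar>l * n s\<bar> \<le> M" using M[of s] s by simp
      then have "0 \<le> M - (l * n s - (cut (y s))\<^sup>2 / 2)"
        using zero_le_power2[of "cut (y s)"] unfolding abs_le_iff by linarith
      ultimately show "\<exists>D. ((\<lambda>s. M * (s - a) - y s) has_real_derivative D) (at s) \<and>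
          0 * (M * (s - a) - y s) \<le> D" by auto
    qed (use t y0 in auto)
    moreover have "M * (t - a) \<le> M * (b - a)" using t \<open>1 \<le> M\<close> by simp
    ultimately show ?thesis using R by linarith
  qed
  have above: "v t \<le> y t" if t: "t \<in> {a..<b}" for t
  proof -
    have "0 \<le> y t - v t"
    proof (rule ode_lower_barrier[where d = "\<lambda>s. y s - v s" and a = a and b = t and L = R])
      have "{a..t} \<subseteq> {a..<b}" "{a..t} \<subseteq> {a..b}" using t by auto
      then show "continuous_on {a..t} (\<lambda>s. y s - v s)"
        using yc v(1) by (intro continuous_intros) (auto intro: continuous_on_subset)
      fix s assume s: "a < s" "s < t" and neg: "y s - v s < 0"
      obtain D where D: "(v has_real_derivative D) (at s)" "D \<le> l * n s - (v s)\<^sup>2 / 2"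
        using sub[of s] s t by auto
      have vs: "\<bar>v s\<bar> \<le> R" using vR[of s] s t by auto
      have "cut (v s) = v s" using vs by (auto simp: cut_def)
      then have "R * (y s - v s) \<le> (v s)\<^sup>2 / 2 - (cut (y s))\<^sup>2 / 2"
        using cut_lip[of "v s" "y s"] neg by (simp add: algebra_simps abs_if split: if_splits)
      then have "R * (y s - v s) \<le> l * n s - (cut (y s))\<^sup>2 / 2 - D" using D by linarith
      moreover have "((\<lambda>s. y s - v s) has_real_derivative l * n s - (cut (y s))\<^sup>2 / 2 - D) (at s)"
        using s t by (intro DERIV_diff y_at D(1)) auto
      ultimately show "\<exists>D. ((\<lambda>s. y s - v s) has_real_derivative D) (at s) \<and> R * (y s - v s) \<le> D"
        by blast
    qed (use t y0 v(2) in auto)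
    then show ?thesis by simp
  qed
  have "- R \<le> y t" if t: "t \<in> {a..b}" for t
  proof (cases "t = b")
    case False
    then show ?thesis using above[of t] vR[of t] t by auto
  next
    case True
    \<comment> \<open>The subsolution is not controlled at \<open>b\<close>, so the lower bound is
      carried there by continuity of \<open>y\<close>.\<close>
    have "(y \<longlongrightarrow> y b) (at b within {a..b})" using yc t True by (auto simp: continuous_on)
    then have "(y \<longlongrightarrow> y b) (at b within {a..<b})"
      by (rule tendsto_within_subset) auto
    moreover have "- R \<le> y s" if "s \<in> {a..<b}" for s
      using above[OF that] vR[OF that] by linarith
    then have "eventually (\<lambda>s. - R \<le> y s) (at b within {a..<b})"
      by (auto simp: eventually_at_filter intro!: always_eventually)
    moreover have "{a..<b} - {b} = {a..<b}" by auto
    then have "at b within {a..<b} \<noteq> bot"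
      using \<open>a < b\<close> by (simp add: at_within_eq_bot_iff)
    ultimately show ?thesis using True tendsto_lowerbound by blast
  qed
  then have "cut (y t) = y t" if "t \<in> {a..b}" for t
    using upper that by (force simp: cut_def)
  then have "riccati a b n l y" using y y0 by (simp add: riccati_def)
  then show ?thesis by blast
qed

text \<open>Comparison in both directions. The competitor \<open>v\<close> is only assumed bounded
  on the half-open interval, which is what a given flow provides; the lemma identifies it with a
  solution that is regular up to \<open>b\<close>.\<close>

lemma riccati_unique:
  assumes y: "riccati a b n l y"
    and v: "continuous_on {a..<b} v" "v a = 0" and bound: "\<And>s. s \<in> {a..<b} \<Longrightarrow> \<bar>v s\<bar> \<le> B"
    and ode: "\<And>s. a < s \<Longrightarrow> s < b \<Longrightarrow> (v has_real_derivative l * n s - (v s)\<^sup>2 / 2) (at s)"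
    and t: "t \<in> {a..<b}"
  shows "v t = y t"
proof -
  obtain R where R: "\<And>s. s \<in> {a..b} \<Longrightarrow> \<bar>y s\<bar> \<le> R"
    using continuous_abs_bound[OF riccati_continuous[OF y]] by metis
  have b: "\<bar>v s\<bar> \<le> max B R" "\<bar>y s\<bar> \<le> max B R" if "s \<in> {a..<b}" for s
    using bound[of s] R[of s] that by (auto simp: le_max_iff_disj)
  have c: "continuous_on {a..<b} y"
    by (rule continuous_on_subset[OF riccati_continuous[OF y]]) auto
  have 0: "y a = 0" using y by (simp add: riccati_def)
  note d = riccati_deriv_at[OF y]
  have "v t \<le> y t"
    by (rule riccati_comparison[where g = "\<lambda>s. l * n s", OF v(1) c _ b])
      (use 0 v(2) d ode t in \<open>auto intro: order_refl\<close>)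
  moreover have "y t \<le> v t"
    by (rule riccati_comparison[where g = "\<lambda>s. l * n s", OF c v(1) _ b(2,1)])
      (use 0 v(2) d ode t in \<open>auto intro: order_refl\<close>)
  ultimately show ?thesis by simp
qed

text \<open>Convexity of the square makes a convex combination of two solutions a subsolution.\<close>

lemma riccati_convex:
  assumes "a < b" and n: "continuous_on {a..b} n"
    and y: "riccati a b n l1 y1" "riccati a b n l2 y2" and l: "l1 \<le> l" "l \<le> l2"
  shows "\<exists>y. riccati a b n l y"
proof -
  obtain t where t: "0 \<le> t" "t \<le> 1" "l = (1 - t) * l1 + t * l2"
  proof (cases "l1 = l2")
    case True
    then show ?thesis using l that[of 0] by simp
  next
    case False
    then have "0 < l2 - l1" using l by simp
    then have "(l - l1) / (l2 - l1) * (l2 - l1) = l - l1" by simp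
    then have "l = (1 - (l - l1) / (l2 - l1)) * l1 + (l - l1) / (l2 - l1) * l2"
      by (simp only: left_diff_distrib right_diff_distrib)
    then show ?thesis
      using l \<open>0 < l2 - l1\<close> that[of "(l - l1) / (l2 - l1)"] by simp
  qed
  define v where "v s = (1 - t) * y1 s + t * y2 s" for s
  have vc: "continuous_on {a..b} v"
    unfolding v_def by (intro continuous_intros riccati_continuous[OF y(1)] riccati_continuous[OF y(2)])
  then obtain B where B: "\<And>s. s \<in> {a..b} \<Longrightarrow> \<bar>v s\<bar> \<le> B"
    using continuous_abs_bound by metis
  show ?thesis
  proof (rule riccati_of_subsolution[OF \<open>a < b\<close> n, of v B l])
    show "continuous_on {a..<b} v" by (rule continuous_on_subset[OF vc]) auto
    show "v a \<le> 0" using y by (simp add: v_def riccati_def)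
    show "\<bar>v s\<bar> \<le> B" if "s \<in> {a..<b}" for s using B that by auto
    fix s assume s: "a < s" "s < b"
    let ?D = "(1 - t) * (l1 * n s - (y1 s)\<^sup>2 / 2) + t * (l2 * n s - (y2 s)\<^sup>2 / 2)"
    have D: "(v has_real_derivative ?D) (at s)"
      unfolding v_def
      by (auto intro!: derivative_eq_intros riccati_deriv_at[OF y(1) s] riccati_deriv_at[OF y(2) s])
    have "0 \<le> t * (1 - t) * (y1 s - y2 s)\<^sup>2" using t by simp
    moreover have "l * n s - (v s)\<^sup>2 / 2 - ?D = t * (1 - t) * (y1 s - y2 s)\<^sup>2 / 2"
      unfolding t(3) v_def by (simp add: power2_eq_square field_simps)
    ultimately have "?D \<le> l * n s - (v s)\<^sup>2 / 2" by linarith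
    then show "\<exists>D. (v has_real_derivative D) (at s) \<and> D \<le> l * n s - (v s)\<^sup>2 / 2" using D by blast
  qed
qed

lemma riccati_nonneg:
  assumes "a < b" and n: "continuous_on {a..b} n" and "\<And>s. a < s \<Longrightarrow> s < b \<Longrightarrow> 0 \<le> l * n s"
  shows "\<exists>y. riccati a b n l y"
proof (rule riccati_of_subsolution[OF assms(1,2), of "\<lambda>s. 0" 0 l])
  show "\<exists>D. ((\<lambda>s. 0) has_real_derivative D) (at s) \<and> D \<le> l * n s - 0\<^sup>2 / 2" if "a < s" "s < b" for s
    using assms(3)[OF that] by (intro exI[of _ 0]) auto
qed auto

text \<open>The linearized equation with source \<open>- 1\<close> has a global solution
  \<open>w\<close>, and \<open>y + \<delta> w\<close> is a strict subsolution for small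
  \<open>\<delta>\<close>: its slack is \<open>\<delta> - \<delta>^2 w^2 / 2\<close>. The slack
  absorbs a small change of \<open>l\<close>.\<close>

lemma riccati_open:
  assumes "a < b" and n: "continuous_on {a..b} n" and y: "riccati a b n l y"
  obtains e where "0 < e" "\<And>k. \<bar>k - l\<bar> \<le> e \<Longrightarrow> \<exists>z. riccati a b n k z"
proof -
  have yc: "continuous_on {a..b} y" by (rule riccati_continuous[OF y])
  obtain R where "1 \<le> R" and R: "\<And>s. s \<in> {a..b} \<Longrightarrow> \<bar>y s\<bar> \<le> R"
    using continuous_abs_bound[OF yc] by metis
  obtain M where "1 \<le> M" and M: "\<And>s. s \<in> {a..b} \<Longrightarrow> \<bar>n s\<bar> \<le> M"
    using continuous_abs_bound[OF n] by metis
  obtain w where w0: "w a = 0" and w: "\<And>s. s \<in> {a..b} \<Longrightarrow>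
      (w has_real_derivative - 1 - y s * w s) (at s within {a..b})"
  proof (rule global_ode_existence[where a = a and b = b and L = R and F = "\<lambda>s z. - 1 - y s * z"])
    show "continuous_on {a..b} (\<lambda>t. - 1 - y t * z t)" if "continuous_on {a..b} z" for z
      by (intro continuous_intros yc that)
    show "\<bar>- 1 - y t * u - (- 1 - y t * z)\<bar> \<le> R * \<bar>u - z\<bar>" if "t \<in> {a..b}" for t u z
    proof -
      have "\<bar>- 1 - y t * u - (- 1 - y t * z)\<bar> = \<bar>y t\<bar> * \<bar>u - z\<bar>"
        by (subst abs_mult[symmetric], subst abs_minus_commute) (simp add: right_diff_distrib)
      then show ?thesis using R[OF that] by (simp add: mult_right_mono)
    qed
  qed (use \<open>a < b\<close> \<open>1 \<le> R\<close> in auto)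
  have wc: "continuous_on {a..b} w" using w by (rule DERIV_continuous_on)
  obtain W where "1 \<le> W" and W: "\<And>s. s \<in> {a..b} \<Longrightarrow> \<bar>w s\<bar> \<le> W"
    using continuous_abs_bound[OF wc] by metis
  \<comment> \<open>With this value the quadratic loss \<open>\<delta>^2 w^2 / 2\<close> is at most
    \<open>\<delta> / 2\<close>, and the other half of \<open>\<delta>\<close> pays for
    \<open>\<bar>k - l\<bar> * M\<close>.\<close>
  define \<delta> where "\<delta> = 1 / W\<^sup>2"
  have \<delta>: "0 < \<delta>" "\<delta> * W\<^sup>2 = 1" using \<open>1 \<le> W\<close> by (auto simp: \<delta>_def)
  show ?thesis
  proof (rule that[of "\<delta> / (2 * M)"])
    show "0 < \<delta> / (2 * M)" using \<delta> \<open>1 \<le> M\<close> by simp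
    fix k assume k: "\<bar>k - l\<bar> \<le> \<delta> / (2 * M)"
    define v where "v s = y s + \<delta> * w s" for s
    have vc: "continuous_on {a..b} v" unfolding v_def by (intro continuous_intros yc wc)
    then obtain B where B: "\<And>s. s \<in> {a..b} \<Longrightarrow> \<bar>v s\<bar> \<le> B"
      using continuous_abs_bound by metis
    show "\<exists>z. riccati a b n k z"
    proof (rule riccati_of_subsolution[OF \<open>a < b\<close> n, of v B k])
      show "continuous_on {a..<b} v" by (rule continuous_on_subset[OF vc]) auto
      show "v a \<le> 0" using y w0 by (simp add: v_def riccati_def)
      show "\<bar>v s\<bar> \<le> B" if "s \<in> {a..<b}" for s using B that by auto
      fix s assume s: "a < s" "s < b"
      have w_at: "(w has_real_derivative - 1 - y s * w s) (at s)"
        using w[of s] s by (simp add: at_within_Icc_at)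
      let ?D = "l * n s - (y s)\<^sup>2 / 2 + \<delta> * (- 1 - y s * w s)"
      have "(v has_real_derivative ?D) (at s)"
        unfolding v_def
        by (auto intro!: derivative_eq_intros riccati_deriv_at[OF y s] w_at)
      note D = this
      have "\<bar>(k - l) * n s\<bar> \<le> \<delta> / (2 * M) * M"
        unfolding abs_mult using k M[of s] s by (intro mult_mono) auto
      then have kn: "- (\<delta> / 2) \<le> (k - l) * n s" using \<open>1 \<le> M\<close> by simp
      have "(w s)\<^sup>2 \<le> W\<^sup>2" using W[of s] s \<open>1 \<le> W\<close> by (simp add: abs_le_square_iff[symmetric])
      then have "\<delta> * (\<delta> * (w s)\<^sup>2) \<le> \<delta> * (\<delta> * W\<^sup>2)" using \<delta> by (intro mult_left_mono) auto
      then have "\<delta> * (\<delta> * (w s)\<^sup>2) \<le> \<delta>" using \<delta> by simp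
      moreover have "k * n s - (v s)\<^sup>2 / 2 - ?D = (k - l) * n s + \<delta> - \<delta> * (\<delta> * (w s)\<^sup>2) / 2"
        unfolding v_def by (simp add: power2_eq_square field_simps)
      ultimately have "?D \<le> k * n s - (v s)\<^sup>2 / 2"
        using kn by linarith
      then show "\<exists>D. (v has_real_derivative D) (at s) \<and> D \<le> k * n s - (v s)\<^sup>2 / 2" using D by blast
    qed
  qed
qed

text \<open>Where \<open>n\<close> is at least \<open>e > 0\<close>, the function \<open>arctan (y / k)\<close> with \<open>k\<^sup>2 = - 2 l e\<close> decreases at rate
  at least \<open>k / 2\<close>, while its total variation is less than \<open>pi\<close>.\<close>

lemma riccati_bounded_below:
  assumes n: "continuous_on {a..b} n" and s: "a < s" "s < b" "0 < n s"
  shows "\<exists>L. \<forall>l y. riccati a b n l y \<longrightarrow> L \<le> l"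
proof -
  have "isCont n s" using n by (rule continuous_on_interior) (use s in simp)
  then obtain d where "d > 0" and d: "\<And>t. \<bar>t - s\<bar> < d \<Longrightarrow> \<bar>n t - n s\<bar> < n s / 2"
    using s unfolding continuous_at_eps_delta dist_real_def
    by (metis half_gt_zero)
  define h where "h = min (d / 2) (min ((s - a) / 2) ((b - s) / 2))"
  have h: "0 < h" "h < d" "a < s - h" "s + h < b"
    using \<open>d > 0\<close> s by (auto simp: h_def min_def field_simps)
  define e where "e = n s / 2"
  have e: "0 < e" using s by (simp add: e_def)
  have ne: "e \<le> n t" if "t \<in> {s - h..s + h}" for t
  proof -
    have "\<bar>t - s\<bar> < d" using that h by auto
    then show ?thesis using d[of t] by (simp add: e_def abs_if split: if_splits)
  qed
  show ?thesis
  \<comment> \<open>Below this value \<open>k = sqrt (- 2 l e)\<close> exceeds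
    \<open>pi / h\<close>. The interval around \<open>s\<close> has length \<open>2 h\<close>, so
    the arctangent would drop by at least \<open>k h > pi\<close>.\<close>
  proof (intro exI[of _ "- (pi / h)\<^sup>2 / (2 * e)"] allI impI)
    fix l y assume y: "riccati a b n l y"
    show "- (pi / h)\<^sup>2 / (2 * e) \<le> l"
    proof (rule ccontr)
      assume "\<not> - (pi / h)\<^sup>2 / (2 * e) \<le> l"
      then have "l * (2 * e) < - (pi / h)\<^sup>2"
        using e pos_less_divide_eq[of "2 * e" l "- (pi / h)\<^sup>2"] by (simp add: not_le del: power_divide)
      then have l: "(pi / h)\<^sup>2 < - 2 * l * e" by (simp add: algebra_simps del: power_divide)
      define k where "k = sqrt (- 2 * l * e)"
      have "0 \<le> (pi / h)\<^sup>2" by (rule zero_le_power2)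
      then have le: "0 < - 2 * l * e" using l by linarith
      then have k2: "k\<^sup>2 = - 2 * l * e" by (simp only: k_def real_sqrt_pow2 less_imp_le)
      have k: "pi / h < k" unfolding k_def using l by (rule real_less_rsqrt)
      have "0 < k" using le by (simp only: k_def real_sqrt_gt_zero)
      have "l \<le> 0" using le e mult_nonneg_nonneg[of l e] by linarith
      have "arctan (y (s + h) / k) + k / 2 * (s + h) \<le> arctan (y (s - h) / k) + k / 2 * (s - h)"
      proof (rule DERIV_nonpos_imp_nonincreasing[where f = "\<lambda>t. arctan (y t / k) + k / 2 * t"])
        fix t assume t: "s - h \<le> t" "t \<le> s + h"
        let ?y' = "l * n t - (y t)\<^sup>2 / 2" and ?i = "inverse (1 + (y t / k)\<^sup>2)"
        have "(y has_real_derivative ?y') (at t)"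
          by (rule riccati_deriv_at[OF y]) (use t h in auto)
        then have "((\<lambda>t. arctan (y t / k)) has_real_derivative ?i * (?y' / k)) (at t)"
          by (intro DERIV_chain2[OF DERIV_arctan] DERIV_cdivide)
        then have "((\<lambda>t. arctan (y t / k) + k / 2 * t) has_real_derivative ?i * (?y' / k) + k / 2) (at t)"
          by (intro DERIV_add DERIV_cmult_Id)
        moreover have "l * n t \<le> l * e"
          using ne[of t] t \<open>l \<le> 0\<close> by (simp add: mult_left_mono_neg)
        then have y': "?y' \<le> - ((k\<^sup>2 + (y t)\<^sup>2) / 2)" using k2 by (simp add: field_simps)
        have "0 < 1 + (y t / k)\<^sup>2" by (simp add: add_pos_nonneg)
        then have "?i * (?y' / k) \<le> ?i * (- ((k\<^sup>2 + (y t)\<^sup>2) / 2) / k)"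
          using y' \<open>0 < k\<close> by (intro mult_left_mono divide_right_mono) auto
        moreover have "?i * (- ((k\<^sup>2 + (y t)\<^sup>2) / 2) / k) = - (k / 2)"
        proof -
          have pos: "0 < k\<^sup>2 + (y t)\<^sup>2" using \<open>0 < k\<close> by (simp add: add_pos_nonneg)
          have "1 + (y t / k)\<^sup>2 = (k\<^sup>2 + (y t)\<^sup>2) / k\<^sup>2"
            using \<open>0 < k\<close> by (simp add: add_divide_distrib power_divide)
          then show ?thesis using pos \<open>0 < k\<close> by (simp add: power2_eq_square)
        qed
        ultimately show "\<exists>D. ((\<lambda>t. arctan (y t / k) + k / 2 * t) has_real_derivative D) (at t) \<and> D \<le> 0"
          by (intro exI[of _ "?i * (?y' / k) + k / 2"]) linarith
      qed (use h in auto)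
      then have "k * h \<le> arctan (y (s - h) / k) - arctan (y (s + h) / k)"
        by (simp add: field_simps)
      also have "\<dots> < pi" using arctan_ubound[of "y (s - h) / k"] arctan_lbound[of "y (s + h) / k"]
        by linarith
      finally show False using k h by (simp add: field_simps)
    qed
  qed
qed

text \<open>This symmetry turns the lower bound on solvable parameters into an upper bound when
  \<open>n\<close> is negative somewhere.\<close>

lemma riccati_uminus: "riccati a b (\<lambda>s. - n s) l y \<longleftrightarrow> riccati a b n (- l) y"
  by (simp add: riccati_def)

text \<open>The thresholds are infimum and supremum, in \<open>ereal\<close>, of the set of solvable
  parameters; openness shows that they are not attained, convexity that nothing between them is
  missing. One sign of \<open>n\<close> gives a whole half-line of solvable parameters, and a single
  point of the other sign excludes it.\<close>

lemma riccati_thresholds: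
  assumes "a < b" and n: "continuous_on {a..b} n"
  obtains lo hi :: ereal where "lo < 0" "0 < hi"
    and "\<And>l. (\<exists>y. riccati a b n l y) \<longleftrightarrow> lo < ereal l \<and> ereal l < hi"
    and "lo = - \<infinity> \<longleftrightarrow> (\<forall>s. a < s \<longrightarrow> s < b \<longrightarrow> n s \<le> 0)"
    and "hi = \<infinity> \<longleftrightarrow> (\<forall>s. a < s \<longrightarrow> s < b \<longrightarrow> 0 \<le> n s)"
proof -
  define S where "S = {l. \<exists>y. riccati a b n l y}"
  define lo hi where "lo = Inf (ereal ` S)" and "hi = Sup (ereal ` S)"
  have n': "continuous_on {a..b} (\<lambda>s. - n s)" by (intro continuous_intros n)
  have between: "lo < ereal l \<and> ereal l < hi" if l: "l \<in> S" for l
  proof -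
    obtain y where "riccati a b n l y" using l by (auto simp: S_def)
    then obtain e where "0 < e" and e: "\<And>k. \<bar>k - l\<bar> \<le> e \<Longrightarrow> \<exists>z. riccati a b n k z"
      using riccati_open[OF assms] by metis
    then have "l - e \<in> S" "l + e \<in> S" by (auto simp: S_def)
    then have "lo \<le> ereal (l - e)" "ereal (l + e) \<le> hi"
      by (auto simp: lo_def hi_def intro: Inf_lower Sup_upper)
    moreover have "ereal (l - e) < ereal l" "ereal l < ereal (l + e)" using \<open>0 < e\<close> by auto
    ultimately show ?thesis by (meson order_le_less_trans order_less_le_trans)
  qed
  have inside: "l \<in> S" if l: "lo < ereal l" "ereal l < hi" for l
  proof -
    obtain l1 l2 where "l1 \<in> S" "l1 < l" "l2 \<in> S" "l < l2"
      using l unfolding lo_def hi_def Inf_less_iff less_Sup_iff by auto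
    then show ?thesis
      using riccati_convex[OF assms, of l1 _ l2 _ l] by (auto simp: S_def)
  qed
  have "0 \<in> S" using riccati_nonneg[OF assms, of 0] by (auto simp: S_def)
  show ?thesis
  proof
    show "lo < 0" "0 < hi" using between[OF \<open>0 \<in> S\<close>] unfolding zero_ereal_def by auto
    show "(\<exists>y. riccati a b n l y) \<longleftrightarrow> lo < ereal l \<and> ereal l < hi" for l
      using between[of l] inside[of l] by (auto simp: S_def)
    show "lo = - \<infinity> \<longleftrightarrow> (\<forall>s. a < s \<longrightarrow> s < b \<longrightarrow> n s \<le> 0)"
    proof
      assume lo: "lo = - \<infinity>"
      show "\<forall>s. a < s \<longrightarrow> s < b \<longrightarrow> n s \<le> 0"
      proof (rule ccontr)
        assume "\<not> ?thesis"
        then obtain s where s: "a < s" "s < b" "0 < n s" by (auto simp: not_le)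
        obtain L where "\<forall>l y. riccati a b n l y \<longrightarrow> L \<le> l"
          using riccati_bounded_below[OF n s] ..
        then have "ereal L \<le> lo" unfolding lo_def by (intro Inf_greatest) (auto simp: S_def)
        then show False using lo by simp
      qed
    next
      assume neg: "\<forall>s. a < s \<longrightarrow> s < b \<longrightarrow> n s \<le> 0"
      have le: "lo \<le> ereal l" if "l \<le> 0" for l
      proof -
        have "l \<in> S"
          unfolding S_def mem_Collect_eq
          by (rule riccati_nonneg[OF assms]) (use neg that in \<open>simp add: mult_nonpos_nonpos\<close>)
        then show ?thesis unfolding lo_def by (intro Inf_lower imageI)
      qed
      have "lo \<le> ereal l" for l
        by (rule order_trans[OF le[of "- \<bar>l\<bar>"]]) auto
      then show "lo = - \<infinity>" by (rule ereal_bot)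
    qed
    show "hi = \<infinity> \<longleftrightarrow> (\<forall>s. a < s \<longrightarrow> s < b \<longrightarrow> 0 \<le> n s)"
    proof
      assume hi: "hi = \<infinity>"
      show "\<forall>s. a < s \<longrightarrow> s < b \<longrightarrow> 0 \<le> n s"
      proof (rule ccontr)
        assume "\<not> ?thesis"
        then obtain s where s: "a < s" "s < b" "0 < - n s" by (auto simp: not_le)
        obtain L where L: "\<forall>l y. riccati a b (\<lambda>s. - n s) l y \<longrightarrow> L \<le> l"
          using riccati_bounded_below[OF n' s] ..
        have "ereal l \<le> ereal (- L)" if l: "l \<in> S" for l
        proof -
          obtain y where "riccati a b n l y" using l unfolding S_def by blast
          then have "riccati a b (\<lambda>s. - n s) (- l) y" unfolding riccati_uminus by simp
          then show ?thesis using L[rule_format, of "- l" y] by simp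
        qed
        then have "hi \<le> ereal (- L)" unfolding hi_def by (intro Sup_least) blast
        then show False using hi by simp
      qed
    next
      assume pos: "\<forall>s. a < s \<longrightarrow> s < b \<longrightarrow> 0 \<le> n s"
      have le: "ereal l \<le> hi" if "0 \<le> l" for l
      proof -
        have "l \<in> S"
          unfolding S_def mem_Collect_eq by (rule riccati_nonneg[OF assms]) (use pos that in simp)
        then show ?thesis unfolding hi_def by (intro Sup_upper imageI)
      qed
      have "ereal l \<le> hi" for l
        by (rule order_trans[OF _ le[of "\<bar>l\<bar>"]]) auto
      then show "hi = \<infinity>" by (rule ereal_top)
    qed
  qed
qed

section \<open>The cone in terms of the cosine of the polar angle\<close>

text \<open>The cosine of the polar angle, which is the variable \<open>s\<close> of all profiles.
  Its value at the origin is 0 because of \<open>x / 0 = 0\<close>.\<close>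

definition cosang :: "real^3 \<Rightarrow> real" where
  "cosang x = x $ 3 / norm x"

lemma norm_sq_3: "(norm x)\<^sup>2 = (x $ 1)\<^sup>2 + (x $ 2)\<^sup>2 + (x $ 3)\<^sup>2" for x :: "real^3"
  by (simp add: norm_vec_def L2_set_def sum_3 add_nonneg_nonneg)

lemma abs_cosang_le: "\<bar>cosang x\<bar> \<le> 1"
  using component_le_norm_cart[of x 3] by (cases "x = 0") (auto simp: cosang_def divide_le_eq)

lemma cosang_le: "cosang x \<le> 1" and cosang_ge: "- 1 \<le> cosang x"
  using abs_cosang_le[of x] by (auto simp: abs_le_iff)

lemma x3_eq: "x $ 3 = norm x * cosang x"
  by (simp add: cosang_def)

lemma x12_sq: "(x $ 1)\<^sup>2 + (x $ 2)\<^sup>2 = (norm x)\<^sup>2 * (1 - (cosang x)\<^sup>2)"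
  using norm_sq_3[of x] x3_eq[of x] by (simp add: power_mult_distrib algebra_simps)

lemma spherical_nth [simp]:
  "spherical \<rho> \<phi> \<theta> $ 1 = \<rho> * sin \<phi> * cos \<theta>" "spherical \<rho> \<phi> \<theta> $ 2 = \<rho> * sin \<phi> * sin \<theta>"
  "spherical \<rho> \<phi> \<theta> $ 3 = \<rho> * cos \<phi>"
  by (simp_all add: spherical_def)

lemma spherical_axis: "spherical \<rho> \<phi> \<theta> = (\<rho> * sin \<phi> * cos \<theta>) *\<^sub>R axis 1 1 +
    (\<rho> * sin \<phi> * sin \<theta>) *\<^sub>R axis 2 1 + (\<rho> * cos \<phi>) *\<^sub>R axis 3 1"
  by (simp add: vec_eq_iff forall_3 axis_def)

lemma norm_spherical: "0 < \<rho> \<Longrightarrow> norm (spherical \<rho> \<phi> \<theta>) = \<rho>"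
proof -
  assume "0 < \<rho>"
  have "(norm (spherical \<rho> \<phi> \<theta>))\<^sup>2 = \<rho>\<^sup>2 * ((sin \<phi>)\<^sup>2 * ((cos \<theta>)\<^sup>2 + (sin \<theta>)\<^sup>2) + (cos \<phi>)\<^sup>2)"
    unfolding norm_sq_3 by (simp add: power_mult_distrib distrib_left del: sin_cos_squared_add sin_cos_squared_add2)
  also have "\<dots> = \<rho>\<^sup>2" by simp
  finally show ?thesis using \<open>0 < \<rho>\<close> by (simp add: power2_eq_iff_nonneg)
qed

lemma cosang_spherical: "0 < \<rho> \<Longrightarrow> cosang (spherical \<rho> \<phi> \<theta>) = cos \<phi>"
  by (simp add: cosang_def norm_spherical)

lemma spherical_coordinates:
  assumes "x \<noteq> 0"
  obtains \<theta> where "0 < \<theta>" "\<theta> \<le> 2 * pi" "x = spherical (norm x) (arccos (cosang x)) \<theta>"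
proof -
  let ?s = "cosang x" and ?r = "norm x"
  let ?q = "?r * sqrt (1 - ?s\<^sup>2)"
  have r: "0 < ?r" using assms by simp
  have s2: "?s\<^sup>2 \<le> 1" using abs_cosang_le[of x] by (simp add: abs_square_le_1)
  have sin: "sin (arccos ?s) = sqrt (1 - ?s\<^sup>2)" and cos: "cos (arccos ?s) = ?s"
    using cosang_le[of x] cosang_ge[of x] by (simp_all add: sin_arccos_abs cos_arccos_abs abs_cosang_le)
  have q2: "(x $ 1)\<^sup>2 + (x $ 2)\<^sup>2 = ?q\<^sup>2"
    using x12_sq[of x] s2 by (simp add: power_mult_distrib)
  have q0: "0 \<le> ?q" using s2 by simp
  have "\<exists>\<theta>. 0 < \<theta> \<and> \<theta> \<le> 2 * pi \<and> x $ 1 = ?q * cos \<theta> \<and> x $ 2 = ?q * sin \<theta>"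
  proof (cases "?q = 0")
    case True
    then have "(x $ 1)\<^sup>2 + (x $ 2)\<^sup>2 = 0" using q2 by simp
    then have "x $ 1 = 0" "x $ 2 = 0" by (auto simp: sum_power2_eq_zero_iff)
    then show ?thesis using True pi_gt_zero by (intro exI[of _ pi]) auto
  next
    case False
    then have "(x $ 1 / ?q)\<^sup>2 + (x $ 2 / ?q)\<^sup>2 = 1"
      using q2 by (simp add: power_divide flip: add_divide_distrib)
    then obtain t where t: "0 \<le> t" "t < 2 * pi" "x $ 1 / ?q = cos t" "x $ 2 / ?q = sin t"
      by (rule sincos_total_2pi)
    then have "x $ 1 = ?q * cos t" "x $ 2 = ?q * sin t" using False by (metis nonzero_mult_div_cancel_left times_divide_eq_right)+
    \<comment> \<open>Longitudes range over the interval from 0 to \<open>2 * pi\<close> that is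
      open on the left, so the angle 0 is replaced by \<open>2 * pi\<close>.\<close>
    then show ?thesis
      using t by (cases "t = 0") (auto intro: exI[of _ "2 * pi"] exI[of _ t])
  qed
  then obtain \<theta> where \<theta>: "0 < \<theta>" "\<theta> \<le> 2 * pi" "x $ 1 = ?q * cos \<theta>" "x $ 2 = ?q * sin \<theta>"
    by blast
  have "x = spherical ?r (arccos ?s) \<theta>"
    unfolding vec_eq_iff forall_3 spherical_nth sin cos using \<theta> x3_eq[of x] by simp
  with \<theta> show ?thesis using that by blast
qed

lemma solid_cone_eq:
  assumes "0 < \<phi>0" "\<phi>0 < pi"
  shows "solid_cone \<phi>0 = {x. x \<noteq> 0 \<and> cos \<phi>0 \<le> cosang x}"
proof (intro set_eqI iffI)
  fix x assume "x \<in> solid_cone \<phi>0"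
  then obtain \<rho> \<phi> \<theta> where x: "x = spherical \<rho> \<phi> \<theta>" "0 < \<rho>" "0 \<le> \<phi>" "\<phi> \<le> \<phi>0"
    by (auto simp: solid_cone_def cone_coords_def)
  then have "norm x \<noteq> 0" by (simp add: norm_spherical)
  moreover have "cos \<phi>0 \<le> cos \<phi>" using x assms by (intro cos_monotone_0_pi_le) auto
  ultimately show "x \<in> {x. x \<noteq> 0 \<and> cos \<phi>0 \<le> cosang x}" using x by (auto simp: cosang_spherical)
next
  fix x assume "x \<in> {x. x \<noteq> 0 \<and> cos \<phi>0 \<le> cosang x}"
  then have x: "x \<noteq> 0" "cos \<phi>0 \<le> cosang x" by auto
  obtain \<theta> where \<theta>: "0 < \<theta>" "\<theta> \<le> 2 * pi" "x = spherical (norm x) (arccos (cosang x)) \<theta>"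
    using spherical_coordinates[OF x(1)] by blast
  have "arccos (cosang x) \<le> arccos (cos \<phi>0)"
    using x cosang_le[of x] by (intro arccos_le_arccos) auto
  then have "arccos (cosang x) \<le> \<phi>0" using assms by (simp add: arccos_cos)
  moreover have "0 \<le> arccos (cosang x)" using cosang_le cosang_ge by (intro arccos_lbound)
  ultimately have "(norm x, arccos (cosang x), \<theta>) \<in> cone_coords \<phi>0"
    using \<theta> x by (simp add: cone_coords_def)
  then show "x \<in> solid_cone \<phi>0"
    unfolding solid_cone_def using \<theta>(3) by (intro image_eqI[where x = "(norm x, arccos (cosang x), \<theta>)"]) auto
qed

lemma continuous_on_cosang: "continuous_on (- {0}) cosang"
  unfolding cosang_def by (intro continuous_intros) auto

lemma continuous_on_cosang_comp [continuous_intros]: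
  "continuous_on S f \<Longrightarrow> (\<And>x. x \<in> S \<Longrightarrow> f x \<noteq> 0) \<Longrightarrow> continuous_on S (\<lambda>x. cosang (f x))"
  by (rule continuous_on_compose2[OF continuous_on_cosang]) auto

lemma open_cosang:
  assumes "open A" shows "open {x. x \<noteq> 0 \<and> cosang x \<in> A}"
proof -
  have "open (- {0} \<inter> cosang -` A)"
    using continuous_on_cosang assms by (intro continuous_open_preimage) auto
  moreover have "- {0} \<inter> cosang -` A = {x. x \<noteq> 0 \<and> cosang x \<in> A}" by auto
  ultimately show ?thesis by simp
qed

text \<open>Rotating a boundary point away from the axis leaves the cone.\<close>

lemma cone_boundary_not_interior:
  assumes c: "- 1 < c" "c < 1" and x: "x \<noteq> 0" "cosang x = c"
  shows "x \<notin> interior {x. x \<noteq> 0 \<and> c \<le> cosang x}"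
proof
  assume "x \<in> interior {x. x \<noteq> 0 \<and> c \<le> cosang x}"
  then obtain e where e: "e > 0" "ball x e \<subseteq> {x. x \<noteq> 0 \<and> c \<le> cosang x}"
    by (auto simp: mem_interior)
  obtain \<theta> where \<theta>: "x = spherical (norm x) (arccos (cosang x)) \<theta>"
    using spherical_coordinates[OF x(1)] by blast
  let ?p = "\<lambda>t. spherical (norm x) t \<theta>"
  have "continuous (at (arccos c)) ?p"
    unfolding spherical_axis by (intro continuous_intros)
  then obtain d where d: "d > 0" "\<And>t. \<bar>t - arccos c\<bar> < d \<Longrightarrow> dist (?p t) (?p (arccos c)) < e"
    using e(1) unfolding continuous_at_eps_delta dist_real_def by blast
  have ac: "0 < arccos c" "arccos c < pi" using c arccos_lt_bounded by blast+
  define t where "t = arccos c + min (d / 2) ((pi - arccos c) / 2)"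
  have t: "\<bar>t - arccos c\<bar> < d" "arccos c < t" "t < pi" using d(1) ac by (auto simp: t_def min_def field_simps)
  have "?p t \<in> ball x e" using d(2)[OF t(1)] \<theta> x by (simp add: dist_commute)
  then have "c \<le> cosang (?p t)" using e(2) by auto
  then have "c \<le> cos t" using x by (simp add: cosang_spherical)
  moreover have "cos t < cos (arccos c)" using t ac by (intro cos_monotone_0_pi) auto
  ultimately show False using c by simp
qed

lemma interior_cone:
  assumes c: "- 1 < c" "c < 1"
  shows "interior {x. x \<noteq> 0 \<and> c \<le> cosang x} = {x. x \<noteq> 0 \<and> c < cosang x}"
proof
  show "{x. x \<noteq> 0 \<and> c < cosang x} \<subseteq> interior {x. x \<noteq> 0 \<and> c \<le> cosang x}"
    using open_cosang[of "{c<..}"] by (intro interior_maximal) auto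
  show "interior {x. x \<noteq> 0 \<and> c \<le> cosang x} \<subseteq> {x. x \<noteq> 0 \<and> c < cosang x}"
    using cone_boundary_not_interior[OF c] interior_subset
    by (smt (verit, best) Collect_mono_iff mem_Collect_eq subset_iff)
qed

text \<open>Together with its vertex the cone is the closed set
  \<open>c * norm x \<le> x $ 3\<close>. Away from the vertex its frontier is therefore the cone
  minus its interior.\<close>

lemma frontier_cone:
  assumes c: "- 1 < c" "c < 1"
  shows "frontier {x. x \<noteq> 0 \<and> c \<le> cosang x} - {0} = {x. x \<noteq> 0 \<and> cosang x = c}"
proof -
  let ?K = "{x. x \<noteq> 0 \<and> c \<le> cosang x}"
  have iff: "c \<le> cosang x \<longleftrightarrow> c * norm x \<le> x $ 3" if "x \<noteq> 0" for x
    using that by (simp add: cosang_def pos_le_divide_eq)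
  have "closed {x :: real^3. c * norm x \<le> x $ 3}" by (intro closed_Collect_le continuous_intros)
  moreover have "?K \<subseteq> {x. c * norm x \<le> x $ 3}" using iff by blast
  ultimately have "closure ?K \<subseteq> {x. c * norm x \<le> x $ 3}" by (rule closure_minimal[rotated])
  then have "closure ?K - {0} \<subseteq> ?K" using iff by blast
  then have "closure ?K - {0} = ?K" using closure_subset[of ?K] by blast
  then have "frontier ?K - {0} = ?K - {x. x \<noteq> 0 \<and> c < cosang x}"
    unfolding frontier_def interior_cone[OF c] by blast
  also have "\<dots> = {x. x \<noteq> 0 \<and> cosang x = c}" by (intro set_eqI iffI) auto
  finally show ?thesis .
qed

section \<open>Partial derivatives\<close>

text \<open>Existence and value of a partial derivative in one relation, so that the rules of
  calculus can be chained.\<close>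

definition has_pd :: "(real^3 \<Rightarrow> 'b::real_normed_vector) \<Rightarrow> 'b \<Rightarrow> 3 \<Rightarrow> real^3 \<Rightarrow> bool" where
  "has_pd f D i x \<longleftrightarrow> ((\<lambda>t. f (x + t *\<^sub>R axis i 1)) has_vector_derivative D) (at 0)"

lemma has_pd_imp_pdiff: "has_pd f D i x \<Longrightarrow> pdiff_at i f x"
  unfolding has_pd_def pdiff_at_def by (rule differentiableI_vector)

lemma has_pd_imp_pderiv: "has_pd f D i x \<Longrightarrow> pderiv_at i f x = D"
  unfolding has_pd_def pderiv_at_def by (rule vector_derivative_at)

lemma pdiff_imp_has_pd: "pdiff_at i f x \<Longrightarrow> has_pd f (pderiv_at i f x) i x"
  unfolding has_pd_def pderiv_at_def pdiff_at_def by (simp add: vector_derivative_works)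

lemma has_pd_eq_rhs: "has_pd f D i x \<Longrightarrow> D = E \<Longrightarrow> has_pd f E i x"
  by simp

lemma line_in_open:
  assumes "open S" "x \<in> S"
  obtains T where "open T" "(0::real) \<in> T" "\<And>t. t \<in> T \<Longrightarrow> x + t *\<^sub>R v \<in> (S :: 'a::real_normed_vector set)"
proof
  show "open ((\<lambda>t. x + t *\<^sub>R v) -` S)"
    using assms(1) by (intro continuous_open_vimage) (auto intro!: continuous_intros)
qed (use assms in auto)

lemma has_pd_transform:
  assumes "has_pd f D i x" "open S" "x \<in> S" "\<And>y. y \<in> S \<Longrightarrow> f y = g y"
  shows "has_pd g D i x"
proof -
  obtain T where "open T" "0 \<in> T" "\<And>t. t \<in> T \<Longrightarrow> x + t *\<^sub>R axis i 1 \<in> S"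
    using line_in_open[OF assms(2,3)] by blast
  then show ?thesis
    using assms(1,4) unfolding has_pd_def
    by (auto elim!: has_vector_derivative_transform_within_open)
qed

lemma has_pd_const [intro]: "has_pd (\<lambda>x. c) 0 i x"
  by (simp add: has_pd_def)

lemma has_pd_add: "has_pd f D i x \<Longrightarrow> has_pd g E i x \<Longrightarrow> has_pd (\<lambda>x. f x + g x) (D + E) i x"
  unfolding has_pd_def by (rule has_vector_derivative_add)

lemma has_pd_diff: "has_pd f D i x \<Longrightarrow> has_pd g E i x \<Longrightarrow> has_pd (\<lambda>x. f x - g x) (D - E) i x"
  unfolding has_pd_def by (rule has_vector_derivative_diff)

lemma has_pd_bounded_linear: "bounded_linear h \<Longrightarrow> has_pd f D i x \<Longrightarrow> has_pd (\<lambda>x. h (f x)) (h D) i x"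
  unfolding has_pd_def by (rule bounded_linear.has_vector_derivative)

lemma has_pd_scaleR:
  fixes a :: "real^3 \<Rightarrow> real"
  assumes "has_pd a A i x" "has_pd f D i x"
  shows "has_pd (\<lambda>x. a x *\<^sub>R f x) (a x *\<^sub>R D + A *\<^sub>R f x) i x"
proof -
  have a: "((\<lambda>t. a (x + t *\<^sub>R axis i 1)) has_real_derivative A) (at 0)"
    using assms(1) unfolding has_pd_def has_real_derivative_iff_has_vector_derivative .
  show ?thesis
    using has_vector_derivative_scaleR[OF a assms(2)[unfolded has_pd_def]] unfolding has_pd_def by simp
qed

lemma has_pd_mult:
  fixes a :: "real^3 \<Rightarrow> real"
  assumes "has_pd a A i x" "has_pd f D i x"
  shows "has_pd (\<lambda>x. a x * f x) (a x * D + A * f x) i x"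
  using has_pd_scaleR[OF assms] by simp

text \<open>The one-sided derivative is needed on the axis: there \<open>cosang\<close> attains its
  maximum 1, and a profile on \<open>{c..1}\<close> is differentiable at 1 only from the
  left.\<close>

lemma has_pd_compose_within:
  fixes f :: "real^3 \<Rightarrow> real"
  assumes "(a has_real_derivative d) (at (f x) within T)" "has_pd f D i x"
    and "open S" "x \<in> S" "f ` S \<subseteq> T"
  shows "has_pd (\<lambda>x. a (f x)) (d * D) i x"
proof -
  obtain U where U: "open U" "0 \<in> U" "\<And>t. t \<in> U \<Longrightarrow> x + t *\<^sub>R axis i 1 \<in> S"
    using line_in_open[OF assms(3,4)] by blast
  let ?g = "\<lambda>t. f (x + t *\<^sub>R axis i 1)"
  have g: "(?g has_real_derivative D) (at 0 within U)"
    using assms(2) unfolding has_pd_def has_real_derivative_iff_has_vector_derivative[symmetric]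
    by (rule has_field_derivative_at_within)
  have "?g t \<in> T" if "t \<in> U" for t
    using assms(5) U(3)[OF that] by (rule subsetD[OF _ imageI])
  then have "?g ` U \<subseteq> T" by (rule image_subsetI)
  then have "(a has_real_derivative d) (at (f x) within ?g ` U)"
    by (rule DERIV_subset[OF assms(1)])
  moreover have "f x = ?g 0" by simp
  ultimately have "(a has_real_derivative d) (at (?g 0) within ?g ` U)" by (simp only:)
  from DERIV_image_chain[OF this g]
  show ?thesis
    unfolding has_pd_def has_real_derivative_iff_has_vector_derivative[symmetric]
      at_within_open[OF U(2,1)] o_def .
qed

lemma has_pd_compose:
  fixes f :: "real^3 \<Rightarrow> real"
  assumes "(a has_real_derivative d) (at (f x))" "has_pd f D i x"
  shows "has_pd (\<lambda>x. a (f x)) (d * D) i x"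
  by (rule has_pd_compose_within[OF assms, of UNIV]) auto

lemma has_pd_power:
  fixes f :: "real^3 \<Rightarrow> real"
  assumes "has_pd f D i x"
  shows "has_pd (\<lambda>x. f x ^ n) (of_nat n * f x ^ (n - 1) * D) i x"
  by (rule has_pd_compose[where a = "\<lambda>t. t ^ n", OF _ assms]) (auto intro!: derivative_eq_intros)

definition kron :: "3 \<Rightarrow> 3 \<Rightarrow> real" where "kron i j = (if i = j then 1 else 0)"

lemma has_pd_coord: "has_pd (\<lambda>x. x $ j) (kron i j) i x"
proof -
  have "((\<lambda>t. x $ j + t * kron i j) has_real_derivative kron i j) (at 0)"
    by (auto intro!: derivative_eq_intros)
  moreover have "(\<lambda>t. (x + t *\<^sub>R axis i 1) $ j) = (\<lambda>t. x $ j + t * kron i j)"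
    by (auto simp: axis_def kron_def)
  ultimately show ?thesis
    unfolding has_pd_def has_real_derivative_iff_has_vector_derivative[symmetric] by simp
qed

lemma has_pd_id: "has_pd (\<lambda>x. x) (axis i 1) i x"
  unfolding has_pd_def by (auto intro!: derivative_eq_intros)

lemma has_pd_norm:
  assumes "x \<noteq> 0" shows "has_pd norm (x $ i / norm x) i x"
proof -
  have "(norm has_derivative (\<lambda>h. inner (sgn x) h)) (at x)"
    using has_derivative_norm[OF assms] by (simp add: inner_commute)
  then have "(norm has_derivative (\<lambda>h. inner (sgn x) h)) (at (x + 0 *\<^sub>R axis i (1::real)))" by simp
  moreover have "((\<lambda>t. x + t *\<^sub>R axis i (1::real)) has_derivative (\<lambda>t. t *\<^sub>R axis i 1)) (at 0)"
    by (auto intro!: derivative_eq_intros)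
  ultimately have "((\<lambda>t. norm (x + t *\<^sub>R axis i (1::real))) has_derivative
      (\<lambda>t. inner (sgn x) (t *\<^sub>R axis i 1))) (at 0)"
    by (rule has_derivative_compose[rotated])
  moreover have "(\<lambda>t. inner (sgn x) (t *\<^sub>R axis i (1::real))) = (\<lambda>t. t *\<^sub>R (x $ i / norm x))"
    by (auto simp: sgn_div_norm inner_axis divide_inverse)
  ultimately show ?thesis unfolding has_pd_def has_vector_derivative_def by simp
qed

lemma has_pd_inverse_norm:
  assumes "x \<noteq> 0" shows "has_pd (\<lambda>x. inverse (norm x)) (- (x $ i * inverse (norm x) ^ 3)) i x"
proof -
  have "(inverse has_real_derivative - (inverse (norm x) ^ 2)) (at (norm x))"
    using DERIV_inverse[of "norm x" UNIV] assms by (simp add: numeral_2_eq_2)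
  from has_pd_compose[OF this has_pd_norm[OF assms]]
  show ?thesis
    by (rule has_pd_eq_rhs) (simp add: divide_inverse power2_eq_square power3_eq_cube)
qed

lemma has_pd_inverse_norm_power:
  assumes "x \<noteq> 0"
  shows "has_pd (\<lambda>x. inverse (norm x) ^ k) (- (k * x $ i * inverse (norm x) ^ (k + 2))) i x"
  by (rule has_pd_eq_rhs[OF has_pd_power[OF has_pd_inverse_norm[OF assms]]])
    (cases k, simp_all add: power2_eq_square power3_eq_cube)

lemma has_pd_cosang:
  assumes "x \<noteq> 0"
  shows "has_pd cosang (kron i 3 / norm x - x $ i * cosang x / (norm x)\<^sup>2) i x"
  using has_pd_mult[OF has_pd_coord[of 3 i x] has_pd_inverse_norm[OF assms, of i]]
  unfolding cosang_def divide_inverse power_inverse[symmetric]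
  by (rule has_pd_eq_rhs) (simp add: power2_eq_square power3_eq_cube)

section \<open>Local Lipschitz classes\<close>

text \<open>Compact subsets are used, as in \<open>loc_holder\<close>, so that the passage to
  Hoelder continuity needs no covering argument.\<close>

definition lipC :: "(real^3) set \<Rightarrow> (real^3 \<Rightarrow> 'b::real_normed_vector) \<Rightarrow> bool" where
  "lipC S f \<longleftrightarrow>
     (\<forall>C. compact C \<and> C \<subseteq> S \<longrightarrow> (\<exists>L. \<forall>x\<in>C. \<forall>y\<in>C. norm (f x - f y) \<le> L * dist x y))"

lemma lipC_obtain:
  assumes "lipC S f" "compact C" "C \<subseteq> S"
  obtains L where "0 \<le> L" "\<And>x y. x \<in> C \<Longrightarrow> y \<in> C \<Longrightarrow> norm (f x - f y) \<le> L * dist x y"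
proof -
  obtain L where L: "\<forall>x\<in>C. \<forall>y\<in>C. norm (f x - f y) \<le> L * dist x y"
    using assms unfolding lipC_def by blast
  show ?thesis
  proof (rule that[of "max 0 L"])
    fix x y assume "x \<in> C" "y \<in> C"
    then have "norm (f x - f y) \<le> L * dist x y" using L by blast
    also have "\<dots> \<le> max 0 L * dist x y" by (intro mult_right_mono) auto
    finally show "norm (f x - f y) \<le> max 0 L * dist x y" .
  qed simp
qed

lemma lipC_I:
  assumes "\<And>C. compact C \<Longrightarrow> C \<subseteq> S \<Longrightarrow> \<exists>L. \<forall>x\<in>C. \<forall>y\<in>C. norm (f x - f y) \<le> L * dist x y"
  shows "lipC S f"
  using assms unfolding lipC_def by blast

lemma lipC_cong:
  assumes "\<And>x. x \<in> S \<Longrightarrow> f x = g x" "lipC S g" shows "lipC S f"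
proof (rule lipC_I)
  fix C assume C: "compact C" "C \<subseteq> S"
  obtain L where L: "\<forall>x\<in>C. \<forall>y\<in>C. norm (g x - g y) \<le> L * dist x y"
    using assms(2)[unfolded lipC_def, rule_format, OF conjI[OF C]] ..
  have "norm (f x - f y) \<le> L * dist x y" if "x \<in> C" "y \<in> C" for x y
    unfolding assms(1)[OF subsetD[OF C(2) that(1)]] assms(1)[OF subsetD[OF C(2) that(2)]]
    using L that by blast
  then show "\<exists>L. \<forall>x\<in>C. \<forall>y\<in>C. norm (f x - f y) \<le> L * dist x y" by blast
qed

text \<open>A convergent sequence together with its limit is compact, so it has a Lipschitz constant
  of its own.\<close>

lemma lipC_continuous:
  assumes "lipC S f" shows "continuous_on S f"
  unfolding continuous_on_sequentially
proof (intro allI ballI impI, elim conjE)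
  fix u x assume x: "x \<in> S" and u: "\<forall>n. u n \<in> S" "u \<longlonglongrightarrow> x"
  let ?C = "insert x (range u)"
  have C: "compact ?C" by (rule compact_sequence_with_limit[OF u(2)])
  have S: "?C \<subseteq> S" using x u(1) by auto
  obtain L where L: "\<forall>x\<in>?C. \<forall>y\<in>?C. norm (f x - f y) \<le> L * dist x y"
    using assms[unfolded lipC_def, rule_format, OF conjI[OF C S]] ..
  have Ln: "norm (f (u n) - f x) \<le> L * dist (u n) x" for n
    using L[rule_format, of "u n" x] by simp
  have "(\<lambda>n. dist (u n) x) \<longlonglongrightarrow> 0" using u(2) by (rule iffD1[OF tendsto_dist_iff])
  from tendsto_mult_left[OF this, of L] have lim: "(\<lambda>n. L * dist (u n) x) \<longlonglongrightarrow> 0" by simp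
  have "(\<lambda>n. f (u n) - f x) \<longlonglongrightarrow> 0"
    by (rule Lim_null_comparison[OF _ lim]) (rule always_eventually, rule allI, rule Ln)
  then show "(f \<circ> u) \<longlonglongrightarrow> f x" unfolding o_def by (rule LIM_zero_cancel)
qed

lemma lipC_bounded:
  assumes "lipC S f" "compact C" "C \<subseteq> S"
  obtains B where "0 \<le> B" "\<And>x. x \<in> C \<Longrightarrow> norm (f x) \<le> B"
proof -
  have "bounded (f ` C)"
    using assms continuous_on_subset[OF lipC_continuous[OF assms(1)]]
    by (intro compact_imp_bounded compact_continuous_image) auto
  then obtain B where "\<And>x. x \<in> C \<Longrightarrow> norm (f x) \<le> B" unfolding bounded_iff by blast
  then show ?thesis by (intro that[of "max 0 B"]) (auto simp: le_max_iff_disj)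
qed

lemma lipC_lipschitz:
  assumes "\<And>x y. norm (f x - f y) \<le> L * dist x y" shows "lipC S f"
  using assms unfolding lipC_def by blast

lemma lipC_const: "lipC S (\<lambda>x. c)"
  by (rule lipC_lipschitz[of _ 0]) auto

lemma lipC_D:
  "lipC S f \<Longrightarrow> compact C \<Longrightarrow> C \<subseteq> S \<Longrightarrow> \<exists>L. \<forall>x\<in>C. \<forall>y\<in>C. norm (f x - f y) \<le> L * dist x y"
  unfolding lipC_def by (elim allE impE) (rule conjI)

lemma lipC_norm_comp:
  assumes "lipC S f" shows "lipC S (\<lambda>x. norm (f x))"
proof (rule lipC_I)
  fix C assume "compact C" "C \<subseteq> S"
  from lipC_D[OF assms this] obtain L where L: "\<forall>x\<in>C. \<forall>y\<in>C. norm (f x - f y) \<le> L * dist x y" ..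
  have "\<forall>x\<in>C. \<forall>y\<in>C. norm (norm (f x) - norm (f y)) \<le> L * dist x y"
  proof (intro ballI)
    fix x y assume "x \<in> C" "y \<in> C"
    then have "norm (f x - f y) \<le> L * dist x y" using L by simp
    then show "norm (norm (f x) - norm (f y)) \<le> L * dist x y"
      unfolding real_norm_def by (rule order_trans[OF norm_triangle_ineq3])
  qed
  then show "\<exists>L. \<forall>x\<in>C. \<forall>y\<in>C. norm (norm (f x) - norm (f y)) \<le> L * dist x y" ..
qed

lemma lipC_id: "lipC S (\<lambda>x. x)"
  by (rule lipC_lipschitz[of _ 1]) (simp add: dist_norm)

lemma lipC_norm: "lipC S norm"
  by (rule lipC_lipschitz[of _ 1]) (simp add: dist_norm norm_triangle_ineq3)

lemma lipC_bounded_linear: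
  assumes h: "bounded_linear h" and f: "lipC S f" shows "lipC S (\<lambda>x. h (f x))"
proof (rule lipC_I)
  fix C assume "compact C" "C \<subseteq> S"
  then obtain L where L: "\<And>x y. x \<in> C \<Longrightarrow> y \<in> C \<Longrightarrow> norm (f x - f y) \<le> L * dist x y"
    using lipC_obtain[OF f] by metis
  obtain K where K: "0 < K" "\<And>x. norm (h x) \<le> norm x * K"
    using bounded_linear.pos_bounded[OF h] by blast
  have "norm (h (f x) - h (f y)) \<le> (K * L) * dist x y" if "x \<in> C" "y \<in> C" for x y
  proof -
    have "norm (h (f x) - h (f y)) \<le> norm (f x - f y) * K"
      using K(2) bounded_linear.linear[OF h] by (metis linear_diff)
    also have "\<dots> \<le> L * dist x y * K" using K L[OF that] by (intro mult_right_mono) auto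
    finally show ?thesis by (simp add: ac_simps)
  qed
  then show "\<exists>L. \<forall>x\<in>C. \<forall>y\<in>C. norm (h (f x) - h (f y)) \<le> L * dist x y" by blast
qed

lemma lipC_add:
  assumes "lipC S f" "lipC S g" shows "lipC S (\<lambda>x. f x + g x)"
proof (rule lipC_I)
  fix C assume C: "compact C" "C \<subseteq> S"
  obtain L where L: "\<And>x y. x \<in> C \<Longrightarrow> y \<in> C \<Longrightarrow> norm (f x - f y) \<le> L * dist x y"
    using lipC_obtain[OF assms(1) C] by metis
  obtain M where M: "\<And>x y. x \<in> C \<Longrightarrow> y \<in> C \<Longrightarrow> norm (g x - g y) \<le> M * dist x y"
    using lipC_obtain[OF assms(2) C] by metis
  have "norm (f x + g x - (f y + g y)) \<le> (L + M) * dist x y" if "x \<in> C" "y \<in> C" for x y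
    unfolding add_diff_add distrib_right
    by (rule norm_triangle_le[OF add_mono[OF L[OF that] M[OF that]]])
  then show "\<exists>L. \<forall>x\<in>C. \<forall>y\<in>C. norm (f x + g x - (f y + g y)) \<le> L * dist x y" by blast
qed

lemma lipC_minus: "lipC S f \<Longrightarrow> lipC S (\<lambda>x. - f x)"
  using lipC_bounded_linear[OF bounded_linear_minus[OF bounded_linear_ident]] by blast

lemma lipC_diff: "lipC S f \<Longrightarrow> lipC S g \<Longrightarrow> lipC S (\<lambda>x. f x - g x)"
  using lipC_add[of S f "\<lambda>x. - g x"] lipC_minus[of S g] by simp

lemma lipC_scaleR:
  fixes a :: "real^3 \<Rightarrow> real"
  assumes "lipC S a" "lipC S f" shows "lipC S (\<lambda>x. a x *\<^sub>R f x)"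
proof (rule lipC_I)
  fix C assume C: "compact C" "C \<subseteq> S"
  obtain L where L: "\<And>x y. x \<in> C \<Longrightarrow> y \<in> C \<Longrightarrow> norm (a x - a y) \<le> L * dist x y"
    using lipC_obtain[OF assms(1) C] by metis
  obtain M where M: "\<And>x y. x \<in> C \<Longrightarrow> y \<in> C \<Longrightarrow> norm (f x - f y) \<le> M * dist x y"
    using lipC_obtain[OF assms(2) C] by metis
  obtain A where A: "0 \<le> A" "\<And>x. x \<in> C \<Longrightarrow> norm (a x) \<le> A" using lipC_bounded[OF assms(1) C] by metis
  obtain B where B: "0 \<le> B" "\<And>x. x \<in> C \<Longrightarrow> norm (f x) \<le> B" using lipC_bounded[OF assms(2) C] by metis
  have "norm (a x *\<^sub>R f x - a y *\<^sub>R f y) \<le> (A * M + L * B) * dist x y" if "x \<in> C" "y \<in> C" for x y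
  proof -
    have "a x *\<^sub>R f x - a y *\<^sub>R f y = a x *\<^sub>R (f x - f y) + (a x - a y) *\<^sub>R f y"
      by (simp add: algebra_simps)
    also have "norm \<dots> \<le> norm (a x) * norm (f x - f y) + norm (a x - a y) * norm (f y)"
      by (rule norm_triangle_le) simp
    also have "\<dots> \<le> A * (M * dist x y) + L * dist x y * B"
      using that A(1) order_trans[OF norm_ge_zero L[OF that]]
      by (intro add_mono mult_mono A(2) B(2) L M) auto
    finally show ?thesis by (simp add: algebra_simps)
  qed
  then show "\<exists>L. \<forall>x\<in>C. \<forall>y\<in>C. norm (a x *\<^sub>R f x - a y *\<^sub>R f y) \<le> L * dist x y" by blast
qed

lemma lipC_mult:
  fixes a f :: "real^3 \<Rightarrow> real"
  shows "lipC S a \<Longrightarrow> lipC S f \<Longrightarrow> lipC S (\<lambda>x. a x * f x)"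
  using lipC_scaleR[of S a f] by simp

lemma lipC_inverse:
  fixes f :: "real^3 \<Rightarrow> real"
  assumes f: "lipC S f" and nz: "\<And>x. x \<in> S \<Longrightarrow> f x \<noteq> 0"
  shows "lipC S (\<lambda>x. inverse (f x))"
proof (rule lipC_I)
  fix C assume C: "compact C" "C \<subseteq> S"
  obtain L where L: "0 \<le> L" "\<And>x y. x \<in> C \<Longrightarrow> y \<in> C \<Longrightarrow> norm (f x - f y) \<le> L * dist x y"
    using lipC_obtain[OF f C] by metis
  have "continuous_on C (\<lambda>x. inverse (f x))"
    using C nz continuous_on_subset[OF lipC_continuous[OF f] C(2)] by (intro continuous_intros) auto
  then have "bounded ((\<lambda>x. inverse (f x)) ` C)"
    using C by (intro compact_imp_bounded compact_continuous_image) auto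
  then obtain B where B: "\<And>x. x \<in> C \<Longrightarrow> norm (inverse (f x)) \<le> B" unfolding bounded_iff by blast
  have "norm (inverse (f x) - inverse (f y)) \<le> (B * L * B) * dist x y" if "x \<in> C" "y \<in> C" for x y
  proof -
    have nx: "f x \<noteq> 0" "f y \<noteq> 0" using that C nz by auto
    then have "inverse (f x) - inverse (f y) = - (inverse (f x) * (f x - f y) * inverse (f y))"
      by (rule inverse_diff_inverse)
    then have "norm (inverse (f x) - inverse (f y)) = norm (inverse (f x)) * norm (f x - f y) * norm (inverse (f y))"
      by (simp only: norm_minus_cancel norm_mult)
    also have "\<dots> \<le> B * (L * dist x y) * B"
      using that L(1) order_trans[OF norm_ge_zero B[OF that(1)]]
      by (intro mult_mono B L(2)) auto
    finally show ?thesis by (simp add: ac_simps)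
  qed
  then show "\<exists>L. \<forall>x\<in>C. \<forall>y\<in>C. norm (inverse (f x) - inverse (f y)) \<le> L * dist x y" by blast
qed

text \<open>The normalized field is discontinuous at the zeros of \<open>v\<close>, but a factor of the size of \<open>norm v\<close>
  restores Lipschitz continuity. At a zero of \<open>v\<close> the product is 0 because of \<open>x / 0 = 0\<close>.\<close>

lemma lipC_normalized:
  fixes k :: "real^3 \<Rightarrow> real" and v :: "real^3 \<Rightarrow> real^3"
  assumes k: "lipC S k" and v: "lipC S v" and bound: "\<And>x. x \<in> S \<Longrightarrow> \<bar>k x\<bar> \<le> B * norm (v x)"
  shows "lipC S (\<lambda>x. k x * (v x $ i / norm (v x)))"
proof (rule lipC_I)
  fix C assume C: "compact C" "C \<subseteq> S"
  obtain L where L: "0 \<le> L" "\<And>x y. x \<in> C \<Longrightarrow> y \<in> C \<Longrightarrow> norm (k x - k y) \<le> L * dist x y"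
    using lipC_obtain[OF k C] by metis
  obtain M where M: "0 \<le> M" "\<And>x y. x \<in> C \<Longrightarrow> y \<in> C \<Longrightarrow> norm (v x - v y) \<le> M * dist x y"
    using lipC_obtain[OF v C] by metis
  let ?n = "\<lambda>x. v x $ i / norm (v x)"
  have n1: "\<bar>?n x\<bar> \<le> 1" for x
    using component_le_norm_cart[of "v x" i] by (cases "v x = 0") (auto simp: divide_le_eq)
  have "norm (k x * ?n x - k y * ?n y) \<le> (2 * \<bar>B\<bar> * M + L) * dist x y" if xy: "x \<in> C" "y \<in> C" for x y
  proof -
    have kxy: "\<bar>k x - k y\<bar> \<le> L * dist x y" using L(2)[OF xy] by simp
    have nn: "0 \<le> 2 * \<bar>B\<bar> * M * dist x y" using M(1) by simp
    have *: "\<bar>k x * (?n x - ?n y)\<bar> \<le> 2 * \<bar>B\<bar> * M * dist x y" if "v x \<noteq> 0" "v y \<noteq> 0"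
    proof -
      let ?p = "norm (v x)" and ?q = "norm (v y)"
      have pq: "0 < ?p" "0 < ?q" using that by auto
      have "?n x - ?n y = (v x $ i - v y $ i) / ?p + ?n y * (?q - ?p) / ?p"
        using pq by (simp add: field_simps)
      also have "\<bar>\<dots>\<bar> \<le> \<bar>v x $ i - v y $ i\<bar> / ?p + \<bar>?n y\<bar> * \<bar>?q - ?p\<bar> / ?p"
        using pq by (intro order_trans[OF abs_triangle_ineq]) (simp add: abs_mult)
      also have "\<dots> \<le> M * dist x y / ?p + 1 * (M * dist x y) / ?p"
      proof (intro add_mono divide_right_mono mult_mono n1)
        have "\<bar>v x $ i - v y $ i\<bar> \<le> norm (v x - v y)"
          using component_le_norm_cart[of "v x - v y" i] by simp
        then show "\<bar>v x $ i - v y $ i\<bar> \<le> M * dist x y" using M(2)[OF xy] by simp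
        have "\<bar>?q - ?p\<bar> \<le> norm (v x - v y)" by (metis norm_minus_commute norm_triangle_ineq3)
        then show "\<bar>?q - ?p\<bar> \<le> M * dist x y" using M(2)[OF xy] by simp
      qed auto
      finally have "\<bar>?n x - ?n y\<bar> \<le> 2 * M * dist x y / ?p" by simp
      then have "\<bar>k x\<bar> * \<bar>?n x - ?n y\<bar> \<le> (\<bar>B\<bar> * ?p) * (2 * M * dist x y / ?p)"
      proof (rule mult_mono[rotated])
        have "x \<in> S" using xy C by auto
        then show "\<bar>k x\<bar> \<le> \<bar>B\<bar> * ?p"
          using bound[of x] mult_right_mono[OF abs_ge_self[of B] norm_ge_zero[of "v x"]] by simp
      qed auto
      also have "\<dots> = 2 * \<bar>B\<bar> * M * dist x y" using pq by simp
      finally show ?thesis by (simp add: abs_mult)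
    qed
    have zero: "k z = 0" if "v z = 0" "z \<in> C" for z using bound[of z] that C by auto
    have "\<bar>k x * (?n x - ?n y)\<bar> \<le> 2 * \<bar>B\<bar> * M * dist x y \<or> v y = 0"
      using * zero[OF _ xy(1)] nn by (cases "v x = 0") auto
    then show ?thesis
    proof
      assume A: "\<bar>k x * (?n x - ?n y)\<bar> \<le> 2 * \<bar>B\<bar> * M * dist x y"
      have "a * p - b * q = a * (p - q) + (a - b) * q" for a b p q :: real
        by (simp add: algebra_simps)
      then have "k x * ?n x - k y * ?n y = k x * (?n x - ?n y) + (k x - k y) * ?n y" .
      also have "\<bar>\<dots>\<bar> \<le> \<bar>k x * (?n x - ?n y)\<bar> + \<bar>k x - k y\<bar> * \<bar>?n y\<bar>"
        by (intro order_trans[OF abs_triangle_ineq]) (simp add: abs_mult)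
      also have "\<dots> \<le> 2 * \<bar>B\<bar> * M * dist x y + (L * dist x y) * 1"
        using A kxy n1[of y] by (intro add_mono mult_mono) auto
      finally show ?thesis by (simp add: algebra_simps)
    next
      assume "v y = 0"
      then have "k y = 0" using zero xy by blast
      then have "norm (k x * ?n x - k y * ?n y) \<le> \<bar>k x - k y\<bar> * 1"
        using mult_left_mono[OF n1[of x] abs_ge_zero[of "k x"]] by (simp add: abs_mult)
      also have "\<dots> \<le> L * dist x y" using kxy by simp
      finally show ?thesis using nn by (simp add: algebra_simps)
    qed
  qed
  then show "\<exists>L. \<forall>x\<in>C. \<forall>y\<in>C. norm (k x * ?n x - k y * ?n y) \<le> L * dist x y" by blast
qed

text \<open>One splits a distance into its powers with exponents \<open>1 - \<alpha>\<close> and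
  \<open>\<alpha>\<close>; on a compact set the first factor is bounded.\<close>

lemma lipC_loc_holder:
  assumes f: "lipC S f" and \<alpha>: "0 < \<alpha>" "\<alpha> < 1"
  shows "loc_holder \<alpha> S f"
  unfolding loc_holder_def
proof (intro allI impI, elim conjE)
  fix C assume C: "compact C" "C \<subseteq> S"
  obtain L where L: "0 \<le> L" "\<And>x y. x \<in> C \<Longrightarrow> y \<in> C \<Longrightarrow> norm (f x - f y) \<le> L * dist x y"
    using lipC_obtain[OF f C] by metis
  obtain D where D: "\<And>x y. x \<in> C \<Longrightarrow> y \<in> C \<Longrightarrow> dist x y \<le> D"
    using bounded_two_points[of C] compact_imp_bounded[OF C(1)] by blast
  have "norm (f x - f y) \<le> (L * D powr (1 - \<alpha>)) * dist x y powr \<alpha>" if xy: "x \<in> C" "y \<in> C" for x y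
  proof (cases "x = y")
    case False
    have "dist x y = dist x y powr (1 - \<alpha>) * dist x y powr \<alpha>"
      using False by (simp flip: powr_add)
    also have "\<dots> \<le> D powr (1 - \<alpha>) * dist x y powr \<alpha>"
      using D[OF xy] \<alpha> by (intro mult_right_mono powr_mono2) auto
    finally have "L * dist x y \<le> L * (D powr (1 - \<alpha>) * dist x y powr \<alpha>)"
      using L(1) by (rule mult_left_mono)
    then show ?thesis using L(2)[OF xy] by (simp add: ac_simps)
  qed simp
  then show "\<exists>M. \<forall>x\<in>C. \<forall>y\<in>C. norm (f x - f y) \<le> M * dist x y powr \<alpha>" by blast
qed

text \<open>The local class \<open>C^(k,1)\<close> up to the boundary. It is closed under products
  and lies in the Hoelder classes of the theorem for all exponents at once, so regularity has to be
  proved only once.\<close>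

primrec CL :: "nat \<Rightarrow> (real^3) set \<Rightarrow> (real^3 \<Rightarrow> 'b::real_normed_vector) \<Rightarrow> bool" where
  "CL 0 S f \<longleftrightarrow> lipC S f"
| "CL (Suc k) S f \<longleftrightarrow> lipC S f \<and>
     (\<forall>i. \<exists>g. CL k S g \<and> (\<forall>x\<in>interior S. has_pd f (g x) i x))"

section \<open>Closure properties of \<open>CL\<close> and its relation to the classes of the
  theorem\<close>

lemma CL_lipC: "CL k S f \<Longrightarrow> lipC S f"
  by (cases k) auto

lemma CL_SucI:
  "lipC S f \<Longrightarrow> (\<And>i. CL k S (g i)) \<Longrightarrow> (\<And>i x. x \<in> interior S \<Longrightarrow> has_pd f (g i x) i x) \<Longrightarrow> CL (Suc k) S f"
  unfolding CL.simps by blast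

lemma CL_SucE:
  assumes "CL (Suc k) S f"
  obtains g where "\<And>i. CL k S (g i)" "\<And>i x. x \<in> interior S \<Longrightarrow> has_pd f (g i x) i x"
proof -
  have "\<forall>i. \<exists>g. CL k S g \<and> (\<forall>x\<in>interior S. has_pd f (g x) i x)" using assms by simp
  then obtain g where "\<forall>i. CL k S (g i) \<and> (\<forall>x\<in>interior S. has_pd f (g i x) i x)"
    using choice[of "\<lambda>i g. CL k S g \<and> (\<forall>x\<in>interior S. has_pd f (g x) i x)"] by blast
  then show ?thesis using that by blast
qed

lemma CL_Suc_imp: "CL (Suc k) S f \<Longrightarrow> CL k S f"
proof (induction k arbitrary: f)
  case (Suc k)
  obtain g where g: "\<And>i. CL (Suc k) S (g i)" "\<And>i x. x \<in> interior S \<Longrightarrow> has_pd f (g i x) i x"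
    using CL_SucE[OF Suc.prems] by metis
  show ?case by (rule CL_SucI[OF CL_lipC[OF Suc.prems] Suc.IH[OF g(1)] g(2)])
qed simp

lemma CL_imp_C_upto: "CL k S f \<Longrightarrow> C_upto k S f"
proof (induction k arbitrary: f)
  case (Suc k)
  obtain g where g: "\<And>i. CL k S (g i)" "\<And>i x. x \<in> interior S \<Longrightarrow> has_pd f (g i x) i x"
    using CL_SucE[OF Suc.prems] by metis
  have "C_upto k S (g i)" for i by (rule Suc.IH[OF g(1)])
  then show ?case
    using lipC_continuous[OF CL_lipC[OF Suc.prems]] g(2) has_pd_imp_pdiff has_pd_imp_pderiv
    unfolding C_upto.simps by metis
qed (simp add: lipC_continuous)

lemma CL_imp_C_holder: "0 < \<alpha> \<Longrightarrow> \<alpha> < 1 \<Longrightarrow> CL k S f \<Longrightarrow> C_holder_upto k \<alpha> S f"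
proof (induction k arbitrary: f)
  case (Suc k)
  obtain g where g: "\<And>i. CL k S (g i)" "\<And>i x. x \<in> interior S \<Longrightarrow> has_pd f (g i x) i x"
    using CL_SucE[OF Suc.prems(3)] by metis
  have "C_holder_upto k \<alpha> S (g i)" for i by (rule Suc.IH[OF Suc.prems(1,2) g(1)])
  then show ?case
    using lipC_continuous[OF CL_lipC[OF Suc.prems(3)]] g(2) has_pd_imp_pdiff has_pd_imp_pderiv
    unfolding C_holder_upto.simps by metis
qed (simp add: lipC_continuous lipC_loc_holder)

lemma CL_const: "CL k S (\<lambda>x. c)"
proof (induction k arbitrary: c)
  case (Suc k)
  show ?case by (rule CL_SucI[where g = "\<lambda>i x. 0"]) (use Suc in \<open>auto simp: lipC_const\<close>)
qed (simp add: lipC_const)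

lemma CL_bounded_linear:
  assumes h: "bounded_linear h" shows "CL k S f \<Longrightarrow> CL k S (\<lambda>x. h (f x))"
proof (induction k arbitrary: f)
  case (Suc k)
  obtain g where g: "\<And>i. CL k S (g i)" "\<And>i x. x \<in> interior S \<Longrightarrow> has_pd f (g i x) i x"
    using CL_SucE[OF Suc.prems] by metis
  show ?case
    by (rule CL_SucI[OF lipC_bounded_linear[OF h CL_lipC[OF Suc.prems]] Suc.IH[OF g(1)]
          has_pd_bounded_linear[OF h g(2)]])
qed (simp add: lipC_bounded_linear[OF h])

lemma CL_add: "CL k S f \<Longrightarrow> CL k S f' \<Longrightarrow> CL k S (\<lambda>x. f x + f' x)"
proof (induction k arbitrary: f f')
  case (Suc k)
  obtain g where g: "\<And>i. CL k S (g i)" "\<And>i x. x \<in> interior S \<Longrightarrow> has_pd f (g i x) i x"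
    using CL_SucE[OF Suc.prems(1)] by metis
  obtain g' where g': "\<And>i. CL k S (g' i)" "\<And>i x. x \<in> interior S \<Longrightarrow> has_pd f' (g' i x) i x"
    using CL_SucE[OF Suc.prems(2)] by metis
  show ?case
    by (rule CL_SucI[OF lipC_add[OF Suc.prems[THEN CL_lipC]] Suc.IH[OF g(1) g'(1)] has_pd_add[OF g(2) g'(2)]])
qed (simp add: lipC_add)

lemma CL_minus: "CL k S f \<Longrightarrow> CL k S (\<lambda>x. - f x)"
  by (rule CL_bounded_linear[OF bounded_linear_minus[OF bounded_linear_ident]])

lemma CL_diff: "CL k S f \<Longrightarrow> CL k S g \<Longrightarrow> CL k S (\<lambda>x. f x - g x)"
  using CL_add[of k S f "\<lambda>x. - g x"] CL_minus[of k S g] by simp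

lemma CL_scaleR:
  fixes a :: "real^3 \<Rightarrow> real"
  shows "CL k S a \<Longrightarrow> CL k S f \<Longrightarrow> CL k S (\<lambda>x. a x *\<^sub>R f x)"
proof (induction k arbitrary: a f)
  case (Suc k)
  obtain b where b: "\<And>i. CL k S (b i)" "\<And>i x. x \<in> interior S \<Longrightarrow> has_pd a (b i x) i x"
    using CL_SucE[OF Suc.prems(1)] by metis
  obtain g where g: "\<And>i. CL k S (g i)" "\<And>i x. x \<in> interior S \<Longrightarrow> has_pd f (g i x) i x"
    using CL_SucE[OF Suc.prems(2)] by metis
  show ?case
    by (rule CL_SucI[OF lipC_scaleR[OF Suc.prems[THEN CL_lipC]] CL_add[OF Suc.IH[OF Suc.prems(1)[THEN CL_Suc_imp] g(1)]
          Suc.IH[OF b(1) Suc.prems(2)[THEN CL_Suc_imp]]] has_pd_scaleR[OF b(2) g(2)]])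
qed (simp add: lipC_scaleR)

lemma CL_mult:
  fixes a f :: "real^3 \<Rightarrow> real"
  shows "CL k S a \<Longrightarrow> CL k S f \<Longrightarrow> CL k S (\<lambda>x. a x * f x)"
  using CL_scaleR[of k S a f] by simp

lemma CL_power:
  fixes a :: "real^3 \<Rightarrow> real"
  shows "CL k S a \<Longrightarrow> CL k S (\<lambda>x. a x ^ n)"
  by (induction n) (auto intro: CL_const CL_mult)

lemma CL_id: "CL k S (\<lambda>x. x)"
proof (cases k)
  case (Suc j)
  show ?thesis unfolding Suc by (rule CL_SucI[OF lipC_id CL_const has_pd_id])
qed (simp add: lipC_id)

lemma CL_coord: "CL k S (\<lambda>x. x $ i)"
  by (rule CL_bounded_linear[OF bounded_linear_vec_nth CL_id])

text \<open>The first derivatives are polynomials in the coordinates and in the function itself, so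
  the induction on the order closes.\<close>

lemma CL_inverse_norm:
  assumes "0 \<notin> S" shows "CL k S (\<lambda>x. inverse (norm x))"
proof (induction k)
  case 0
  show ?case using assms by (auto intro!: lipC_inverse lipC_norm)
next
  case (Suc k)
  show ?case
  proof (rule CL_SucI[where g = "\<lambda>i x. - (x $ i * inverse (norm x) ^ 3)"])
    show "lipC S (\<lambda>x. inverse (norm x))" by (rule CL_lipC[OF Suc])
    show "CL k S (\<lambda>x. - (x $ i * inverse (norm x) ^ 3))" for i
      by (intro CL_minus CL_mult CL_coord CL_power Suc)
    fix i x assume "x \<in> interior S"
    then have x: "x \<noteq> 0" using interior_subset assms by blast
    show "has_pd (\<lambda>x. inverse (norm x)) (- (x $ i * inverse (norm x) ^ 3)) i x"
      by (rule has_pd_inverse_norm[OF x])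
  qed
qed

lemma CL_cosang: "0 \<notin> S \<Longrightarrow> CL k S cosang"
  unfolding cosang_def divide_inverse by (intro CL_mult CL_coord CL_inverse_norm)

section \<open>Functions of the polar angle\<close>

text \<open>Regularity of profiles is measured in the variable \<open>sqrt (1 - s)\<close>, which is comparable to the polar
  angle: \<open>s = cos \<phi>\<close> itself is degenerate at the axis.\<close>

definition LD :: "real \<Rightarrow> (real \<Rightarrow> 'b::real_normed_vector) \<Rightarrow> bool" where
  "LD c a \<longleftrightarrow> (\<exists>L. \<forall>s\<in>{c..1}. \<forall>t\<in>{c..1}. norm (a s - a t) \<le> L * \<bar>sqrt (1 - s) - sqrt (1 - t)\<bar>)"

lemma LD_obtain:
  assumes "LD c a"
  obtains L where "0 \<le> L"
    "\<And>s t. s \<in> {c..1} \<Longrightarrow> t \<in> {c..1} \<Longrightarrow> norm (a s - a t) \<le> L * \<bar>sqrt (1 - s) - sqrt (1 - t)\<bar>"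
proof -
  obtain L where L: "\<forall>s\<in>{c..1}. \<forall>t\<in>{c..1}. norm (a s - a t) \<le> L * \<bar>sqrt (1 - s) - sqrt (1 - t)\<bar>"
    using assms unfolding LD_def by blast
  show ?thesis
  proof (rule that[of "max 0 L"])
    fix s t assume "s \<in> {c..1}" "t \<in> {c..1}"
    then have "norm (a s - a t) \<le> L * \<bar>sqrt (1 - s) - sqrt (1 - t)\<bar>" using L by blast
    also have "\<dots> \<le> max 0 L * \<bar>sqrt (1 - s) - sqrt (1 - t)\<bar>" by (intro mult_right_mono) auto
    finally show "norm (a s - a t) \<le> max 0 L * \<bar>sqrt (1 - s) - sqrt (1 - t)\<bar>" .
  qed simp
qed

lemma LD_I:
  assumes "\<And>s t. s \<in> {c..1} \<Longrightarrow> t \<in> {c..1} \<Longrightarrow> norm (a s - a t) \<le> L * \<bar>sqrt (1 - s) - sqrt (1 - t)\<bar>"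
  shows "LD c a"
  unfolding LD_def using assms by blast

lemma LD_cong: "(\<And>s. s \<in> {c..1} \<Longrightarrow> a s = b s) \<Longrightarrow> LD c a \<Longrightarrow> LD c b"
  unfolding LD_def by simp

lemma LD_bounded:
  assumes "LD c a"
  obtains B where "0 \<le> B" "\<And>s. s \<in> {c..1} \<Longrightarrow> norm (a s) \<le> B"
proof -
  obtain L where L: "0 \<le> L"
    "\<And>s t. s \<in> {c..1} \<Longrightarrow> t \<in> {c..1} \<Longrightarrow> norm (a s - a t) \<le> L * \<bar>sqrt (1 - s) - sqrt (1 - t)\<bar>"
    using LD_obtain[OF assms] by metis
  show ?thesis
  proof (rule that[of "norm (a 1) + L * sqrt (1 - c) + \<bar>L * sqrt (1 - c)\<bar>"])
    show "0 \<le> norm (a 1) + L * sqrt (1 - c) + \<bar>L * sqrt (1 - c)\<bar>"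
      using norm_ge_zero[of "a 1"] abs_ge_minus_self[of "L * sqrt (1 - c)"] by linarith
    fix s assume s: "s \<in> {c..1}"
    then have "norm (a s - a 1) \<le> L * sqrt (1 - s)" using L(2)[of s 1] by simp
    also have "\<dots> \<le> L * sqrt (1 - c)" using s L(1) by (intro mult_left_mono) auto
    finally show "norm (a s) \<le> norm (a 1) + L * sqrt (1 - c) + \<bar>L * sqrt (1 - c)\<bar>"
      using norm_triangle_sub[of "a s" "a 1"] abs_ge_zero[of "L * sqrt (1 - c)"] by linarith
  qed
qed

lemma LD_continuous:
  assumes "LD c a" shows "continuous_on {c..1} a"
proof -
  obtain L where L: "0 \<le> L"
    "\<And>s t. s \<in> {c..1} \<Longrightarrow> t \<in> {c..1} \<Longrightarrow> norm (a s - a t) \<le> L * \<bar>sqrt (1 - s) - sqrt (1 - t)\<bar>"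
    using LD_obtain[OF assms] by metis
  have "(a \<longlongrightarrow> a t) (at t within {c..1})" if t: "t \<in> {c..1}" for t
  proof -
    have "((\<lambda>s. L * \<bar>sqrt (1 - s) - sqrt (1 - t)\<bar>) \<longlongrightarrow> L * \<bar>sqrt (1 - t) - sqrt (1 - t)\<bar>) (at t within {c..1})"
      by (intro tendsto_intros)
    then have lim: "((\<lambda>s. L * \<bar>sqrt (1 - s) - sqrt (1 - t)\<bar>) \<longlongrightarrow> 0) (at t within {c..1})"
      by simp
    have "eventually (\<lambda>s. norm (a s - a t) \<le> L * \<bar>sqrt (1 - s) - sqrt (1 - t)\<bar>) (at t within {c..1})"
      unfolding eventually_at_filter by (rule always_eventually) (use L(2) t in blast)
    then have "((\<lambda>s. a s - a t) \<longlongrightarrow> 0) (at t within {c..1})"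
      by (rule Lim_null_comparison[OF _ lim])
    then show ?thesis by (rule LIM_zero_cancel)
  qed
  then show ?thesis unfolding continuous_on_def by blast
qed

lemma LD_const: "LD c (\<lambda>s. k)"
  by (rule LD_I[of _ _ 0]) simp

lemma LD_add:
  assumes "LD c a" "LD c b" shows "LD c (\<lambda>s. a s + b s)"
proof -
  obtain L where L: "\<And>s t. s \<in> {c..1} \<Longrightarrow> t \<in> {c..1} \<Longrightarrow> norm (a s - a t) \<le> L * \<bar>sqrt (1 - s) - sqrt (1 - t)\<bar>"
    using LD_obtain[OF assms(1)] by metis
  obtain M where M: "\<And>s t. s \<in> {c..1} \<Longrightarrow> t \<in> {c..1} \<Longrightarrow> norm (b s - b t) \<le> M * \<bar>sqrt (1 - s) - sqrt (1 - t)\<bar>"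
    using LD_obtain[OF assms(2)] by metis
  show ?thesis
  proof (rule LD_I[of _ _ "L + M"])
    fix s t assume st: "s \<in> {c..1}" "t \<in> {c..1}"
    show "norm (a s + b s - (a t + b t)) \<le> (L + M) * \<bar>sqrt (1 - s) - sqrt (1 - t)\<bar>"
      unfolding add_diff_add distrib_right
      by (rule norm_triangle_le[OF add_mono[OF L[OF st] M[OF st]]])
  qed
qed

lemma LD_scaleR:
  fixes a :: "real \<Rightarrow> real"
  assumes "LD c a" "LD c b" shows "LD c (\<lambda>s. a s *\<^sub>R b s)"
proof -
  obtain L where L: "0 \<le> L" "\<And>s t. s \<in> {c..1} \<Longrightarrow> t \<in> {c..1} \<Longrightarrow> norm (a s - a t) \<le> L * \<bar>sqrt (1 - s) - sqrt (1 - t)\<bar>"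
    using LD_obtain[OF assms(1)] by metis
  obtain M where M: "\<And>s t. s \<in> {c..1} \<Longrightarrow> t \<in> {c..1} \<Longrightarrow> norm (b s - b t) \<le> M * \<bar>sqrt (1 - s) - sqrt (1 - t)\<bar>"
    using LD_obtain[OF assms(2)] by metis
  obtain A where A: "0 \<le> A" "\<And>s. s \<in> {c..1} \<Longrightarrow> norm (a s) \<le> A" using LD_bounded[OF assms(1)] by metis
  obtain B where B: "0 \<le> B" "\<And>s. s \<in> {c..1} \<Longrightarrow> norm (b s) \<le> B" using LD_bounded[OF assms(2)] by metis
  show ?thesis
  proof (rule LD_I[of _ _ "A * M + L * B"])
    fix s t assume st: "s \<in> {c..1}" "t \<in> {c..1}"
    let ?d = "\<bar>sqrt (1 - s) - sqrt (1 - t)\<bar>"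
    have "a s *\<^sub>R b s - a t *\<^sub>R b t = a s *\<^sub>R (b s - b t) + (a s - a t) *\<^sub>R b t"
      by (simp add: algebra_simps)
    also have "norm \<dots> \<le> norm (a s) * norm (b s - b t) + norm (a s - a t) * norm (b t)"
      by (rule norm_triangle_le) simp
    also have "\<dots> \<le> A * (M * ?d) + L * ?d * B"
      using st A(1) order_trans[OF norm_ge_zero L(2)[OF st]]
      by (intro add_mono mult_mono A(2) B(2) L M) auto
    finally show "norm (a s *\<^sub>R b s - a t *\<^sub>R b t) \<le> (A * M + L * B) * ?d"
      by (simp add: algebra_simps)
  qed
qed

lemma LD_mult:
  fixes a b :: "real \<Rightarrow> real"
  shows "LD c a \<Longrightarrow> LD c b \<Longrightarrow> LD c (\<lambda>s. a s * b s)"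
  using LD_scaleR[of c a b] by simp

lemma LD_diff:
  assumes "LD c a" "LD c b" shows "LD c (\<lambda>s. a s - b s)"
  using LD_add[OF assms(1) LD_scaleR[OF LD_const[of c "- 1"] assms(2)]] by simp

lemma LD_power2:
  fixes a :: "real \<Rightarrow> real"
  shows "LD c a \<Longrightarrow> LD c (\<lambda>s. (a s)\<^sup>2)"
  unfolding power2_eq_square by (rule LD_mult)

lemma LD_sqrt: "LD c (\<lambda>s. sqrt (1 - s))"
  by (rule LD_I[of _ _ 1]) simp

text \<open>\<open>s - t\<close> factors into the difference and the sum of the square roots of
  \<open>1 - t\<close> and \<open>1 - s\<close>, and the sum is bounded. Lipschitz continuity in
  \<open>s\<close> is thus the stronger property.\<close>

lemma LD_lipschitz:
  assumes "\<And>s t. s \<in> {c..1} \<Longrightarrow> t \<in> {c..1} \<Longrightarrow> norm (a s - a t) \<le> B * \<bar>s - t\<bar>"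
  shows "LD c a"
proof (rule LD_I[of _ _ "\<bar>B\<bar> * (2 * sqrt (1 - c))"])
  fix s t assume st: "s \<in> {c..1}" "t \<in> {c..1}"
  let ?p = "sqrt (1 - s)" and ?q = "sqrt (1 - t)"
  have "s - t = (?q + ?p) * (?q - ?p)"
    using st real_sqrt_mult_self[of "1 - s"] real_sqrt_mult_self[of "1 - t"]
    by (simp add: algebra_simps)
  then have "\<bar>s - t\<bar> = (?q + ?p) * \<bar>?p - ?q\<bar>" using st by (simp add: abs_mult abs_minus_commute)
  also have "\<dots> \<le> (2 * sqrt (1 - c)) * \<bar>?p - ?q\<bar>"
  proof (rule mult_right_mono)
    have "?p \<le> sqrt (1 - c)" "?q \<le> sqrt (1 - c)" using st by simp_all
    then show "?q + ?p \<le> 2 * sqrt (1 - c)" by linarith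
  qed simp
  finally have "\<bar>B\<bar> * \<bar>s - t\<bar> \<le> \<bar>B\<bar> * ((2 * sqrt (1 - c)) * \<bar>?p - ?q\<bar>)" by (intro mult_left_mono) auto
  moreover have "B * \<bar>s - t\<bar> \<le> \<bar>B\<bar> * \<bar>s - t\<bar>" by (intro mult_right_mono) auto
  ultimately show "norm (a s - a t) \<le> \<bar>B\<bar> * (2 * sqrt (1 - c)) * \<bar>?p - ?q\<bar>"
    using assms[OF st] by (simp add: mult.assoc)
qed

lemma LD_id: "LD c (\<lambda>s. s)"
  by (rule LD_lipschitz[of _ _ 1]) simp

lemma LD_deriv:
  assumes d: "\<And>s. s \<in> {c..1} \<Longrightarrow> (a has_real_derivative a' s) (at s within {c..1})"
    and b: "\<And>s. s \<in> {c..1} \<Longrightarrow> \<bar>a' s\<bar> \<le> B"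
  shows "LD c a"
proof (rule LD_lipschitz[of _ _ B])
  fix s t assume st: "s \<in> {c..1}" "t \<in> {c..1}"
  have "norm (a s - a t) \<le> B * norm (s - t)"
    by (rule field_differentiable_bound[OF convex_closed_interval d]) (use b st in auto)
  then show "norm (a s - a t) \<le> B * \<bar>s - t\<bar>" by simp
qed

lemma LD_C1:
  assumes d: "\<And>s. s \<in> {c..1} \<Longrightarrow> (a has_real_derivative a' s) (at s within {c..1})"
    and b: "continuous_on {c..1} a'"
  shows "LD c a"
proof -
  obtain B where B: "\<And>s. s \<in> {c..1} \<Longrightarrow> \<bar>a' s\<bar> \<le> B" using continuous_abs_bound[OF b] by metis
  show ?thesis by (rule LD_deriv[OF d B])
qed

lemma LD_inverse_1_plus:
  assumes "- 1 < c" shows "LD c (\<lambda>s. 1 / (1 + s))"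
  by (rule LD_C1[where a' = "\<lambda>s. - 1 / (1 + s)\<^sup>2"])
    (use assms in \<open>auto intro!: derivative_eq_intros continuous_intros simp: power2_eq_square\<close>)

lemma LD_sqrt_1_plus:
  assumes "- 1 < c" shows "LD c (\<lambda>s. sqrt (1 + s))"
  by (rule LD_C1[where a' = "\<lambda>s. inverse (sqrt (1 + s)) / 2"])
    (use assms in \<open>auto intro!: derivative_eq_intros continuous_intros simp: field_simps\<close>)

lemma sqrt_sin_eq: "sqrt (1 - s\<^sup>2) = sqrt (1 - s) * sqrt (1 + s)"
  by (simp add: power2_eq_square algebra_simps flip: real_sqrt_mult)

lemma LD_sqrt_sin:
  assumes "- 1 < c" shows "LD c (\<lambda>s. sqrt (1 - s\<^sup>2))"
  unfolding sqrt_sin_eq by (rule LD_mult[OF LD_sqrt LD_sqrt_1_plus[OF assms]])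

text \<open>The Lipschitz bound makes \<open>a - L sqrt (1 - t)\<close> and
  \<open>- a - L sqrt (1 - t)\<close> nondecreasing, so their derivatives are nonnegative. The bound
  later shows that an integration constant at the axis is 0.\<close>

lemma LD_derivative_bound:
  fixes a :: "real \<Rightarrow> real"
  assumes L: "\<And>s t. s \<in> {c..1} \<Longrightarrow> t \<in> {c..1} \<Longrightarrow> \<bar>a s - a t\<bar> \<le> L * \<bar>sqrt (1 - s) - sqrt (1 - t)\<bar>"
    and s: "c < s" "s < 1" and D: "(a has_real_derivative D) (at s)"
  shows "\<bar>D\<bar> \<le> L / (2 * sqrt (1 - s))"
proof -
  have sq: "((\<lambda>t. sqrt (1 - t)) has_real_derivative - (inverse (sqrt (1 - s)) / 2)) (at s)"
  proof -
    have "((\<lambda>t. 1 - t) has_real_derivative - 1) (at s)" by (auto intro!: derivative_eq_intros)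
    from DERIV_chain2[where f = sqrt and g = "\<lambda>t. 1 - t" and x = s and s = UNIV, OF DERIV_real_sqrt this]
    show ?thesis using s by simp
  qed
  have gen: "0 \<le> D' + L * (inverse (sqrt (1 - s)) / 2)"
    if D': "(b has_real_derivative D') (at s)"
      and b: "\<And>p q. p \<in> {c..1} \<Longrightarrow> q \<in> {c..1} \<Longrightarrow> \<bar>b p - b q\<bar> \<le> L * \<bar>sqrt (1 - p) - sqrt (1 - q)\<bar>" for b D'
  proof -
    have deriv: "((\<lambda>t. b t - L * sqrt (1 - t)) has_real_derivative D' - L * (- (inverse (sqrt (1 - s)) / 2))) (at s)"
      by (rule DERIV_diff[OF D' DERIV_cmult[OF sq]])
    have mono: "mono_on {c..1} (\<lambda>t. b t - L * sqrt (1 - t))"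
    proof (rule mono_onI)
      fix p q assume pq: "p \<in> {c..1}" "q \<in> {c..1}" "p \<le> q"
      then have "0 \<le> sqrt (1 - p) - sqrt (1 - q)" by simp
      then have eq: "\<bar>sqrt (1 - p) - sqrt (1 - q)\<bar> = sqrt (1 - p) - sqrt (1 - q)" by (rule abs_of_nonneg)
      have "b p - b q \<le> \<bar>b p - b q\<bar>" by (rule abs_ge_self)
      also have "\<dots> \<le> L * (sqrt (1 - p) - sqrt (1 - q))" using b[OF pq(1,2)] unfolding eq .
      also have "\<dots> = L * sqrt (1 - p) - L * sqrt (1 - q)" by (rule right_diff_distrib)
      finally show "b p - L * sqrt (1 - p) \<le> b q - L * sqrt (1 - q)" by linarith
    qed
    have "s \<in> interior {c..1}" using s by simp
    from mono_on_imp_deriv_nonneg[OF mono deriv this]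
    show ?thesis unfolding mult_minus_right diff_minus_eq_add .
  qed
  have "0 \<le> D + L * (inverse (sqrt (1 - s)) / 2)" by (rule gen[OF D L])
  moreover have "0 \<le> - D + L * (inverse (sqrt (1 - s)) / 2)"
  proof (rule gen[OF DERIV_minus[OF D]])
    fix p q assume pq: "p \<in> {c..1}" "q \<in> {c..1}"
    have "- a p - - a q = - (a p - a q)" by simp
    then show "\<bar>- a p - - a q\<bar> \<le> L * \<bar>sqrt (1 - p) - sqrt (1 - q)\<bar>"
      using L[OF pq] by (simp only: abs_minus_cancel)
  qed
  moreover have "L / (2 * sqrt (1 - s)) = L * (inverse (sqrt (1 - s)) / 2)"
    by (simp only: divide_inverse inverse_mult_distrib mult_ac)
  ultimately show ?thesis by linarith
qed

section \<open>Angular profiles composed with \<open>cosang\<close>\<close>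

abbreviation pcone :: "real \<Rightarrow> (real^3) set" where
  "pcone c \<equiv> {x. x \<noteq> 0 \<and> c \<le> cosang x}"

lemma zero_notin_cone: "0 \<notin> pcone c" by simp

lemma cosang_cone: "x \<in> pcone c \<Longrightarrow> cosang x \<in> {c..1}"
  using cosang_le by auto

text \<open>Up to the factor \<open>sqrt 2\<close> this is the chord from \<open>x / norm x\<close>
  to the north pole. It links \<open>LD\<close> to Lipschitz continuity in space.\<close>

lemma lipC_sqrt_cosang: "lipC (pcone c) (\<lambda>x. sqrt (1 - cosang x))"
proof -
  have eq: "sqrt (1 - cosang x) = norm (inverse (norm x) *\<^sub>R x - axis 3 1) / sqrt 2" if "x \<noteq> 0" for x :: "real^3"
  proof -
    let ?e = "inverse (norm x) *\<^sub>R x"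
    have 1: "inner ?e ?e = 1"
      using that by (simp add: power2_norm_eq_inner[symmetric] power2_eq_square)
    have "inner ?e (axis 3 1) = cosang x" by (simp add: inner_axis cosang_def divide_inverse)
    moreover have "inner (axis 3 1) (axis 3 1 :: real^3) = 1" by (simp add: inner_axis)
    ultimately have "(norm (?e - axis 3 1))\<^sup>2 = 2 * (1 - cosang x)"
      using 1 by (simp add: power2_norm_eq_inner inner_diff inner_commute)
    then have "norm (?e - axis 3 1) = sqrt (2 * (1 - cosang x))"
      by (metis norm_ge_zero real_sqrt_abs abs_of_nonneg)
    then have "norm (?e - axis 3 1) = sqrt 2 * sqrt (1 - cosang x)" by (simp only: real_sqrt_mult)
    then show ?thesis by simp
  qed
  have "lipC (pcone c) (\<lambda>x. norm (inverse (norm x) *\<^sub>R x - axis 3 1))"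
    by (intro lipC_norm_comp lipC_diff lipC_scaleR lipC_inverse lipC_norm lipC_id lipC_const) simp
  then have "lipC (pcone c) (\<lambda>x. norm (inverse (norm x) *\<^sub>R x - axis 3 1) * (1 / sqrt 2))"
    by (rule lipC_mult[OF _ lipC_const])
  then show ?thesis by (rule lipC_cong[rotated]) (simp add: eq)
qed

lemma lipC_LD:
  assumes "LD c a" shows "lipC (pcone c) (\<lambda>x. a (cosang x))"
proof (rule lipC_I)
  fix C assume C: "compact C" "C \<subseteq> pcone c"
  obtain L where L: "0 \<le> L"
    "\<And>s t. s \<in> {c..1} \<Longrightarrow> t \<in> {c..1} \<Longrightarrow> norm (a s - a t) \<le> L * \<bar>sqrt (1 - s) - sqrt (1 - t)\<bar>"
    using LD_obtain[OF assms] by metis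
  from lipC_D[OF lipC_sqrt_cosang C] obtain M where
    M: "\<forall>x\<in>C. \<forall>y\<in>C. norm (sqrt (1 - cosang x) - sqrt (1 - cosang y)) \<le> M * dist x y" ..
  have "\<forall>x\<in>C. \<forall>y\<in>C. norm (a (cosang x) - a (cosang y)) \<le> (L * M) * dist x y"
  proof (intro ballI)
    fix x y assume xy: "x \<in> C" "y \<in> C"
    have "norm (a (cosang x) - a (cosang y)) \<le> L * \<bar>sqrt (1 - cosang x) - sqrt (1 - cosang y)\<bar>"
      by (rule L(2)[OF cosang_cone[OF subsetD[OF C(2) xy(1)]] cosang_cone[OF subsetD[OF C(2) xy(2)]]])
    also have "\<dots> \<le> L * (M * dist x y)"
      using M[rule_format, OF xy] by (intro mult_left_mono L(1)) simp
    finally show "norm (a (cosang x) - a (cosang y)) \<le> (L * M) * dist x y" by (simp only: mult.assoc)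
  qed
  then show "\<exists>L. \<forall>x\<in>C. \<forall>y\<in>C. norm (a (cosang x) - a (cosang y)) \<le> L * dist x y" ..
qed

definition dcos :: "3 \<Rightarrow> real^3 \<Rightarrow> real" where
  "dcos i x = kron i 3 * inverse (norm x) - x $ i * cosang x * inverse (norm x) ^ 2"

lemma has_pd_dcos: "x \<noteq> 0 \<Longrightarrow> has_pd cosang (dcos i x) i x"
  using has_pd_cosang[of x i] by (simp add: dcos_def divide_inverse power_inverse)

lemma CL_dcos: "0 \<notin> S \<Longrightarrow> CL k S (dcos i)"
  unfolding dcos_def
  by (intro CL_diff CL_mult CL_power CL_coord CL_const CL_cosang CL_inverse_norm)

text \<open>The component of \<open>axis 3 1\<close> orthogonal to \<open>x\<close>, equal to
  \<open>norm x\<close> times the gradient of \<open>cosang\<close>. Its length is the sine of the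
  polar angle, so its direction is undefined exactly on the axis.\<close>

definition vcos :: "real^3 \<Rightarrow> real^3" where
  "vcos x = axis 3 1 - (cosang x * inverse (norm x)) *\<^sub>R x"

lemma vcos_nth: "x \<noteq> 0 \<Longrightarrow> vcos x $ i = norm x * dcos i x"
  by (simp add: vcos_def dcos_def kron_def axis_def right_diff_distrib power2_eq_square)

lemma lipC_vcos: "0 \<notin> S \<Longrightarrow> lipC S vcos"
  unfolding vcos_def
  by (intro lipC_diff lipC_scaleR lipC_mult lipC_const lipC_id CL_lipC[OF CL_cosang[where k = 0]]
      CL_lipC[OF CL_inverse_norm[where k = 0]])

lemma norm_vcos: "x \<noteq> 0 \<Longrightarrow> norm (vcos x) = sqrt (1 - (cosang x)\<^sup>2)"
proof -
  assume x: "x \<noteq> 0"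
  have "inner (axis 3 1 - k *\<^sub>R x) (axis 3 1 - k *\<^sub>R x) = 1 - 2 * k * x $ 3 + k\<^sup>2 * inner x x" for k
    by (simp add: inner_diff inner_axis inner_axis' power2_eq_square algebra_simps)
  then have "inner (vcos x) (vcos x) = 1 - 2 * (cosang x * inverse (norm x)) * x $ 3 + (cosang x * inverse (norm x))\<^sup>2 * (norm x)\<^sup>2"
    unfolding vcos_def dot_square_norm by simp
  also have "\<dots> = 1 - (cosang x)\<^sup>2"
  proof -
    have "inverse (norm x) * norm x = 1" using x by simp
    then have "2 * (cosang x * inverse (norm x)) * x $ 3 = 2 * (cosang x)\<^sup>2"
      "(cosang x * inverse (norm x))\<^sup>2 * (norm x)\<^sup>2 = (cosang x)\<^sup>2"
      unfolding x3_eq power_mult_distrib[symmetric] by (simp_all add: mult.assoc power2_eq_square)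
    then show ?thesis by simp
  qed
  finally show ?thesis by (simp add: norm_eq_sqrt_inner)
qed

text \<open>The squared sine is \<open>(1 - cosang x) * (1 + cosang x)\<close>, and on the cone the
  second factor is at least \<open>1 + c > 0\<close>.\<close>

lemma sqrt_le_norm_vcos:
  assumes "- 1 < c" "x \<in> pcone c"
  shows "sqrt (1 - cosang x) \<le> (1 / sqrt (1 + c)) * norm (vcos x)"
proof -
  have "sqrt (1 + c) \<le> sqrt (1 + cosang x)" using assms by simp
  then have "sqrt (1 - cosang x) * sqrt (1 + c) \<le> sqrt (1 - cosang x) * sqrt (1 + cosang x)"
    using cosang_le[of x] by (intro mult_left_mono) auto
  then show ?thesis
    using assms norm_vcos[of x] sqrt_sin_eq[of "cosang x"] by (simp add: pos_le_divide_eq)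
qed

text \<open>At a zero of one factor the product rule requires only continuity of the other. It
  serves on the axis, where \<open>dcos\<close> vanishes and the profile in front of it need not be
  differentiable.\<close>

lemma has_pd_mult_zero:
  fixes b k :: "real^3 \<Rightarrow> real"
  assumes b: "isCont b x" and k: "has_pd k D i x" "k x = 0"
  shows "has_pd (\<lambda>x. b x * k x) (b x * D) i x"
proof -
  let ?l = "\<lambda>t. x + t *\<^sub>R axis i (1::real)"
  have "((\<lambda>t. k (?l t)) has_real_derivative D) (at 0)"
    using k(1) unfolding has_pd_def has_real_derivative_iff_has_vector_derivative .
  then have kl: "((\<lambda>t. k (?l t) / t) \<longlongrightarrow> D) (at 0)"
    unfolding DERIV_def using k(2) by simp
  have "isCont (\<lambda>t. b (?l t)) 0"
    by (rule isCont_o2[where g = b]) (use b in \<open>auto intro!: continuous_intros\<close>)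
  then have "((\<lambda>t. b (?l t)) \<longlongrightarrow> b x) (at 0)" unfolding isCont_def by simp
  from tendsto_mult[OF this kl]
  have "((\<lambda>t. b (?l t) * k (?l t)) has_real_derivative b x * D) (at 0)"
    unfolding DERIV_def using k(2) by simp
  then show ?thesis unfolding has_pd_def has_real_derivative_iff_has_vector_derivative .
qed

lemma has_pd_squeeze:
  fixes f g :: "real^3 \<Rightarrow> real"
  assumes S: "open S" "x \<in> S" and fg: "\<And>y. y \<in> S \<Longrightarrow> \<bar>f y - f x\<bar> \<le> g y"
    and g: "has_pd g 0 i x" "g x = 0"
  shows "has_pd f 0 i x"
proof -
  let ?l = "\<lambda>t. x + t *\<^sub>R axis i (1::real)"
  obtain T where T: "open T" "(0::real) \<in> T" "\<And>t. t \<in> T \<Longrightarrow> ?l t \<in> S"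
    using line_in_open[OF S] by blast
  have "((\<lambda>t. g (?l t)) has_real_derivative 0) (at 0)"
    using g(1) unfolding has_pd_def has_real_derivative_iff_has_vector_derivative .
  then have gl: "((\<lambda>t. g (?l t) / t) \<longlongrightarrow> 0) (at 0)" unfolding DERIV_def using g(2) by simp
  have "((\<lambda>t. (f (?l t) - f x) / t) \<longlongrightarrow> 0) (at 0)"
  proof (rule Lim_null_comparison[OF _ tendsto_rabs_zero[OF gl]])
    have "eventually (\<lambda>t. t \<in> T) (at 0)" by (rule eventually_at_in_open'[OF T(1,2)])
    then show "eventually (\<lambda>t. norm ((f (?l t) - f x) / t) \<le> \<bar>g (?l t) / t\<bar>) (at 0)"
    proof (rule eventually_mono)
      fix t assume "t \<in> T"
      then have "\<bar>f (?l t) - f x\<bar> \<le> \<bar>g (?l t)\<bar>" using fg[OF T(3)] abs_ge_self order_trans by blast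
      then show "norm ((f (?l t) - f x) / t) \<le> \<bar>g (?l t) / t\<bar>"
        unfolding real_norm_def abs_divide by (intro divide_right_mono) auto
    qed
  qed
  then have "((\<lambda>t. f (?l t)) has_real_derivative 0) (at 0)" unfolding DERIV_def by simp
  then show ?thesis unfolding has_pd_def has_real_derivative_iff_has_vector_derivative .
qed

lemma cosang_interior:
  assumes "- 1 < c" "c < 1" "x \<in> interior (pcone c)"
  shows "x \<noteq> 0" "c < cosang x" "cosang x < 1 \<or> cosang x = 1" "cosang ` interior (pcone c) \<subseteq> {c..1}"
proof -
  have x: "x \<noteq> 0 \<and> c < cosang x" using assms(3) unfolding interior_cone[OF assms(1,2)] by simp
  then show "x \<noteq> 0" "c < cosang x" by auto
  show "cosang x < 1 \<or> cosang x = 1" using cosang_le[of x] by linarith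
  show "cosang ` interior (pcone c) \<subseteq> {c..1}"
    by (rule image_subsetI) (rule cosang_cone[OF subsetD[OF interior_subset]])
qed

lemma has_pd_cosang_comp:
  assumes c: "- 1 < c" "c < 1" "x \<in> interior (pcone c)"
    and a: "(a has_real_derivative d) (at (cosang x) within {c..1})"
  shows "has_pd (\<lambda>x. a (cosang x)) (d * dcos i x) i x"
  by (rule has_pd_compose_within[OF a has_pd_dcos open_interior c(3)]) (use cosang_interior[OF c] in auto)

lemma CL1_angular:
  assumes c: "- 1 < c" "c < 1"
    and a: "\<And>s. s \<in> {c..1} \<Longrightarrow> (a has_real_derivative a1 s) (at s within {c..1})"
    and a1: "LD c a1"
  shows "CL 1 (pcone c) (\<lambda>x. a (cosang x))"
  unfolding One_nat_def
proof (rule CL_SucI)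
  show "lipC (pcone c) (\<lambda>x. a (cosang x))" by (rule lipC_LD[OF LD_C1[OF a LD_continuous[OF a1]]])
  show "CL 0 (pcone c) (\<lambda>x. a1 (cosang x) * dcos i x)" for i
    by (intro CL_mult CL_dcos) (auto intro: lipC_LD a1)
  show "has_pd (\<lambda>x. a (cosang x)) (a1 (cosang x) * dcos i x) i x" if "x \<in> interior (pcone c)" for i x
    using that interior_subset by (intro has_pd_cosang_comp[OF c that] a cosang_cone) auto
qed

text \<open>The critical part of the second derivatives is \<open>a2 * dcos i * dcos j\<close>. As
  \<open>norm (vcos x)\<close> squared is \<open>1 - s^2\<close>, this equals
  \<open>(1 - s^2) * a2\<close> times two components of the normalized \<open>vcos\<close>, divided
  by \<open>(norm x)^2\<close>. The coefficient is \<open>LD\<close> and vanishes at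
  \<open>s = 1\<close>, so \<open>lipC_normalized\<close>, applied twice, makes the product
  Lipschitz although \<open>a2\<close> may blow up at the axis.\<close>

lemma CL2_angular:
  assumes c: "- 1 < c" "c < 1"
    and a: "\<And>s. s \<in> {c..1} \<Longrightarrow> (a has_real_derivative a1 s) (at s within {c..1})"
    and a1: "LD c a1"
    and a2: "\<And>s. c < s \<Longrightarrow> s < 1 \<Longrightarrow> (a1 has_real_derivative a2 s) (at s)"
    and M: "LD c (\<lambda>s. (1 - s\<^sup>2) * a2 s)"
  shows "CL 2 (pcone c) (\<lambda>x. a (cosang x))"
proof -
  define k where "k x = (1 - (cosang x)\<^sup>2) * a2 (cosang x)" for x
  define n where "n i x = vcos x $ i / norm (vcos x)" for i x
  have k: "lipC (pcone c) k" unfolding k_def by (rule lipC_LD[OF M])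
  obtain L where L: "0 \<le> L" "\<And>s t. s \<in> {c..1} \<Longrightarrow> t \<in> {c..1} \<Longrightarrow>
      norm ((1 - s\<^sup>2) * a2 s - (1 - t\<^sup>2) * a2 t) \<le> L * \<bar>sqrt (1 - s) - sqrt (1 - t)\<bar>"
    using LD_obtain[OF M] by metis
  have kb: "\<bar>k x\<bar> \<le> L * (1 / sqrt (1 + c)) * norm (vcos x)" if x: "x \<in> pcone c" for x
  proof -
    have "\<bar>k x\<bar> \<le> L * sqrt (1 - cosang x)"
      using L(2)[OF cosang_cone[OF x], of 1] c cosang_le[of x] by (simp add: k_def)
    also have "\<dots> \<le> L * ((1 / sqrt (1 + c)) * norm (vcos x))"
      by (rule mult_left_mono[OF sqrt_le_norm_vcos[OF c(1) x] L(1)])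
    finally show ?thesis by (simp add: mult.assoc)
  qed
  have v: "lipC (pcone c) vcos" by (rule lipC_vcos[OF zero_notin_cone])
  have kn: "lipC (pcone c) (\<lambda>x. k x * n i x)" for i
    unfolding n_def by (rule lipC_normalized[OF k v kb])
  have n1: "\<bar>n i x\<bar> \<le> 1" for i x
    unfolding n_def using component_le_norm_cart[of "vcos x" i]
    by (cases "vcos x = 0") (auto simp: divide_le_eq)
  have knb: "\<bar>k x * n i x\<bar> \<le> L * (1 / sqrt (1 + c)) * norm (vcos x)" if x: "x \<in> pcone c" for i x
    using kb[OF x] mult_left_le[OF n1[of i x] abs_ge_zero[of "k x"]] by (simp only: abs_mult)
  have knn: "lipC (pcone c) (\<lambda>x. k x * n i x * n j x)" for i j
    unfolding n_def[of j] by (rule lipC_normalized[OF kn v knb])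
  have dd: "\<exists>e. CL 0 (pcone c) e \<and> (\<forall>x\<in>interior (pcone c). has_pd (dcos i) (e x) j x)" for i j
    using CL_dcos[OF zero_notin_cone, of "Suc 0" c i] by (simp only: CL.simps)
  \<comment> \<open>\<open>e i j\<close> is the second derivative of \<open>cosang\<close> in the
    directions \<open>i\<close> and \<open>j\<close>.\<close>
  define e where "e i j = (SOME e. CL 0 (pcone c) e \<and> (\<forall>x\<in>interior (pcone c). has_pd (dcos i) (e x) j x))" for i j
  have e: "lipC (pcone c) (e i j)" "\<And>x. x \<in> interior (pcone c) \<Longrightarrow> has_pd (dcos i) (e i j x) j x" for i j
    using someI_ex[OF dd[of i j]] unfolding e_def[symmetric] by auto
  have inner: "CL (Suc 0) (pcone c) (\<lambda>x. a1 (cosang x) * dcos i x)" for i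
  proof (rule CL_SucI)
    show "lipC (pcone c) (\<lambda>x. a1 (cosang x) * dcos i x)"
      by (intro lipC_mult lipC_LD a1 CL_lipC[OF CL_dcos[where k = 0]] zero_notin_cone)
    show "CL 0 (pcone c) (\<lambda>x. a1 (cosang x) * e i j x + k x * n j x * n i x * inverse (norm x) ^ 2)" for j
      unfolding CL.simps
      by (intro lipC_add lipC_mult lipC_LD a1 e knn CL_lipC[OF CL_power[OF CL_inverse_norm[where k = 0]]] zero_notin_cone)
    fix j x assume x: "x \<in> interior (pcone c)"
    note x0 = cosang_interior[OF c x]
    have a1_cont: "isCont (\<lambda>x. a1 (cosang x)) x"
      using continuous_on_subset[OF lipC_continuous[OF lipC_LD[OF a1]] interior_subset] x
      by (simp add: continuous_on_eq_continuous_at)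
    show "has_pd (\<lambda>x. a1 (cosang x) * dcos i x)
        (a1 (cosang x) * e i j x + k x * n j x * n i x * inverse (norm x) ^ 2) j x"
    proof (cases "cosang x = 1")
      \<comment> \<open>On the axis \<open>dcos i\<close> vanishes, so continuity of
        \<open>a1\<close> suffices; the second summand of the claimed derivative is 0 because
        \<open>k x = 0\<close>.\<close>
      case True
      then have "norm (vcos x) = 0" using norm_vcos[OF x0(1)] by simp
      then have "vcos x = 0" by simp
      then have "dcos i x = 0" using vcos_nth[OF x0(1), of i] x0(1) by simp
      from has_pd_mult_zero[OF a1_cont e(2)[OF x] this]
      show ?thesis using True by (simp add: k_def)
    next
      case False
      then have s: "cosang x < 1" using x0 by simp
      have pos: "0 < 1 - (cosang x)\<^sup>2"
        using s x0(2) c by (simp add: abs_square_less_1 abs_less_iff)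
      have "has_pd (\<lambda>x. a1 (cosang x)) (a2 (cosang x) * dcos j x) j x"
        by (rule has_pd_cosang_comp[OF c x has_field_derivative_at_within[OF a2[OF x0(2) s]]])
      from has_pd_mult[OF this e(2)[OF x]]
      show ?thesis
      proof (rule has_pd_eq_rhs)
        have "norm (vcos x) * norm (vcos x) = 1 - (cosang x)\<^sup>2" using norm_vcos[OF x0(1)] pos by simp
        then have "k x * n j x * n i x = a2 (cosang x) * (vcos x $ j) * (vcos x $ i)"
          using pos unfolding k_def n_def by (simp add: times_divide_times_eq mult.assoc)
        also have "\<dots> = a2 (cosang x) * dcos j x * dcos i x * (norm x)\<^sup>2"
          by (simp add: vcos_nth[OF x0(1)] power2_eq_square)
        finally have "k x * n j x * n i x * inverse (norm x) ^ 2 = a2 (cosang x) * dcos j x * dcos i x"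
          using x0(1) by (simp add: power_inverse mult.assoc)
        then show "a1 (cosang x) * e i j x + a2 (cosang x) * dcos j x * dcos i x =
            a1 (cosang x) * e i j x + k x * n j x * n i x * inverse (norm x) ^ 2"
          by simp
      qed
    qed
  qed
  show ?thesis
    unfolding numeral_2_eq_2
  proof (rule CL_SucI[OF _ inner])
    show "lipC (pcone c) (\<lambda>x. a (cosang x))" by (rule lipC_LD[OF LD_C1[OF a LD_continuous[OF a1]]])
    show "has_pd (\<lambda>x. a (cosang x)) (a1 (cosang x) * dcos i x) i x" if "x \<in> interior (pcone c)" for i x
      using that interior_subset by (intro has_pd_cosang_comp[OF c that] a cosang_cone) auto
  qed
qed

text \<open>Here \<open>a'\<close> may fail to extend continuously to the axis; differentiability there comes from the
  quadratic bound instead.\<close>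

lemma CL1_angular_flat:
  assumes c: "- 1 < c" "c < 1" and a: "LD c a" and k: "LD c k" "k 1 = 0"
    and d: "\<And>s. c < s \<Longrightarrow> s < 1 \<Longrightarrow> (a has_real_derivative k s / sqrt (1 - s\<^sup>2)) (at s)"
    and flat: "\<And>s. s \<in> {c..1} \<Longrightarrow> \<bar>a s - a 1\<bar> \<le> B * (1 - s)"
  shows "CL 1 (pcone c) (\<lambda>x. a (cosang x))"
  unfolding One_nat_def
proof (rule CL_SucI)
  let ?g = "\<lambda>i x. k (cosang x) * (vcos x $ i / norm (vcos x)) * inverse (norm x)"
  obtain L where L: "0 \<le> L" "\<And>s t. s \<in> {c..1} \<Longrightarrow> t \<in> {c..1} \<Longrightarrow>
      norm (k s - k t) \<le> L * \<bar>sqrt (1 - s) - sqrt (1 - t)\<bar>"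
    using LD_obtain[OF k(1)] by metis
  have kb: "\<bar>k (cosang x)\<bar> \<le> L * (1 / sqrt (1 + c)) * norm (vcos x)" if x: "x \<in> pcone c" for x
  proof -
    have "\<bar>k (cosang x)\<bar> \<le> L * sqrt (1 - cosang x)"
      using L(2)[OF cosang_cone[OF x], of 1] c cosang_le[of x] k(2) by simp
    also have "\<dots> \<le> L * ((1 / sqrt (1 + c)) * norm (vcos x))"
      by (rule mult_left_mono[OF sqrt_le_norm_vcos[OF c(1) x] L(1)])
    finally show ?thesis by (simp add: mult.assoc)
  qed
  show "lipC (pcone c) (\<lambda>x. a (cosang x))" by (rule lipC_LD[OF a])
  show "CL 0 (pcone c) (?g i)" for i
    unfolding CL.simps
    by (intro lipC_mult lipC_normalized[OF lipC_LD[OF k(1)] lipC_vcos kb]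
        CL_lipC[OF CL_inverse_norm[where k = 0]] zero_notin_cone)
  fix i x assume x: "x \<in> interior (pcone c)"
  note x0 = cosang_interior[OF c x]
  show "has_pd (\<lambda>x. a (cosang x)) (?g i x) i x"
  proof (cases "cosang x = 1")
    case True
    then have "norm (vcos x) = 0" using norm_vcos[OF x0(1)] by simp
    then have v0: "vcos x = 0" by simp
    then have "dcos i x = 0" using vcos_nth[OF x0(1), of i] x0(1) by simp
    then have "has_pd (\<lambda>x. B * (1 - cosang x)) (B * (0 - 0) + 0 * (1 - cosang x)) i x"
      using has_pd_dcos[OF x0(1), of i] by (intro has_pd_mult has_pd_diff has_pd_const) simp
    then have "has_pd (\<lambda>x. B * (1 - cosang x)) 0 i x" by simp
    then have "has_pd (\<lambda>x. a (cosang x)) 0 i x"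
    proof (rule has_pd_squeeze[OF open_interior x, rotated])
      show "\<bar>a (cosang y) - a (cosang x)\<bar> \<le> B * (1 - cosang y)" if "y \<in> interior (pcone c)" for y
        using flat[of "cosang y"] cosang_interior(4)[OF c x] that True by auto
    qed (simp add: True)
    then show ?thesis by (simp add: v0)
  next
    case False
    then have s: "cosang x < 1" using x0 by simp
    have pos: "0 < norm (vcos x)"
      unfolding norm_vcos[OF x0(1)] using s x0(2) c by (simp add: abs_square_less_1 abs_less_iff)
    have "has_pd (\<lambda>x. a (cosang x)) (k (cosang x) / norm (vcos x) * dcos i x) i x"
      unfolding norm_vcos[OF x0(1)]
      by (rule has_pd_cosang_comp[OF c x has_field_derivative_at_within[OF d[OF x0(2) s]]])
    then show ?thesis
    proof (rule has_pd_eq_rhs)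
      show "k (cosang x) / norm (vcos x) * dcos i x = ?g i x"
        using x0(1) by (simp add: vcos_nth[OF x0(1)])
    qed
  qed
qed

section \<open>Total derivatives and the meridian\<close>

lemma has_pd_shift:
  assumes "has_pd f D i (x + r *\<^sub>R axis i 1)"
  shows "((\<lambda>t. f (x + t *\<^sub>R axis i 1)) has_vector_derivative D) (at r)"
proof -
  let ?g = "\<lambda>t. f (x + r *\<^sub>R axis i 1 + t *\<^sub>R axis i 1)"
  have "(?g has_vector_derivative D) (at (r - r))"
    using assms by (simp add: has_pd_def)
  moreover have "((\<lambda>t. t - r) has_vector_derivative 1) (at r)"
    by (auto intro!: derivative_eq_intros)
  ultimately have "((?g \<circ> (\<lambda>t. t - r)) has_vector_derivative 1 *\<^sub>R D) (at r)"
    by (rule vector_diff_chain_at[rotated])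
  moreover have "?g \<circ> (\<lambda>t. t - r) = (\<lambda>t. f (x + t *\<^sub>R axis i 1))"
    by (auto simp: o_def algebra_simps)
  ultimately show ?thesis by simp
qed

lemma partial_increment:
  assumes pd: "\<And>r. \<bar>r\<bar> \<le> \<bar>t\<bar> \<Longrightarrow> has_pd f (g (p + r *\<^sub>R axis i 1)) i (p + r *\<^sub>R axis i 1)"
    and close: "\<And>r. \<bar>r\<bar> \<le> \<bar>t\<bar> \<Longrightarrow> norm (g (p + r *\<^sub>R axis i 1) - D) \<le> e"
  shows "norm (f (p + t *\<^sub>R axis i 1) - f p - t *\<^sub>R D) \<le> e * \<bar>t\<bar>"
proof -
  let ?h = "\<lambda>r. f (p + r *\<^sub>R axis i 1) - r *\<^sub>R D"
  let ?S = "{- \<bar>t\<bar>..\<bar>t\<bar>}"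
  have "norm (?h t - ?h 0) \<le> e * norm (t - 0)"
  proof (rule differentiable_bound[where S = ?S and f' = "\<lambda>r k. k *\<^sub>R (g (p + r *\<^sub>R axis i 1) - D)"])
    fix r assume "r \<in> ?S"
    then have r: "\<bar>r\<bar> \<le> \<bar>t\<bar>" by auto
    have "(?h has_vector_derivative g (p + r *\<^sub>R axis i 1) - D) (at r)"
      by (intro has_vector_derivative_diff has_pd_shift pd r) (auto intro!: derivative_eq_intros)
    then show "(?h has_derivative (\<lambda>k. k *\<^sub>R (g (p + r *\<^sub>R axis i 1) - D))) (at r within ?S)"
      unfolding has_vector_derivative_def by (rule has_derivative_at_withinI)
    show "onorm (\<lambda>k. k *\<^sub>R (g (p + r *\<^sub>R axis i 1) - D)) \<le> e"
    proof (rule onorm_le)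
      fix k :: real
      show "norm (k *\<^sub>R (g (p + r *\<^sub>R axis i 1) - D)) \<le> e * norm k"
        using mult_left_mono[OF close[OF r] abs_ge_zero[of k]] by (simp add: mult.commute)
    qed
  qed auto
  then show ?thesis by (simp add: algebra_simps)
qed

text \<open>The increment is split along three segments parallel to the coordinate axes. Every point
  on them differs from \<open>x\<close> by a vector whose components are bounded by those of
  \<open>h\<close>, so it stays in the ball where the partial derivatives are close to their values
  at \<open>x\<close>.\<close>

lemma partials_has_derivative:
  fixes f :: "real^3 \<Rightarrow> 'b::real_normed_vector"
  assumes U: "open U" "x \<in> U" and pd: "\<And>i y. y \<in> U \<Longrightarrow> has_pd f (g i y) i y"
    and cont: "\<And>i. isCont (g i) x"
  shows "(f has_derivative (\<lambda>h. \<Sum>i\<in>UNIV. h $ i *\<^sub>R g i x)) (at x)"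
  unfolding has_derivative_within_alt[where s = UNIV, simplified]
proof (intro conjI allI impI)
  show "bounded_linear (\<lambda>h. \<Sum>i\<in>UNIV. h $ i *\<^sub>R g i x)"
    by (intro bounded_linear_sum bounded_linear_compose[OF bounded_linear_scaleR_left bounded_linear_vec_nth])
  fix e :: real assume "e > 0"
  obtain d0 where d0: "d0 > 0" "ball x d0 \<subseteq> U" using U by (meson open_contains_ball)
  have "\<exists>d>0. \<forall>y. dist y x < d \<longrightarrow> dist (g i y) (g i x) < e / 3" for i
    using cont[of i, unfolded continuous_at_eps_delta, rule_format, of "e / 3"] \<open>e > 0\<close> by simp
  then obtain d where d: "\<And>i. d i > 0" "\<And>i y. dist y x < d i \<Longrightarrow> dist (g i y) (g i x) < e / 3" by metis
  define r where "r = min d0 (min (d 1) (min (d 2) (d 3)))"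
  have r: "r > 0" "r \<le> d0" "r \<le> d 1" "r \<le> d 2" "r \<le> d 3" using d0 d by (auto simp: r_def)
  have rd: "r \<le> d i" for i using r exhaust_3[of i] by auto
  show "\<exists>d>0. \<forall>y. norm (y - x) < d \<longrightarrow>
      norm (f y - f x - (\<Sum>i\<in>UNIV. (y - x) $ i *\<^sub>R g i x)) \<le> e * norm (y - x)"
  proof (intro exI[of _ r] conjI allI impI)
    fix y assume y: "norm (y - x) < r"
    define h where "h = y - x"
    have inc: "norm (f (p + (h $ i) *\<^sub>R axis i 1) - f p - (h $ i) *\<^sub>R g i x) \<le> e / 3 * \<bar>h $ i\<bar>"
      if p: "\<And>q. \<bar>q\<bar> \<le> \<bar>h $ i\<bar> \<Longrightarrow> norm (p + q *\<^sub>R axis i 1 - x) \<le> norm h" for p i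
    proof (rule partial_increment[where g = "g i"])
      fix q assume "\<bar>q\<bar> \<le> \<bar>h $ i\<bar>"
      from p[OF this] have dist: "dist (p + q *\<^sub>R axis i 1) x < r" using y by (simp add: dist_norm h_def)
      then have "p + q *\<^sub>R axis i 1 \<in> U" using r d0(2) by (auto simp: dist_commute)
      then show "has_pd f (g i (p + q *\<^sub>R axis i 1)) i (p + q *\<^sub>R axis i 1)" by (rule pd)
      have "dist (g i (p + q *\<^sub>R axis i 1)) (g i x) < e / 3" using dist rd[of i] by (intro d(2)) simp
      then show "norm (g i (p + q *\<^sub>R axis i 1) - g i x) \<le> e / 3" by (simp add: dist_norm)
    qed
    let ?p1 = "x + (h $ 1) *\<^sub>R axis 1 1"
    let ?p2 = "?p1 + (h $ 2) *\<^sub>R axis 2 1"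
    have 1: "norm (f ?p1 - f x - (h $ 1) *\<^sub>R g 1 x) \<le> e / 3 * \<bar>h $ 1\<bar>"
    proof (rule inc)
      fix q assume q: "\<bar>q\<bar> \<le> \<bar>h $ 1\<bar>"
      show "norm (x + q *\<^sub>R axis 1 1 - x) \<le> norm h"
        by (rule norm_le_componentwise_cart) (use q exhaust_3 in \<open>auto simp: axis_def\<close>)
    qed
    have 2: "norm (f ?p2 - f ?p1 - (h $ 2) *\<^sub>R g 2 x) \<le> e / 3 * \<bar>h $ 2\<bar>"
    proof (rule inc)
      fix q assume q: "\<bar>q\<bar> \<le> \<bar>h $ 2\<bar>"
      show "norm (?p1 + q *\<^sub>R axis 2 1 - x) \<le> norm h"
      proof (rule norm_le_componentwise_cart)
        fix i :: 3
        show "norm ((?p1 + q *\<^sub>R axis 2 1 - x) $ i) \<le> norm (h $ i)"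
          using exhaust_3[of i] q by (auto simp: axis_def)
      qed
    qed
    have 3: "norm (f (?p2 + (h $ 3) *\<^sub>R axis 3 1) - f ?p2 - (h $ 3) *\<^sub>R g 3 x) \<le> e / 3 * \<bar>h $ 3\<bar>"
    proof (rule inc)
      fix q assume q: "\<bar>q\<bar> \<le> \<bar>h $ 3\<bar>"
      show "norm (?p2 + q *\<^sub>R axis 3 1 - x) \<le> norm h"
      proof (rule norm_le_componentwise_cart)
        fix i :: 3
        show "norm ((?p2 + q *\<^sub>R axis 3 1 - x) $ i) \<le> norm (h $ i)"
          using exhaust_3[of i] q by (auto simp: axis_def)
      qed
    qed
    have yp: "?p2 + (h $ 3) *\<^sub>R axis 3 1 = y"
      by (simp add: vec_eq_iff forall_3 axis_def h_def)
    have "f y - f x - (\<Sum>i\<in>UNIV. h $ i *\<^sub>R g i x) = (f ?p1 - f x - (h $ 1) *\<^sub>R g 1 x) +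
        (f ?p2 - f ?p1 - (h $ 2) *\<^sub>R g 2 x) + (f y - f ?p2 - (h $ 3) *\<^sub>R g 3 x)"
      by (simp add: sum_3 algebra_simps)
    also have "norm \<dots> \<le> e / 3 * \<bar>h $ 1\<bar> + e / 3 * \<bar>h $ 2\<bar> + e / 3 * \<bar>h $ 3\<bar>"
      by (intro norm_triangle_le add_mono 1 2 3[unfolded yp])
    also have "\<dots> \<le> e / 3 * norm h + e / 3 * norm h + e / 3 * norm h"
      using \<open>e > 0\<close> by (intro add_mono mult_left_mono component_le_norm_cart) auto
    finally show "norm (f y - f x - (\<Sum>i\<in>UNIV. (y - x) $ i *\<^sub>R g i x)) \<le> e * norm (y - x)"
      unfolding h_def by simp
  qed (use r in auto)
qed

lemma C_upto_SucD:
  assumes "C_upto (Suc k) S f"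
  shows "\<exists>g. (\<forall>i. C_upto k S (g i)) \<and> (\<forall>i. \<forall>x\<in>interior S. has_pd f (g i x) i x)"
proof -
  have "\<exists>g. C_upto k S g \<and> (\<forall>x\<in>interior S. has_pd f (g x) i x)" for i
  proof -
    have pd: "\<forall>x\<in>interior S. pdiff_at i f x"
      and ex: "\<exists>g. C_upto k S g \<and> (\<forall>x\<in>interior S. g x = pderiv_at i f x)"
      using assms unfolding C_upto.simps by blast+
    from ex obtain g where g: "C_upto k S g" "\<forall>x\<in>interior S. g x = pderiv_at i f x" by blast
    have "has_pd f (g x) i x" if "x \<in> interior S" for x
      using pdiff_imp_has_pd[of i f x] pd g(2) that by simp
    then show ?thesis using g(1) by blast
  qed
  then have "\<exists>g. \<forall>i. C_upto k S (g i) \<and> (\<forall>x\<in>interior S. has_pd f (g i x) i x)" by (intro choice) blast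
  then show ?thesis by blast
qed

lemma C_upto_continuous: "C_upto k S f \<Longrightarrow> continuous_on S f"
  by (cases k) auto

lemma chain_curve:
  assumes f: "\<And>i y. y \<in> interior S \<Longrightarrow> has_pd f (g i y) i y" "\<And>i. continuous_on S (g i)"
    and \<gamma>: "(\<gamma> has_vector_derivative \<gamma>') (at s)" "\<gamma> s \<in> interior S"
  shows "((\<lambda>t. f (\<gamma> t)) has_vector_derivative (\<Sum>i\<in>UNIV. \<gamma>' $ i *\<^sub>R g i (\<gamma> s))) (at s)"
proof -
  have "isCont (g i) (\<gamma> s)" for i
    using continuous_on_interior[OF f(2) \<gamma>(2)] by simp
  then have "(f has_derivative (\<lambda>h. \<Sum>i\<in>UNIV. h $ i *\<^sub>R g i (\<gamma> s))) (at (\<gamma> s))"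
    by (intro partials_has_derivative[OF open_interior \<gamma>(2)] f(1))
  then have "(f has_derivative (\<lambda>h. \<Sum>i\<in>UNIV. h $ i *\<^sub>R g i (\<gamma> s))) (at (\<gamma> s) within \<gamma> ` UNIV)"
    by (rule has_derivative_at_withinI)
  from vector_derivative_diff_chain_within[OF \<gamma>(1) this] show ?thesis by (simp only: o_def)
qed

lemma lipschitz_open_interval:
  fixes f :: "real \<Rightarrow> 'b::real_inner"
  assumes cont: "continuous_on {a..b} f"
    and d: "\<And>x. a < x \<Longrightarrow> x < b \<Longrightarrow> (f has_vector_derivative f' x) (at x)"
    and bound: "\<And>x. a < x \<Longrightarrow> x < b \<Longrightarrow> norm (f' x) \<le> B"
    and pq: "p \<in> {a..b}" "q \<in> {a..b}"
  shows "norm (f p - f q) \<le> B * \<bar>p - q\<bar>"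
proof -
  have *: "norm (f q - f p) \<le> B * (q - p)" if pq: "p \<in> {a..b}" "q \<in> {a..b}" "p < q" for p q
  proof -
    have "continuous_on {p..q} f" by (rule continuous_on_subset[OF cont]) (use pq in auto)
    moreover have "(f has_derivative (\<lambda>h. h *\<^sub>R f' x)) (at x)" if "p < x" "x < q" for x
      using d[of x] that pq unfolding has_vector_derivative_def by auto
    ultimately obtain x where x: "x \<in> {p<..<q}" "norm (f q - f p) \<le> norm ((q - p) *\<^sub>R f' x)"
      using mvt_general[OF pq(3), of f "\<lambda>x h. h *\<^sub>R f' x"] by blast
    have "norm ((q - p) *\<^sub>R f' x) = norm (f' x) * (q - p)" using pq(3) by simp
    also have "\<dots> \<le> B * (q - p)" using x pq by (intro mult_right_mono bound) auto
    finally show ?thesis using x(2) by simp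
  qed
  consider "p < q" | "q < p" | "p = q" by linarith
  then show ?thesis
  proof cases
    case 1 then show ?thesis using *[OF pq 1] by (simp add: norm_minus_commute)
  next
    case 2 then show ?thesis using *[OF pq(2,1) 2] by simp
  next
    case 3 then show ?thesis by simp
  qed
qed

section \<open>The meridian of longitude 0, where symmetry and homogeneity determine a field\<close>

definition mer :: "real \<Rightarrow> real^3" where
  "mer s = sqrt (1 - s\<^sup>2) *\<^sub>R axis 1 1 + s *\<^sub>R axis 3 1"

lemma mer_nth [simp]: "mer s $ 1 = sqrt (1 - s\<^sup>2)" "mer s $ 2 = 0" "mer s $ 3 = s"
  by (simp_all add: mer_def axis_def)

lemma norm_mer: "\<bar>s\<bar> \<le> 1 \<Longrightarrow> norm (mer s) = 1"
proof -
  assume "\<bar>s\<bar> \<le> 1"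
  then have "s\<^sup>2 \<le> 1" by (simp add: abs_square_le_1)
  then have "(norm (mer s))\<^sup>2 = 1" unfolding norm_sq_3 by simp
  then show ?thesis by (simp add: power2_eq_1_iff) (use norm_ge_zero[of "mer s"] in linarith)
qed

lemma cosang_mer: "\<bar>s\<bar> \<le> 1 \<Longrightarrow> cosang (mer s) = s"
  by (simp add: cosang_def norm_mer)

lemma mer_nonzero: "\<bar>s\<bar> \<le> 1 \<Longrightarrow> mer s \<noteq> 0"
  using norm_mer[of s] by auto

lemma mer_cone: "- 1 < c \<Longrightarrow> s \<in> {c..1} \<Longrightarrow> mer s \<in> pcone c"
  using cosang_mer[of s] mer_nonzero[of s] by (auto simp: abs_le_iff)

lemma mer_interior: "- 1 < c \<Longrightarrow> c < s \<Longrightarrow> s \<le> 1 \<Longrightarrow> mer s \<in> interior (pcone c)"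
  using cosang_mer[of s] mer_nonzero[of s] by (subst interior_cone) (auto simp: abs_le_iff)

lemma mer_deriv:
  assumes "\<bar>s\<bar> < 1"
  shows "(mer has_vector_derivative ((- s / sqrt (1 - s\<^sup>2)) *\<^sub>R axis 1 1 + axis 3 1)) (at s)"
proof -
  have pos: "0 < 1 - s\<^sup>2" using assms by (simp add: abs_square_less_1)
  have "((\<lambda>s. 1 - s\<^sup>2) has_real_derivative - (2 * s)) (at s)" by (auto intro!: derivative_eq_intros)
  from DERIV_chain2[where f = sqrt and g = "\<lambda>s. 1 - s\<^sup>2" and x = s and s = UNIV, OF DERIV_real_sqrt[OF pos] this]
  have sq: "((\<lambda>s. sqrt (1 - s\<^sup>2)) has_real_derivative - s / sqrt (1 - s\<^sup>2)) (at s)"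
    by (rule DERIV_cong) (simp add: field_simps)
  show ?thesis
    unfolding mer_def
    by (intro has_vector_derivative_add[OF has_vector_derivative_scaleR[OF sq has_vector_derivative_const, THEN has_vector_derivative_eq_rhs]
          has_vector_derivative_scaleR[OF DERIV_ident has_vector_derivative_const, THEN has_vector_derivative_eq_rhs]]) simp_all
qed

text \<open>In the parameter \<open>d = sqrt (1 - s)\<close> the meridian is \<open>C\<^sup>1\<close> up to the axis.\<close>

lemma LD_meridian:
  fixes v :: "real^3 \<Rightarrow> 'b::real_inner"
  assumes c: "- 1 < c" "c < 1" and v: "C_upto 1 (pcone c) v"
  shows "LD c (\<lambda>s. v (mer s))"
proof -
  obtain g where g0: "\<forall>i. C_upto 0 (pcone c) (g i)"
    and g1: "\<forall>i. \<forall>x\<in>interior (pcone c). has_pd v (g i x) i x"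
    using C_upto_SucD[OF v[unfolded One_nat_def]] by blast
  have gc: "continuous_on (pcone c) (g i)" for i using g0 C_upto_continuous by blast
  have g: "has_pd v (g i x) i x" if "x \<in> interior (pcone c)" for i x using g1 that by blast
  define d0 where "d0 = sqrt (1 - c)"
  define \<kappa> where "\<kappa> d = mer (1 - d\<^sup>2)" for d
  have d2: "c \<le> 1 - d\<^sup>2" if "0 \<le> d" "d \<le> d0" for d
  proof -
    have "d\<^sup>2 \<le> d0\<^sup>2" using that by (rule power_mono[rotated])
    then show ?thesis using c by (simp add: d0_def)
  qed
  have q: "0 < 2 - d\<^sup>2" if "0 \<le> d" "d \<le> d0" for d using d2[OF that] c by simp
  have d2': "c < 1 - d\<^sup>2" if "0 < d" "d < d0" for d
  proof -
    have "d\<^sup>2 < d0\<^sup>2" using that by (intro power_strict_mono) auto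
    then show ?thesis using c by (simp add: d0_def)
  qed
  \<comment> \<open>The factor \<open>d\<close> comes out of the square root:
    \<open>1 - (1 - d^2)^2 = d^2 (2 - d^2)\<close>. What remains under the root is positive up to
    \<open>d = 0\<close>, the axis.\<close>
  have \<kappa>_eq: "\<kappa> d = (d * sqrt (2 - d\<^sup>2)) *\<^sub>R axis 1 1 + (1 - d\<^sup>2) *\<^sub>R axis 3 1" if "0 \<le> d" for d
  proof -
    have "1 - (1 - d\<^sup>2)\<^sup>2 = d\<^sup>2 * (2 - d\<^sup>2)" by (simp add: power2_eq_square algebra_simps)
    then have "sqrt (1 - (1 - d\<^sup>2)\<^sup>2) = d * sqrt (2 - d\<^sup>2)" using that by (simp add: real_sqrt_mult)
    then show ?thesis by (simp add: \<kappa>_def mer_def)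
  qed
  have \<kappa>_cont: "continuous_on {0..d0} \<kappa>"
    unfolding \<kappa>_def mer_def by (intro continuous_intros)
  have \<kappa>_cone: "\<kappa> d \<in> pcone c" if "d \<in> {0..d0}" for d
    unfolding \<kappa>_def by (rule mer_cone[OF c(1)]) (use d2[of d] that in auto)
  define k1 where "k1 d = sqrt (2 - d\<^sup>2) - d\<^sup>2 / sqrt (2 - d\<^sup>2)" for d
  have qn: "sqrt (2 - d\<^sup>2) \<noteq> 0" if "d \<in> {0..d0}" for d using q[of d] that by simp
  define G where "G d = k1 d *\<^sub>R g 1 (\<kappa> d) + (- 2 * d) *\<^sub>R g 3 (\<kappa> d)" for d
  have "continuous_on {0..d0} k1"
    unfolding k1_def by (intro continuous_intros ballI qn)
  moreover have "continuous_on {0..d0} (\<lambda>d. g i (\<kappa> d))" for i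
    by (rule continuous_on_compose2[OF gc \<kappa>_cont image_subsetI[OF \<kappa>_cone]])
  ultimately have "continuous_on {0..d0} G" unfolding G_def by (intro continuous_intros)
  then have "bounded (G ` {0..d0})" by (intro compact_imp_bounded compact_continuous_image) auto
  then obtain B where B: "\<And>d. d \<in> {0..d0} \<Longrightarrow> norm (G d) \<le> B" unfolding bounded_iff by blast
  have deriv: "((\<lambda>d. v (\<kappa> d)) has_vector_derivative G d) (at d)" if d: "0 < d" "d < d0" for d
  proof -
    have pos: "0 < 2 - d\<^sup>2" using q[of d] d by simp
    have "((\<lambda>d. 2 - d\<^sup>2) has_real_derivative - (2 * d)) (at d)" by (auto intro!: derivative_eq_intros)
    from DERIV_chain2[where f = sqrt and g = "\<lambda>d. 2 - d\<^sup>2" and x = d and s = UNIV, OF DERIV_real_sqrt[OF pos] this]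
    have sq: "((\<lambda>d. sqrt (2 - d\<^sup>2)) has_real_derivative - d / sqrt (2 - d\<^sup>2)) (at d)"
      by (rule DERIV_cong) (simp add: field_simps)
    have "((\<lambda>d. d * sqrt (2 - d\<^sup>2)) has_real_derivative k1 d) (at d)"
      by (rule DERIV_cong[OF DERIV_mult[OF DERIV_ident sq]]) (simp add: k1_def power2_eq_square)
    moreover have "((\<lambda>d. 1 - d\<^sup>2) has_real_derivative - 2 * d) (at d)" by (auto intro!: derivative_eq_intros)
    ultimately have "((\<lambda>d. (d * sqrt (2 - d\<^sup>2)) *\<^sub>R axis 1 1 + (1 - d\<^sup>2) *\<^sub>R axis 3 1 :: real^3)
        has_vector_derivative (((d * sqrt (2 - d\<^sup>2)) *\<^sub>R 0 + k1 d *\<^sub>R axis 1 1) + ((1 - d\<^sup>2) *\<^sub>R 0 + (- 2 * d) *\<^sub>R axis 3 1))) (at d)"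
      by (intro has_vector_derivative_add has_vector_derivative_scaleR has_vector_derivative_const)
    then have "((\<lambda>d. (d * sqrt (2 - d\<^sup>2)) *\<^sub>R axis 1 1 + (1 - d\<^sup>2) *\<^sub>R axis 3 1 :: real^3)
        has_vector_derivative (k1 d *\<^sub>R axis 1 1 + (- 2 * d) *\<^sub>R axis 3 1)) (at d)"
      by (simp only: scaleR_zero_right add_0)
    then have "(\<kappa> has_vector_derivative (k1 d *\<^sub>R axis 1 1 + (- 2 * d) *\<^sub>R axis 3 1)) (at d)"
    proof (rule has_vector_derivative_transform_within_open[where S = "{0<..}"])
      show "(t * sqrt (2 - t\<^sup>2)) *\<^sub>R axis 1 1 + (1 - t\<^sup>2) *\<^sub>R axis 3 1 = \<kappa> t" if "t \<in> {0<..}" for t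
        by (rule \<kappa>_eq[symmetric]) (use that in simp)
    qed (use d in simp_all)
    moreover have "\<kappa> d \<in> interior (pcone c)"
      unfolding \<kappa>_def by (rule mer_interior[OF c(1)]) (use d2'[OF d] in auto)
    ultimately have "((\<lambda>d. v (\<kappa> d)) has_vector_derivative
        (\<Sum>i\<in>UNIV. (k1 d *\<^sub>R axis 1 1 + (- 2 * d) *\<^sub>R axis 3 1 :: real^3) $ i *\<^sub>R g i (\<kappa> d))) (at d)"
      by (intro chain_curve[where S = "pcone c"] g gc)
    then show ?thesis by (simp add: sum_3 axis_def G_def)
  qed
  have vc: "continuous_on {0..d0} (\<lambda>d. v (\<kappa> d))"
    by (rule continuous_on_compose2[OF C_upto_continuous[OF v] \<kappa>_cont image_subsetI[OF \<kappa>_cone]])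
  show ?thesis
  proof (rule LD_I[where L = B])
    fix s t assume st: "s \<in> {c..1}" "t \<in> {c..1}"
    then have "sqrt (1 - s) \<in> {0..d0}" "sqrt (1 - t) \<in> {0..d0}" by (simp_all add: d0_def)
    then have "norm (v (\<kappa> (sqrt (1 - s))) - v (\<kappa> (sqrt (1 - t)))) \<le> B * \<bar>sqrt (1 - s) - sqrt (1 - t)\<bar>"
      by (rule lipschitz_open_interval[OF vc deriv B, rotated 3]) simp_all
    then show "norm (v (mer s) - v (mer t)) \<le> B * \<bar>sqrt (1 - s) - sqrt (1 - t)\<bar>"
      using st by (simp add: \<kappa>_def)
  qed
qed

lemma LD_nth:
  fixes a :: "real \<Rightarrow> real^3"
  assumes "LD c a" shows "LD c (\<lambda>s. a s $ i)"
proof -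
  from assms obtain L where L: "\<forall>s\<in>{c..1}. \<forall>t\<in>{c..1}. norm (a s - a t) \<le> L * \<bar>sqrt (1 - s) - sqrt (1 - t)\<bar>"
    unfolding LD_def ..
  show ?thesis
  proof (rule LD_I[where L = L])
    fix s t assume st: "s \<in> {c..1}" "t \<in> {c..1}"
    have "norm (a s $ i - a t $ i) \<le> norm (a s - a t)"
      using component_le_norm_cart[of "a s - a t" i] by simp
    also have "\<dots> \<le> L * \<bar>sqrt (1 - s) - sqrt (1 - t)\<bar>" using L st by blast
    finally show "norm (a s $ i - a t $ i) \<le> L * \<bar>sqrt (1 - s) - sqrt (1 - t)\<bar>" .
  qed
qed

text \<open>The derivative is taken off the axis only, since the velocity of \<open>mer\<close> is
  unbounded as \<open>s\<close> tends to 1.\<close>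

lemma meridian_C1:
  assumes c: "- 1 < c" "c < 1" and v: "C_upto (Suc k) (pcone c) v"
  shows "\<exists>g. (\<forall>i. C_upto k (pcone c) (g i)) \<and> (\<forall>i. \<forall>x\<in>interior (pcone c). has_pd v (g i x) i x) \<and>
    (\<forall>s. c < s \<longrightarrow> s < 1 \<longrightarrow> ((\<lambda>s. v (mer s)) has_vector_derivative
      (- s / sqrt (1 - s\<^sup>2)) *\<^sub>R g 1 (mer s) + g 3 (mer s)) (at s))"
proof -
  obtain g where g: "\<forall>i. C_upto k (pcone c) (g i)"
    "\<forall>i. \<forall>x\<in>interior (pcone c). has_pd v (g i x) i x"
    using C_upto_SucD[OF v] by blast
  have "((\<lambda>s. v (mer s)) has_vector_derivative
      (- s / sqrt (1 - s\<^sup>2)) *\<^sub>R g 1 (mer s) + g 3 (mer s)) (at s)" if s: "c < s" "s < 1" for s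
  proof -
    have "((\<lambda>s. v (mer s)) has_vector_derivative
        (\<Sum>i\<in>UNIV. ((- s / sqrt (1 - s\<^sup>2)) *\<^sub>R axis 1 1 + axis 3 1 :: real^3) $ i *\<^sub>R g i (mer s))) (at s)"
    proof (rule chain_curve[where S = "pcone c"])
      show "has_pd v (g i y) i y" if "y \<in> interior (pcone c)" for i y using g(2) that by blast
      show "continuous_on (pcone c) (g i)" for i by (rule C_upto_continuous[OF g(1)[rule_format]])
      show "(mer has_vector_derivative (- s / sqrt (1 - s\<^sup>2)) *\<^sub>R axis 1 1 + axis 3 1) (at s)"
        by (rule mer_deriv) (use s c in simp)
      show "mer s \<in> interior (pcone c)" by (rule mer_interior) (use s c in simp_all)
    qed
    then show ?thesis by (simp add: sum_3 axis_def)
  qed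
  then show ?thesis using g by blast
qed

lemma meridian_C2:
  fixes v :: "real^3 \<Rightarrow> real^3"
  assumes c: "- 1 < c" "c < 1" and v: "C_upto 2 (pcone c) v"
  shows "\<exists>v1 v2. \<forall>s. c < s \<longrightarrow> s < 1 \<longrightarrow> ((\<lambda>s. v (mer s)) has_vector_derivative v1 s) (at s) \<and>
    (v1 has_vector_derivative v2 s) (at s)"
proof -
  from meridian_C1[OF c v[unfolded numeral_2_eq_2]]
  obtain g :: "3 \<Rightarrow> real^3 \<Rightarrow> real^3" where g: "\<forall>i. C_upto (Suc 0) (pcone c) (g i)"
    and d: "\<forall>s. c < s \<longrightarrow> s < 1 \<longrightarrow> ((\<lambda>s. v (mer s)) has_vector_derivative
      (- s / sqrt (1 - s\<^sup>2)) *\<^sub>R g 1 (mer s) + g 3 (mer s)) (at s)"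
    by (elim exE conjE) (rule that, assumption+)
  have "\<exists>D. \<forall>s. c < s \<longrightarrow> s < 1 \<longrightarrow> ((\<lambda>s. g i (mer s)) has_vector_derivative D s) (at s)" for i
    using meridian_C1[OF c g[rule_format, of i]] by (elim exE conjE) (rule exI)
  then obtain D where D: "\<And>i s. c < s \<Longrightarrow> s < 1 \<Longrightarrow> ((\<lambda>s. g i (mer s)) has_vector_derivative D i s) (at s)"
    by metis
  define q' where "q' s = - 1 / sqrt (1 - s\<^sup>2) - s\<^sup>2 / (sqrt (1 - s\<^sup>2) * (1 - s\<^sup>2))" for s :: real
  have q: "((\<lambda>s. - s / sqrt (1 - s\<^sup>2)) has_real_derivative q' s) (at s)" if s: "c < s" "s < 1" for s
  proof -
    have pos: "0 < 1 - s\<^sup>2" using s c by (simp add: abs_square_less_1)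
    have "((\<lambda>s. 1 - s\<^sup>2) has_real_derivative - (2 * s)) (at s)" by (auto intro!: derivative_eq_intros)
    from DERIV_chain2[where f = sqrt and g = "\<lambda>s. 1 - s\<^sup>2" and x = s and s = UNIV, OF DERIV_real_sqrt[OF pos] this]
    have sq: "((\<lambda>s. sqrt (1 - s\<^sup>2)) has_real_derivative - s / sqrt (1 - s\<^sup>2)) (at s)"
      by (rule DERIV_cong) (simp add: field_simps)
    have nz: "sqrt (1 - s\<^sup>2) \<noteq> 0" using pos by simp
    let ?w = "sqrt (1 - s\<^sup>2)"
    have w2: "?w * ?w = 1 - s\<^sup>2" using pos by simp
    have "((\<lambda>s. - s / sqrt (1 - s\<^sup>2)) has_real_derivative (- 1 * ?w - - s * (- s / ?w)) / (?w * ?w)) (at s)"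
      by (rule DERIV_divide[OF DERIV_minus[OF DERIV_ident] sq nz])
    then show ?thesis
    proof (rule DERIV_cong)
      have "(- 1 * ?w - - s * (- s / ?w)) / (?w * ?w) = - 1 / ?w - s\<^sup>2 / (?w * (?w * ?w))"
        using nz by (simp add: field_simps power2_eq_square)
      then show "(- 1 * ?w - - s * (- s / ?w)) / (?w * ?w) = q' s" unfolding w2 q'_def .
    qed
  qed
  have "((\<lambda>s. (- s / sqrt (1 - s\<^sup>2)) *\<^sub>R g 1 (mer s) + g 3 (mer s)) has_vector_derivative
      ((- s / sqrt (1 - s\<^sup>2)) *\<^sub>R D 1 s + q' s *\<^sub>R g 1 (mer s)) + D 3 s) (at s)" if s: "c < s" "s < 1" for s
    by (intro has_vector_derivative_add has_vector_derivative_scaleR q D s)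
  then show ?thesis
    using d by (intro exI[of _ "\<lambda>s. (- s / sqrt (1 - s\<^sup>2)) *\<^sub>R g 1 (mer s) + g 3 (mer s)"]
      exI[of _ "\<lambda>s. ((- s / sqrt (1 - s\<^sup>2)) *\<^sub>R D 1 s + q' s *\<^sub>R g 1 (mer s)) + D 3 s"]) simp
qed

section \<open>Averages of the forcing profile\<close>

lemma lower_integral_deriv:
  fixes f :: "real \<Rightarrow> real"
  assumes f: "continuous_on {c..b} f" and s: "s \<in> {c..b}"
  shows "((\<lambda>u. integral {u..b} f) has_real_derivative - f s) (at s within {c..b})"
proof -
  have i: "f integrable_on {c..b}" by (rule integrable_continuous_interval[OF f])
  have "((\<lambda>u. integral {c..b} f - integral {c..u} f) has_real_derivative 0 - f s) (at s within {c..b})"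
    by (intro DERIV_diff DERIV_const)
      (use integral_has_vector_derivative[OF f s] in \<open>simp add: has_real_derivative_iff_has_vector_derivative\<close>)
  then have "((\<lambda>u. integral {c..b} f - integral {c..u} f) has_real_derivative - f s) (at s within {c..b})" by simp
  then show ?thesis
  proof (rule has_field_derivative_transform_within[OF _ zero_less_one s])
    fix u assume "u \<in> {c..b}"
    then show "integral {c..b} f - integral {c..u} f = integral {u..b} f"
      using Henstock_Kurzweil_Integration.integral_combine[OF _ _ i, of u] by auto
  qed
qed

text \<open>Instantiated twice: with the profile \<open>Gam\<close> of the force, and inside
  \<open>solution_riccati\<close> with a profile that contains a still unknown constant of
  integration.\<close>

locale angular_mean =
  fixes c :: real and \<Gamma> :: "real \<Rightarrow> real"
  assumes c: "- 1 < c" "c < 1" and \<Gamma>: "LD c \<Gamma>"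
begin

text \<open>Iterated integrals from the axis: \<open>NN' = J1\<close> and
  \<open>J1' = - \<Gamma>\<close>, both 0 at \<open>s = 1\<close>. For
  \<open>\<Gamma> = Gam\<close>, \<open>NN\<close> is \<open>N_fun\<close> as a function of the
  cosine.\<close>

definition "J1 s = integral {s..1} \<Gamma>"
definition "NN s = integral {s..1} (\<lambda>t. \<Gamma> t * (s - t))"
text \<open>The averages are the regular forms of \<open>J1 s / (1 - s)\<close> and \<open>- NN s / (1 - s)\<^sup>2\<close>; they make sense at \<open>s = 1\<close>.\<close>

definition "I1 s = integral {0..1} (\<lambda>q. \<Gamma> (s + q * (1 - s)))"
definition "I2 s = integral {0..1} (\<lambda>q. q * \<Gamma> (s + q * (1 - s)))"

lemma Gam_cont: "continuous_on {c..1} \<Gamma>"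
  by (rule LD_continuous[OF \<Gamma>])

lemma between: "s \<in> {c..1} \<Longrightarrow> q \<in> {0..1} \<Longrightarrow> s + q * (1 - s) \<in> {s..1}" for s q :: real
proof -
  assume "s \<in> {c..1}" "q \<in> {0..1}"
  then have "0 \<le> q * (1 - s)" "q * (1 - s) \<le> 1 * (1 - s)"
    using mult_right_mono[of q 1 "1 - s"] by simp_all
  then show ?thesis by simp
qed

lemma between_c: "s \<in> {c..1} \<Longrightarrow> q \<in> {0..1} \<Longrightarrow> s + q * (1 - s) \<in> {c..1}"
  using between[of s q] by (meson atLeastAtMost_iff order_trans)

lemma mean_cont: "s \<in> {c..1} \<Longrightarrow> continuous_on {0..1} (\<lambda>q. \<Gamma> (s + q * (1 - s)))"
  by (rule continuous_on_compose2[OF Gam_cont]) (auto intro!: continuous_intros simp del: atLeastAtMost_iff dest: between_c)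

text \<open>Moving from \<open>s\<close> towards 1 by the fraction \<open>q\<close> multiplies
  \<open>sqrt (1 - s)\<close> by \<open>sqrt (1 - q) \<le> 1\<close>, so averaging preserves the
  constant \<open>L\<close>.\<close>

lemma LD_mean:
  assumes w: "continuous_on {0..1} w" "\<And>q. q \<in> {0..1} \<Longrightarrow> \<bar>w q\<bar> \<le> 1"
  shows "LD c (\<lambda>s. integral {0..1} (\<lambda>q. w q * \<Gamma> (s + q * (1 - s))))"
proof -
  obtain L where L: "0 \<le> L"
    "\<And>s t. s \<in> {c..1} \<Longrightarrow> t \<in> {c..1} \<Longrightarrow> norm (\<Gamma> s - \<Gamma> t) \<le> L * \<bar>sqrt (1 - s) - sqrt (1 - t)\<bar>"
    using LD_obtain[OF \<Gamma>] by metis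
  show ?thesis
  proof (rule LD_I[where L = L])
    fix s t assume st: "s \<in> {c..1}" "t \<in> {c..1}"
    let ?d = "\<bar>sqrt (1 - s) - sqrt (1 - t)\<bar>"
    have i: "(\<lambda>q. w q * \<Gamma> (s + q * (1 - s))) integrable_on {0..1}" if "s \<in> {c..1}" for s
      by (intro integrable_continuous_interval continuous_intros w mean_cont that)
    have b: "norm (w q * \<Gamma> (s + q * (1 - s)) - w q * \<Gamma> (t + q * (1 - t))) \<le> L * ?d" if q: "q \<in> {0..1}" for q
    proof -
      have e: "1 - (s + q * (1 - s)) = (1 - q) * (1 - s)" for s :: real by (simp add: algebra_simps)
      have "norm (\<Gamma> (s + q * (1 - s)) - \<Gamma> (t + q * (1 - t))) \<le> L * \<bar>sqrt ((1 - q) * (1 - s)) - sqrt ((1 - q) * (1 - t))\<bar>"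
        using L(2)[OF between_c[OF st(1) q] between_c[OF st(2) q]] unfolding e .
      also have "\<dots> = L * (sqrt (1 - q) * ?d)"
        unfolding real_sqrt_mult right_diff_distrib[symmetric] abs_mult using q by simp
      also have "\<dots> \<le> L * (1 * ?d)" using L(1) q by (intro mult_left_mono mult_right_mono) auto
      finally have "norm (\<Gamma> (s + q * (1 - s)) - \<Gamma> (t + q * (1 - t))) \<le> L * ?d" by simp
      then have "\<bar>w q\<bar> * norm (\<Gamma> (s + q * (1 - s)) - \<Gamma> (t + q * (1 - t))) \<le> 1 * (L * ?d)"
        by (intro mult_mono w q) auto
      then show ?thesis by (simp add: abs_mult flip: right_diff_distrib)
    qed
    have "norm (integral {0..1} (\<lambda>q. w q * \<Gamma> (s + q * (1 - s)) - w q * \<Gamma> (t + q * (1 - t)))) \<le> integral {0..1::real} (\<lambda>q. L * ?d)"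
      by (rule integral_norm_bound_integral) (use b in \<open>auto intro!: integrable_diff i st\<close>)
    then show "norm (integral {0..1} (\<lambda>q. w q * \<Gamma> (s + q * (1 - s))) - integral {0..1} (\<lambda>q. w q * \<Gamma> (t + q * (1 - t))))
        \<le> L * ?d"
      by (simp add: integral_diff[OF i[OF st(1)] i[OF st(2)]])
  qed
qed

lemma LD_I1: "LD c I1"
  using LD_mean[of "\<lambda>q. 1"] by (simp add: I1_def[abs_def])

lemma LD_I2: "LD c I2"
  using LD_mean[of "\<lambda>q. q"] by (simp add: I2_def[abs_def])

lemma substitute:
  fixes f :: "real \<Rightarrow> real"
  assumes f: "continuous_on {c..1} f" and s: "s \<in> {c..1}"
  shows "integral {s..1} f = (1 - s) * integral {0..1} (\<lambda>q. f (s + q * (1 - s)))"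
proof -
  have "((\<lambda>q. (1 - s) *\<^sub>R f (s + q * (1 - s))) has_integral integral {s + 0 * (1 - s)..s + 1 * (1 - s)} f) {0..1}"
  proof (rule has_integral_substitution[where g = "\<lambda>q. s + q * (1 - s)" and c = c and d = 1, OF _ _ _ f])
    show "(\<lambda>q. s + q * (1 - s)) ` {0..1} \<subseteq> {c..1}" by (rule image_subsetI) (rule between_c[OF s])
    show "((\<lambda>q. s + q * (1 - s)) has_field_derivative 1 - s) (at x within {0..1})" for x
      by (auto intro!: derivative_eq_intros)
  qed (use s in auto)
  then have "integral {0..1} (\<lambda>q. (1 - s) * f (s + q * (1 - s))) = integral {s..1} f"
    by (intro integral_unique) simp
  then show ?thesis by simp
qed

lemma J1_eq: "s \<in> {c..1} \<Longrightarrow> J1 s = (1 - s) * I1 s"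
  unfolding J1_def I1_def by (rule substitute[OF Gam_cont])

lemma NN_eq: "s \<in> {c..1} \<Longrightarrow> NN s = - ((1 - s)\<^sup>2 * I2 s)"
proof -
  assume s: "s \<in> {c..1}"
  have "NN s = (1 - s) * integral {0..1} (\<lambda>q. \<Gamma> (s + q * (1 - s)) * (s - (s + q * (1 - s))))"
    unfolding NN_def by (rule substitute[OF _ s]) (intro continuous_intros Gam_cont)
  also have "(\<lambda>q. \<Gamma> (s + q * (1 - s)) * (s - (s + q * (1 - s)))) = (\<lambda>q. (- (1 - s)) * (q * \<Gamma> (s + q * (1 - s))))"
    by (auto simp: algebra_simps)
  also have "integral {0..1} \<dots> = (- (1 - s)) * I2 s" unfolding I2_def by (rule integral_mult_right)
  finally show ?thesis by (simp add: power2_eq_square algebra_simps)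
qed

lemma dJ1: "s \<in> {c..1} \<Longrightarrow> (J1 has_real_derivative - \<Gamma> s) (at s within {c..1})"
  unfolding J1_def[abs_def] by (rule lower_integral_deriv[OF Gam_cont])

lemma dNN: "s \<in> {c..1} \<Longrightarrow> (NN has_real_derivative J1 s) (at s within {c..1})"
proof -
  assume s: "s \<in> {c..1}"
  have c2: "continuous_on {c..1} (\<lambda>t. t * \<Gamma> t)" by (intro continuous_intros Gam_cont)
  have "((\<lambda>s. s * J1 s - integral {s..1} (\<lambda>t. t * \<Gamma> t)) has_real_derivative
      (1 * J1 s + - \<Gamma> s * s) - - (s * \<Gamma> s)) (at s within {c..1})"
    by (intro DERIV_diff DERIV_mult' DERIV_mult DERIV_ident dJ1 s lower_integral_deriv[OF c2])
  then have "((\<lambda>s. s * J1 s - integral {s..1} (\<lambda>t. t * \<Gamma> t)) has_real_derivative J1 s) (at s within {c..1})"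
    by simp
  then show ?thesis
  proof (rule has_field_derivative_transform_within[OF _ zero_less_one s])
    fix u assume u: "u \<in> {c..1}"
    then have sub: "{u..1} \<subseteq> {c..1}" by auto
    have "NN u = integral {u..1} (\<lambda>t. u * \<Gamma> t - t * \<Gamma> t)" unfolding NN_def by (simp add: algebra_simps)
    also have "\<dots> = integral {u..1} (\<lambda>t. u * \<Gamma> t) - integral {u..1} (\<lambda>t. t * \<Gamma> t)"
      by (intro integral_diff integrable_continuous_interval continuous_intros
          continuous_on_subset[OF Gam_cont sub])
    finally show "u * J1 u - integral {u..1} (\<lambda>t. t * \<Gamma> t) = NN u" by (simp add: J1_def)
  qed
qed

text \<open>\<open>nn\<close> and \<open>mm\<close> are the regular forms of
  \<open>NN / (1 - s^2)^2\<close> and \<open>NN / (1 - s^2)\<close>. \<open>mm\<close> is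
  \<open>C^1\<close> up to the axis with derivative \<open>mm1\<close>, whereas \<open>nn\<close> is
  differentiated only off the axis. \<open>mm2\<close> and \<open>nn1\<close> are the derivatives of
  \<open>mm1\<close> and \<open>nn\<close> there; at \<open>s = 1\<close> they are 0 because of
  \<open>x / 0 = 0\<close>.\<close>

definition "nn s = - (I2 s / (1 + s)\<^sup>2)"
definition "mm s = (1 - s\<^sup>2) * nn s"
definition "mm1 s = I1 s / (1 + s) + 2 * s * nn s"
definition "mm2 s = (2 * mm s + 4 * s * mm1 s - \<Gamma> s) / (1 - s\<^sup>2)"
definition "nn1 s = (mm1 s + 2 * s * nn s) / (1 - s\<^sup>2)"

lemma plus_pos: "s \<in> {c..1} \<Longrightarrow> 0 < 1 + s" using c by auto

lemma one_minus_square_pos: "c < s \<Longrightarrow> s < 1 \<Longrightarrow> 0 < 1 - s\<^sup>2" using c by (simp add: abs_square_less_1)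

lemma LD_nn: "LD c nn"
proof -
  have "LD c (\<lambda>s. (- 1) * (I2 s * (1 / (1 + s))\<^sup>2))"
    by (intro LD_mult LD_const LD_I2 LD_power2 LD_inverse_1_plus c)
  then show ?thesis by (simp add: nn_def[abs_def] power_divide)
qed

lemma LD_mm: "LD c mm"
  unfolding mm_def[abs_def] by (intro LD_mult LD_diff LD_const LD_power2 LD_id LD_nn)

lemma LD_mm1: "LD c mm1"
proof -
  have "LD c (\<lambda>s. I1 s * (1 / (1 + s)) + 2 * s * nn s)"
    by (intro LD_add LD_mult LD_const LD_I1 LD_inverse_1_plus LD_id LD_nn c)
  then show ?thesis by (simp add: mm1_def[abs_def])
qed

lemma NN_mm: "s \<in> {c..1} \<Longrightarrow> NN s = (1 - s\<^sup>2) * mm s"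
proof -
  assume s: "s \<in> {c..1}"
  have "1 - s\<^sup>2 = (1 - s) * (1 + s)" by (simp add: power2_eq_square algebra_simps)
  then have "(1 - s\<^sup>2) * mm s = ((1 - s) * (1 + s)) * (((1 - s) * (1 + s)) * nn s)" unfolding mm_def by simp
  also have "\<dots> = (1 - s)\<^sup>2 * ((1 + s)\<^sup>2 * nn s)" by (simp only: power2_eq_square mult_ac)
  also have "(1 + s)\<^sup>2 * nn s = - I2 s" using plus_pos[OF s] by (simp add: nn_def)
  finally show ?thesis using NN_eq[OF s] by simp
qed

lemma mm1_eq: "s \<in> {c..1} \<Longrightarrow> (1 - s\<^sup>2) * mm1 s = J1 s + 2 * s * mm s"
proof -
  assume s: "s \<in> {c..1}"
  have "1 - s\<^sup>2 = (1 - s) * (1 + s)" by (simp add: power2_eq_square algebra_simps)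
  then have "(1 - s\<^sup>2) * (I1 s / (1 + s)) = J1 s" using plus_pos[OF s] J1_eq[OF s] by simp
  then show ?thesis by (simp add: mm1_def mm_def distrib_left)
qed

lemma mean_1: "I1 1 = \<Gamma> 1" "I2 1 = \<Gamma> 1 / 2"
proof -
  show "I1 1 = \<Gamma> 1" by (simp add: I1_def)
  have "((\<lambda>q. q * \<Gamma> 1) has_integral (1\<^sup>2 / 2 * \<Gamma> 1 - 0\<^sup>2 / 2 * \<Gamma> 1)) {0..1}"
    by (rule fundamental_theorem_of_calculus)
      (auto intro!: derivative_eq_intros simp flip: has_real_derivative_iff_has_vector_derivative)
  then show "I2 1 = \<Gamma> 1 / 2" unfolding I2_def by (simp add: integral_unique)
qed

lemma mm1_1: "mm1 1 = \<Gamma> 1 / 4" and nn_1: "nn 1 = - (\<Gamma> 1 / 8)"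
  by (simp_all add: mm1_def nn_def mean_1)

lemma within_at: "c < s \<Longrightarrow> s < 1 \<Longrightarrow> (a has_real_derivative D) (at s within {c..1}) \<Longrightarrow> (a has_real_derivative D) (at s)"
  by (simp add: at_within_Icc_at)

lemma has_deriv_quotient:
  assumes s: "c \<le> s" "s < 1" and a: "(a has_real_derivative a') (at s within {c..1})"
    and eq: "\<And>t. t \<in> {c..1} \<Longrightarrow> a t = (1 - t\<^sup>2) * b t"
  shows "(b has_real_derivative (a' + 2 * s * b s) / (1 - s\<^sup>2)) (at s within {c..1})"
proof -
  have pos: "0 < 1 - s\<^sup>2" using s c by (simp add: abs_square_less_1)
  have "((\<lambda>t. 1 - t\<^sup>2) has_real_derivative - (2 * s)) (at s within {c..1})" by (auto intro!: derivative_eq_intros)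
  from DERIV_divide[OF a this] have
    "((\<lambda>t. a t / (1 - t\<^sup>2)) has_real_derivative (a' * (1 - s\<^sup>2) - a s * - (2 * s)) / ((1 - s\<^sup>2) * (1 - s\<^sup>2))) (at s within {c..1})"
    using pos by simp
  moreover have as: "a s = (1 - s\<^sup>2) * b s" using eq[of s] s by simp
  have "(a' * (1 - s\<^sup>2) - a s * - (2 * s)) / ((1 - s\<^sup>2) * (1 - s\<^sup>2)) = (a' + 2 * s * b s) / (1 - s\<^sup>2)"
  proof -
    have "a' * (1 - s\<^sup>2) - a s * - (2 * s) = (1 - s\<^sup>2) * (a' + 2 * s * b s)"
      unfolding as by (simp add: algebra_simps)
    then show ?thesis using pos by simp
  qed
  ultimately have d: "((\<lambda>t. a t / (1 - t\<^sup>2)) has_real_derivative (a' + 2 * s * b s) / (1 - s\<^sup>2)) (at s within {c..1})"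
    by (simp only:)
  show ?thesis
  proof (rule has_field_derivative_transform_within[OF d, of "1 - s"])
    fix t assume t: "t \<in> {c..1}" "dist t s < 1 - s"
    then have "t < 1" by (simp add: dist_real_def)
    then have "0 < 1 - t\<^sup>2" using t c by (simp add: abs_square_less_1)
    then show "a t / (1 - t\<^sup>2) = b t" using eq[OF t(1)] by simp
  qed (use s in auto)
qed

lemma dmm: "s \<in> {c..1} \<Longrightarrow> (mm has_real_derivative mm1 s) (at s within {c..1})"
proof (cases "s = 1")
  case False
  moreover assume s: "s \<in> {c..1}"
  ultimately have s': "c \<le> s" "s < 1" by auto
  have "(mm has_real_derivative (J1 s + 2 * s * mm s) / (1 - s\<^sup>2)) (at s within {c..1})"
    by (rule has_deriv_quotient[OF s' dNN[OF s] NN_mm])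
  moreover have "(J1 s + 2 * s * mm s) / (1 - s\<^sup>2) = mm1 s"
  proof -
    have "0 < 1 - s\<^sup>2" using s' c by (simp add: abs_square_less_1)
    then show ?thesis unfolding mm1_eq[OF s, symmetric] by simp
  qed
  ultimately show ?thesis by (simp only:)
next
  case True
  \<comment> \<open>At the axis the quotient rule breaks down, but
    \<open>mm t = (1 - t) * (1 + t) * nn t\<close> gives the difference quotient
    \<open>- (1 + t) * nn t\<close> directly.\<close>
  have "((\<lambda>t. (1 + t) * nn t) \<longlongrightarrow> (1 + 1) * nn 1) (at 1 within {c..1})"
    using LD_continuous[OF LD_nn] c by (intro tendsto_intros) (auto simp: continuous_on_def)
  then have lim: "((\<lambda>t. - ((1 + t) * nn t)) \<longlongrightarrow> mm1 1) (at 1 within {c..1})"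
    using tendsto_minus by (fastforce simp: mm1_1 nn_1)
  have "((\<lambda>t. (mm t - mm 1) / (t - 1)) \<longlongrightarrow> mm1 1) (at 1 within {c..1})"
  proof (rule Lim_transform_eventually[OF lim])
    have "- ((1 + t) * nn t) = (mm t - mm 1) / (t - 1)" if "t \<noteq> 1" for t
    proof -
      have "mm t - mm 1 = - ((1 + t) * nn t) * (t - 1)"
        by (simp add: mm_def power2_eq_square algebra_simps)
      then show ?thesis using that by simp
    qed
    then show "eventually (\<lambda>t. - ((1 + t) * nn t) = (mm t - mm 1) / (t - 1)) (at 1 within {c..1})"
      unfolding eventually_at_filter by (intro always_eventually) simp
  qed
  then show ?thesis unfolding True has_field_derivative_iff .
qed

lemma dmm1: "c < s \<Longrightarrow> s < 1 \<Longrightarrow> (mm1 has_real_derivative mm2 s) (at s)"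
proof (rule within_at)
  assume s: "c < s" "s < 1"
  then have s': "s \<in> {c..1}" by simp
  have "((\<lambda>s. J1 s + 2 * s * mm s) has_real_derivative - \<Gamma> s + (2 * 1 * mm s + mm1 s * (2 * s))) (at s within {c..1})"
    by (intro DERIV_add dJ1 s' DERIV_mult DERIV_cmult DERIV_ident dmm)
  from has_deriv_quotient[OF _ s(2) this mm1_eq[symmetric]] s
  have "(mm1 has_real_derivative (- \<Gamma> s + (2 * 1 * mm s + mm1 s * (2 * s)) + 2 * s * mm1 s) / (1 - s\<^sup>2)) (at s within {c..1})"
    by simp
  then show "(mm1 has_real_derivative mm2 s) (at s within {c..1})"
    by (rule DERIV_cong) (simp add: mm2_def algebra_simps)
qed

lemma dnn: "c < s \<Longrightarrow> s < 1 \<Longrightarrow> (nn has_real_derivative nn1 s) (at s)"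
proof (rule within_at)
  assume s: "c < s" "s < 1"
  show "(nn has_real_derivative nn1 s) (at s within {c..1})"
    unfolding nn1_def by (rule has_deriv_quotient[OF _ s(2) dmm mm_def]) (use s in auto)
qed

lemma one_minus_square_pos': "s \<in> {c..1} \<Longrightarrow> s \<noteq> 1 \<Longrightarrow> 0 < 1 - s\<^sup>2"
  using c by (simp add: abs_square_less_1 abs_less_iff)

text \<open>At \<open>s = 1\<close> the right side vanishes by the values of \<open>mm1\<close> and
  \<open>nn\<close> there; the same happens in \<open>mm2_eq\<close>. These products are thus
  regular up to the axis, unlike \<open>nn1\<close> and \<open>mm2\<close> themselves.\<close>

lemma nn1_eq: "s \<in> {c..1} \<Longrightarrow> (1 - s\<^sup>2) * nn1 s = mm1 s + 2 * s * nn s"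
proof (cases "s = 1")
  case False
  assume "s \<in> {c..1}"
  from one_minus_square_pos'[OF this False] show ?thesis by (simp add: nn1_def)
qed (simp add: mm1_1 nn_1)

lemma mm2_eq: "s \<in> {c..1} \<Longrightarrow> (1 - s\<^sup>2) * mm2 s = 2 * mm s + 4 * s * mm1 s - \<Gamma> s"
proof (cases "s = 1")
  case False
  assume "s \<in> {c..1}"
  from one_minus_square_pos'[OF this False] show ?thesis by (simp add: mm2_def)
qed (simp add: mm1_1 mm_def)

end

section \<open>The differential operators on angular fields\<close>

abbreviation R :: "real^3 \<Rightarrow> real" where "R x \<equiv> inverse (norm x)"

text \<open>The velocity of rotation about the third axis: at \<open>x\<close> it is
  \<open>norm x\<close> times the sine of the polar angle times \<open>e_theta\<close>. Unlike
  \<open>e_theta\<close> it is linear in \<open>x\<close>.\<close>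

definition rotz :: "real^3 \<Rightarrow> real^3" where
  "rotz x = (x $ 1) *\<^sub>R axis 2 1 - (x $ 2) *\<^sub>R axis 1 1"

lemma rotz_nth: "rotz x $ 1 = - x $ 2" "rotz x $ 2 = x $ 1" "rotz x $ 3 = 0"
  by (simp_all add: rotz_def axis_def)

lemma bounded_linear_rotz: "bounded_linear rotz"
  unfolding rotz_def[abs_def]
  by (intro bounded_linear_sub bounded_linear_compose[OF bounded_linear_scaleR_left bounded_linear_vec_nth])

text \<open>Functions of degree \<open>- k\<close> with angular part \<open>a\<close>; this class is closed under differentiation up to
  the components of \<open>R x *\<^sub>R x\<close>.\<close>

definition E :: "nat \<Rightarrow> (real \<Rightarrow> real) \<Rightarrow> real^3 \<Rightarrow> real" where
  "E k a x = a (cosang x) * R x ^ k"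

definition dE :: "nat \<Rightarrow> (real \<Rightarrow> real) \<Rightarrow> (real \<Rightarrow> real) \<Rightarrow> 3 \<Rightarrow> real^3 \<Rightarrow> real" where
  "dE k a a1 i x = kron i 3 * E (k + 1) a1 x - x $ i * E (k + 2) (\<lambda>s. k * a s + s * a1 s) x"

lemma has_pd_E:
  assumes x: "x \<noteq> 0" and a: "(a has_real_derivative a1 (cosang x)) (at (cosang x))"
  shows "has_pd (E k a) (dE k a a1 i x) i x"
proof -
  have "has_pd (\<lambda>x. a (cosang x)) (a1 (cosang x) * dcos i x) i x"
    by (rule has_pd_compose[OF a has_pd_dcos[OF x]])
  from has_pd_mult[OF this has_pd_inverse_norm_power[OF x, of k i]]
  show ?thesis
    unfolding E_def[abs_def] dE_def dcos_def
    by (rule has_pd_eq_rhs) (simp add: power_add power2_eq_square algebra_simps)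
qed

text \<open>The second derivative taken twice in the same direction, which is what the Laplacian
  sums.\<close>

definition ddE :: "nat \<Rightarrow> (real \<Rightarrow> real) \<Rightarrow> (real \<Rightarrow> real) \<Rightarrow> (real \<Rightarrow> real) \<Rightarrow> 3 \<Rightarrow> real^3 \<Rightarrow> real" where
  "ddE k a a1 a2 i x = kron i 3 * dE (k + 1) a1 a2 i x -
    (x $ i * dE (k + 2) (\<lambda>s. k * a s + s * a1 s) (\<lambda>s. (k + 1) * a1 s + s * a2 s) i x +
      E (k + 2) (\<lambda>s. k * a s + s * a1 s) x)"

lemma has_pd_dE:
  assumes x: "x \<noteq> 0" and a: "(a has_real_derivative a1 (cosang x)) (at (cosang x))"
    and a1: "(a1 has_real_derivative a2 (cosang x)) (at (cosang x))"
  shows "has_pd (dE k a a1 i) (ddE k a a1 a2 i x) i x"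
proof -
  have "((\<lambda>s. k * a s + s * a1 s) has_real_derivative (k + 1) * a1 (cosang x) + cosang x * a2 (cosang x)) (at (cosang x))"
    by (rule DERIV_cong[OF DERIV_add[OF DERIV_cmult[OF a] DERIV_mult[OF DERIV_ident a1]]])
      (simp add: algebra_simps)
  then have 2: "has_pd (E (k + 2) (\<lambda>s. k * a s + s * a1 s))
      (dE (k + 2) (\<lambda>s. k * a s + s * a1 s) (\<lambda>s. (k + 1) * a1 s + s * a2 s) i x) i x"
    by (rule has_pd_E[OF x, of "\<lambda>s. k * a s + s * a1 s" "\<lambda>s. (k + 1) * a1 s + s * a2 s"])
  have 3: "has_pd (\<lambda>x. x $ i) 1 i x" using has_pd_coord[of i i x] by (simp add: kron_def)
  have "has_pd (\<lambda>x. kron i 3 * E (k + 1) a1 x - x $ i * E (k + 2) (\<lambda>s. k * a s + s * a1 s) x)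
     ((kron i 3 * dE (k + 1) a1 a2 i x + 0 * E (k + 1) a1 x) -
      (x $ i * dE (k + 2) (\<lambda>s. k * a s + s * a1 s) (\<lambda>s. (k + 1) * a1 s + s * a2 s) i x +
       1 * E (k + 2) (\<lambda>s. k * a s + s * a1 s) x)) i x"
    by (intro has_pd_diff has_pd_mult has_pd_const has_pd_E[OF x, of a1 a2, OF a1] 2 3)
  then show ?thesis unfolding dE_def[abs_def] ddE_def by (simp add: add.commute[of "real k" 1])
qed

lemma R_norm: "x \<noteq> 0 \<Longrightarrow> R x * norm x = 1"
  by simp

lemma x3_R: "x \<noteq> 0 \<Longrightarrow> x $ 3 * R x = cosang x"
  by (simp add: cosang_def divide_inverse)

lemma sq_R: "x \<noteq> 0 \<Longrightarrow> (x $ 1)\<^sup>2 * (R x)\<^sup>2 + (x $ 2)\<^sup>2 * (R x)\<^sup>2 + (x $ 3)\<^sup>2 * (R x)\<^sup>2 = 1"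
proof -
  assume x: "x \<noteq> 0"
  have "(x $ 1)\<^sup>2 * (R x)\<^sup>2 + (x $ 2)\<^sup>2 * (R x)\<^sup>2 + (x $ 3)\<^sup>2 * (R x)\<^sup>2 = (norm x)\<^sup>2 * (R x)\<^sup>2"
    unfolding norm_sq_3 by (simp add: algebra_simps)
  also have "\<dots> = (R x * norm x)\<^sup>2" by (simp add: power_mult_distrib)
  also have "\<dots> = 1" unfolding R_norm[OF x] by simp
  finally show ?thesis .
qed

text \<open>The Laplacian in spherical coordinates: on functions of degree \<open>- k\<close> it
  acts on the profile as the Legendre operator plus \<open>k (k - 1)\<close>. The sum over
  directions only uses \<open>x $ 3 * R x = s\<close> and that \<open>R x *\<^sub>R x\<close> is a
  unit vector.\<close>

lemma sum_ddE:
  fixes x :: "real^3"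
  assumes x: "x \<noteq> 0"
  shows "(\<Sum>i\<in>UNIV. ddE k a a1 a2 i x) = E (k + 2) (\<lambda>s. (1 - s\<^sup>2) * a2 s - 2 * s * a1 s + real k * (real k - 1) * a s) x"
proof -
  define s where "s = cosang x"
  define r where "r = R x"
  define b0 where "b0 = k * a s + s * a1 s"
  define b1 where "b1 = (k + 1) * a1 s + s * a2 s"
  have x3: "x $ 3 * r = s" using x3_R[OF x] by (simp add: r_def s_def)
  have sq: "(x $ 1)\<^sup>2 * r\<^sup>2 + (x $ 2)\<^sup>2 * r\<^sup>2 + (x $ 3)\<^sup>2 * r\<^sup>2 = 1" using sq_R[OF x] by (simp only: r_def)
  have D: "ddE k a a1 a2 i x = r ^ k * (kron i 3 * kron i 3 * (a2 s * r\<^sup>2) - 2 * (kron i 3 * ((x $ i * r) * r\<^sup>2 * b1)) +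
      (x $ i)\<^sup>2 * r\<^sup>2 * (r\<^sup>2 * ((k + 2) * b0 + s * b1)) - r\<^sup>2 * b0)" for i
    unfolding ddE_def dE_def E_def r_def[symmetric] s_def[symmetric] b0_def b1_def
    by (simp add: power_add power2_eq_square algebra_simps)
  have "(\<Sum>i\<in>UNIV. ddE k a a1 a2 i x) = r ^ k * (a2 s * r\<^sup>2 - 2 * ((x $ 3 * r) * r\<^sup>2 * b1) +
      ((x $ 1)\<^sup>2 * r\<^sup>2 + (x $ 2)\<^sup>2 * r\<^sup>2 + (x $ 3)\<^sup>2 * r\<^sup>2) * (r\<^sup>2 * ((k + 2) * b0 + s * b1)) - 3 * (r\<^sup>2 * b0))"
    unfolding sum_3 D by (simp add: kron_def algebra_simps)
  also have "\<dots> = r ^ k * r\<^sup>2 * (a2 s - 2 * (s * b1) + ((k + 2) * b0 + s * b1) - 3 * b0)"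
    unfolding x3 sq by (simp add: algebra_simps)
  also have "a2 s - 2 * (s * b1) + ((k + 2) * b0 + s * b1) - 3 * b0 =
      (1 - s\<^sup>2) * a2 s - 2 * s * a1 s + real k * (real k - 1) * a s"
    by (simp add: b0_def b1_def power2_eq_square algebra_simps)
  finally show ?thesis by (simp add: E_def r_def s_def power_add power2_eq_square ac_simps)
qed

text \<open>The components in the moving basis, times \<open>norm x\<close>, are
  \<open>A - s B\<close> radially, \<open>sin \<phi> B\<close> along \<open>e_phi\<close> and
  \<open>sin \<phi> D\<close> along \<open>e_theta\<close>. The frame of \<open>x\<close>, the third
  axis and \<open>rotz x\<close> is preferred because its vectors are constant or linear in
  \<open>x\<close>. The computation serves both the construction of a solution and the analysis of a
  given one.\<close>

locale angular_field =
  fixes c :: real and A A1 A2 B B1 B2 D D1 D2 Q Q1 :: "real \<Rightarrow> real"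
    and u :: "real^3 \<Rightarrow> real^3" and p :: "real^3 \<Rightarrow> real"
  assumes c: "- 1 < c" "c < 1"
    and A: "\<And>s. c < s \<Longrightarrow> s < 1 \<Longrightarrow> (A has_real_derivative A1 s) (at s)"
      "\<And>s. c < s \<Longrightarrow> s < 1 \<Longrightarrow> (A1 has_real_derivative A2 s) (at s)"
    and B: "\<And>s. c < s \<Longrightarrow> s < 1 \<Longrightarrow> (B has_real_derivative B1 s) (at s)"
      "\<And>s. c < s \<Longrightarrow> s < 1 \<Longrightarrow> (B1 has_real_derivative B2 s) (at s)"
    and D: "\<And>s. c < s \<Longrightarrow> s < 1 \<Longrightarrow> (D has_real_derivative D1 s) (at s)"
      "\<And>s. c < s \<Longrightarrow> s < 1 \<Longrightarrow> (D1 has_real_derivative D2 s) (at s)"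
    and Q: "\<And>s. c < s \<Longrightarrow> s < 1 \<Longrightarrow> (Q has_real_derivative Q1 s) (at s)"
    and u: "\<And>x. x \<noteq> 0 \<Longrightarrow> c < cosang x \<Longrightarrow> cosang x < 1 \<Longrightarrow>
      u x = E 2 A x *\<^sub>R x - E 1 B x *\<^sub>R axis 3 1 + E 2 D x *\<^sub>R rotz x"
    and p: "\<And>x. x \<noteq> 0 \<Longrightarrow> c < cosang x \<Longrightarrow> cosang x < 1 \<Longrightarrow> p x = E 2 Q x"
begin

definition "W = {x. x \<noteq> 0 \<and> cosang x \<in> {c<..<1}}"

lemma W: "x \<in> W \<Longrightarrow> x \<noteq> 0" "x \<in> W \<Longrightarrow> c < cosang x" "x \<in> W \<Longrightarrow> cosang x < 1"
  by (auto simp: W_def)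

lemma open_W: "open W"
  unfolding W_def by (rule open_cosang) simp

definition "du i x = (E 2 A x *\<^sub>R axis i 1 + dE 2 A A1 i x *\<^sub>R x) - (E 1 B x *\<^sub>R 0 + dE 1 B B1 i x *\<^sub>R axis 3 1) +
   (E 2 D x *\<^sub>R rotz (axis i 1) + dE 2 D D1 i x *\<^sub>R rotz x)"

lemma has_pd_u: "x \<in> W \<Longrightarrow> has_pd u (du i x) i x"
proof -
  assume x: "x \<in> W"
  have "has_pd (\<lambda>x. E 2 A x *\<^sub>R x - E 1 B x *\<^sub>R axis 3 1 + E 2 D x *\<^sub>R rotz x) (du i x) i x"
    unfolding du_def
    by (intro has_pd_add has_pd_diff has_pd_scaleR has_pd_E A B D W x has_pd_id has_pd_const
        has_pd_bounded_linear[OF bounded_linear_rotz])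
  then show ?thesis by (rule has_pd_transform[OF _ open_W x]) (simp add: u W)
qed

lemma second_derivative:
  assumes x: "x \<in> W"
  shows "pderiv_at i (pderiv_at i u) x =
    (2 * dE 2 A A1 i x) *\<^sub>R axis i 1 + ddE 2 A A1 A2 i x *\<^sub>R x - ddE 1 B B1 B2 i x *\<^sub>R axis 3 1 +
    ((2 * dE 2 D D1 i x) *\<^sub>R rotz (axis i 1) + ddE 2 D D1 D2 i x *\<^sub>R rotz x)"
proof -
  have "has_pd (du i) (((E 2 A x *\<^sub>R 0 + dE 2 A A1 i x *\<^sub>R axis i 1) + (dE 2 A A1 i x *\<^sub>R axis i 1 + ddE 2 A A1 A2 i x *\<^sub>R x))
      - ((E 1 B x *\<^sub>R 0 + dE 1 B B1 i x *\<^sub>R 0) + (dE 1 B B1 i x *\<^sub>R 0 + ddE 1 B B1 B2 i x *\<^sub>R axis 3 1))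
      + ((E 2 D x *\<^sub>R 0 + dE 2 D D1 i x *\<^sub>R rotz (axis i 1)) +
         (dE 2 D D1 i x *\<^sub>R rotz (axis i 1) + ddE 2 D D1 D2 i x *\<^sub>R rotz x))) i x"
    unfolding du_def[abs_def]
    by (intro has_pd_add has_pd_diff has_pd_scaleR has_pd_E has_pd_dE A B D W x has_pd_id has_pd_const
        has_pd_bounded_linear[OF bounded_linear_rotz])
  moreover have "du i y = pderiv_at i u y" if "y \<in> W" for y
    using has_pd_imp_pderiv[OF has_pd_u[OF that]] by simp
  ultimately have "has_pd (pderiv_at i u) (((E 2 A x *\<^sub>R 0 + dE 2 A A1 i x *\<^sub>R axis i 1) + (dE 2 A A1 i x *\<^sub>R axis i 1 + ddE 2 A A1 A2 i x *\<^sub>R x))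
      - ((E 1 B x *\<^sub>R 0 + dE 1 B B1 i x *\<^sub>R 0) + (dE 1 B B1 i x *\<^sub>R 0 + ddE 1 B B1 B2 i x *\<^sub>R axis 3 1))
      + ((E 2 D x *\<^sub>R 0 + dE 2 D D1 i x *\<^sub>R rotz (axis i 1)) +
         (dE 2 D D1 i x *\<^sub>R rotz (axis i 1) + ddE 2 D D1 D2 i x *\<^sub>R rotz x))) i x"
    by (rule has_pd_transform[OF _ open_W x])
  from has_pd_imp_pderiv[OF this] show ?thesis
    by (simp add: scaleR_2 flip: scaleR_scaleR)
qed

abbreviation "frame x a b d \<equiv> R x ^ 3 *\<^sub>R (a *\<^sub>R (R x *\<^sub>R x) + b *\<^sub>R axis 3 1 + d *\<^sub>R (R x *\<^sub>R rotz x))"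

lemma laplacian_u:
  assumes x: "x \<in> W"
  defines "s \<equiv> cosang x"
  shows "laplacian u x = frame x ((1 - s\<^sup>2) * A2 s - 4 * s * A1 s - 2 * A s)
    (2 * A1 s - ((1 - s\<^sup>2) * B2 s - 2 * s * B1 s)) ((1 - s\<^sup>2) * D2 s - 4 * s * D1 s - 2 * D s)"
proof -
  have 1: "(\<Sum>i\<in>UNIV. ddE k a a1 a2 i x) = R x ^ (k + 2) * ((1 - s\<^sup>2) * a2 s - 2 * s * a1 s + real k * (real k - 1) * a s)"
    for k a a1 a2 using sum_ddE[OF W(1)[OF x]] by (simp add: E_def s_def)
  have "laplacian u x = (\<Sum>i\<in>UNIV. (2 * dE 2 A A1 i x) *\<^sub>R axis i 1) + (\<Sum>i\<in>UNIV. ddE 2 A A1 A2 i x) *\<^sub>R x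
     - (\<Sum>i\<in>UNIV. ddE 1 B B1 B2 i x) *\<^sub>R axis 3 1 +
     ((\<Sum>i\<in>UNIV. (2 * dE 2 D D1 i x) *\<^sub>R rotz (axis i 1)) + (\<Sum>i\<in>UNIV. ddE 2 D D1 D2 i x) *\<^sub>R rotz x)"
    unfolding laplacian_def second_derivative[OF x] by (simp add: sum.distrib sum_subtractf scaleR_sum_left)
  moreover have "(\<Sum>i\<in>UNIV. (2 * dE 2 A A1 i x) *\<^sub>R axis i 1) = (2 * R x ^ 3 * A1 s) *\<^sub>R axis 3 1 - (2 * R x ^ 4 * (2 * A s + s * A1 s)) *\<^sub>R x"
    by (simp add: vec_eq_iff forall_3 sum_3 axis_def dE_def E_def kron_def s_def power3_eq_cube power4_eq_xxxx algebra_simps)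
  moreover have "(\<Sum>i\<in>UNIV. (2 * dE 2 D D1 i x) *\<^sub>R rotz (axis i 1)) = - ((2 * R x ^ 4 * (2 * D s + s * D1 s)) *\<^sub>R rotz x)"
    by (simp add: vec_eq_iff forall_3 sum_3 axis_def rotz_nth dE_def E_def kron_def s_def power3_eq_cube power4_eq_xxxx algebra_simps)
  ultimately show ?thesis
    unfolding 1
    by (simp add: vec_eq_iff forall_3 rotz_nth axis_def numeral_eq_Suc algebra_simps)
qed

text \<open>Since radial and azimuthal motion do not change the polar angle, \<open>u\<close> moves
  \<open>s\<close> at the rate \<open>- (R x)^2 (1 - s^2) B s\<close>; this gives all terms with
  derivatives of profiles. The terms with \<open>(D s)^2\<close> are the centripetal acceleration of
  the swirl.\<close>

lemma convection_u:
  assumes x: "x \<in> W"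
  defines "s \<equiv> cosang x"
  shows "convection u u x = frame x (- (A s)\<^sup>2 - B s * ((1 - s\<^sup>2) * A1 s - 2 * s * A s) - (D s)\<^sup>2)
    (B s * ((1 - s\<^sup>2) * B1 s - s * B s) + s * (D s)\<^sup>2) (- (B s * ((1 - s\<^sup>2) * D1 s - 2 * s * D s)))"
proof -
  define r where "r = R x"
  have nz: "r \<noteq> 0" using W(1)[OF x] by (simp add: r_def)
  define \<xi> where "\<xi> = r *\<^sub>R x"
  have x\<xi>: "x = inverse r *\<^sub>R \<xi>" using nz by (simp add: \<xi>_def)
  have \<xi>3: "\<xi> $ 3 = s" using x3_R[OF W(1)[OF x]] by (simp add: \<xi>_def r_def s_def ac_simps)
  have \<xi>\<xi>: "\<xi> $ 1 * \<xi> $ 1 + \<xi> $ 2 * \<xi> $ 2 + \<xi> $ 3 * \<xi> $ 3 = 1"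
    using sq_R[OF W(1)[OF x]] by (simp add: \<xi>_def r_def power2_eq_square ac_simps)
  have rotx: "rotz x = inverse r *\<^sub>R rotz \<xi>"
    unfolding x\<xi> by (rule linear_scale[OF bounded_linear.linear[OF bounded_linear_rotz]])
  have ux: "u x = r *\<^sub>R (A s *\<^sub>R \<xi> - B s *\<^sub>R axis 3 1 + D s *\<^sub>R rotz \<xi>)"
    unfolding u[OF W[OF x]] E_def r_def[symmetric] s_def[symmetric] rotx
    using nz by (simp add: \<xi>_def power2_eq_square algebra_simps)
  have u3: "u x $ 3 = r * (A s * s - B s)"
    by (simp add: ux \<xi>3 rotz_nth axis_def)
  have u\<xi>: "u x $ 1 * \<xi> $ 1 + u x $ 2 * \<xi> $ 2 + u x $ 3 * \<xi> $ 3 = r * (A s - B s * s)"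
  proof -
    have "u x $ 1 * \<xi> $ 1 + u x $ 2 * \<xi> $ 2 + u x $ 3 * \<xi> $ 3 =
        r * (A s * (\<xi> $ 1 * \<xi> $ 1 + \<xi> $ 2 * \<xi> $ 2 + \<xi> $ 3 * \<xi> $ 3) - B s * \<xi> $ 3)"
      by (simp add: ux rotz_nth axis_def algebra_simps)
    then show ?thesis unfolding \<xi>\<xi> unfolding \<xi>3 by simp
  qed
  have grad: "(\<Sum>i\<in>UNIV. u x $ i * dE k a a1 i x) = r ^ (k + 2) * (- (B s * (1 - s\<^sup>2) * a1 s) - (A s - B s * s) * (k * a s))"
    for k a a1
  proof -
    have dEx: "dE k a a1 i x = r ^ (k + 1) * (kron i 3 * a1 s - \<xi> $ i * (k * a s + s * a1 s))" for i
      by (simp add: dE_def E_def \<xi>_def r_def s_def power2_eq_square algebra_simps)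
    have "(\<Sum>i\<in>UNIV. u x $ i * dE k a a1 i x) = r ^ (k + 1) * (u x $ 3 * a1 s -
        (u x $ 1 * \<xi> $ 1 + u x $ 2 * \<xi> $ 2 + u x $ 3 * \<xi> $ 3) * (k * a s + s * a1 s))"
      unfolding sum_3 dEx by (simp add: kron_def algebra_simps)
    then show ?thesis unfolding u\<xi> unfolding u3 by (simp add: power2_eq_square algebra_simps)
  qed
  have "pderiv_at i u x = du i x" for i by (rule has_pd_imp_pderiv[OF has_pd_u[OF x]])
  then have "convection u u x = (\<Sum>i\<in>UNIV. u x $ i *\<^sub>R du i x)" by (simp add: convection_def)
  also have "\<dots> = E 2 A x *\<^sub>R (\<Sum>i\<in>UNIV. u x $ i *\<^sub>R axis i 1) + (\<Sum>i\<in>UNIV. u x $ i * dE 2 A A1 i x) *\<^sub>R x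
     - (\<Sum>i\<in>UNIV. u x $ i * dE 1 B B1 i x) *\<^sub>R axis 3 1
     + (E 2 D x *\<^sub>R (\<Sum>i\<in>UNIV. u x $ i *\<^sub>R rotz (axis i 1)) + (\<Sum>i\<in>UNIV. u x $ i * dE 2 D D1 i x) *\<^sub>R rotz x)"
    unfolding sum_3 du_def by (simp add: algebra_simps)
  also have "(\<Sum>i\<in>UNIV. u x $ i *\<^sub>R axis i 1) = u x"
    by (simp add: sum_3 vec_eq_iff forall_3 axis_def)
  also have "(\<Sum>i\<in>UNIV. u x $ i *\<^sub>R rotz (axis i 1)) = rotz (u x)"
    by (simp add: sum_3 vec_eq_iff forall_3 axis_def rotz_nth)
  also have "rotz (u x) = r *\<^sub>R (A s *\<^sub>R rotz \<xi> - D s *\<^sub>R (\<xi> - s *\<^sub>R axis 3 1))"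
    by (simp add: ux vec_eq_iff forall_3 axis_def rotz_nth \<xi>3 algebra_simps)
  finally have conv: "convection u u x = E 2 A x *\<^sub>R u x + (\<Sum>i\<in>UNIV. u x $ i * dE 2 A A1 i x) *\<^sub>R x
     - (\<Sum>i\<in>UNIV. u x $ i * dE 1 B B1 i x) *\<^sub>R axis 3 1
     + (E 2 D x *\<^sub>R (r *\<^sub>R (A s *\<^sub>R rotz \<xi> - D s *\<^sub>R (\<xi> - s *\<^sub>R axis 3 1)))
       + (\<Sum>i\<in>UNIV. u x $ i * dE 2 D D1 i x) *\<^sub>R rotz x)" .
  have E2: "E 2 a x = r\<^sup>2 * a s" for a by (simp add: E_def r_def s_def)
  have r4: "r ^ (2 + 2) *\<^sub>R x = r ^ 3 *\<^sub>R \<xi>" "(r ^ (2 + 2) * k) *\<^sub>R x = (r ^ 3 * k) *\<^sub>R \<xi>"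
    "(r ^ (2 + 2) * k) *\<^sub>R rotz x = (r ^ 3 * k) *\<^sub>R rotz \<xi>" for k
    using nz unfolding rotx by (simp_all add: \<xi>_def numeral_eq_Suc)
  have r3: "r ^ (1 + 2) = r ^ 3" by (simp add: power3_eq_cube power2_eq_square)
  have "convection u u x = r ^ 3 *\<^sub>R ((- (A s)\<^sup>2 - B s * ((1 - s\<^sup>2) * A1 s - 2 * s * A s) - (D s)\<^sup>2) *\<^sub>R \<xi>
     + (B s * ((1 - s\<^sup>2) * B1 s - s * B s) + s * (D s)\<^sup>2) *\<^sub>R axis 3 1
     + (- (B s * ((1 - s\<^sup>2) * D1 s - 2 * s * D s))) *\<^sub>R rotz \<xi>)"
    unfolding conv grad r4 r3 unfolding ux E2
    by (simp add: vec_eq_iff power2_eq_square power3_eq_cube algebra_simps)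
  then show ?thesis using nz unfolding r_def[symmetric] rotx by (simp add: \<xi>_def)
qed

lemma grad_p:
  assumes x: "x \<in> W"
  defines "s \<equiv> cosang x"
  shows "grad p x = frame x (- (2 * Q s + s * Q1 s)) (Q1 s) 0"
proof -
  have "has_pd (E 2 Q) (dE 2 Q Q1 i x) i x" for i by (intro has_pd_E Q W x)
  then have "has_pd p (dE 2 Q Q1 i x) i x" for i
    by (rule has_pd_transform[OF _ open_W x]) (simp add: p W)
  then have "pderiv_at i p x = dE 2 Q Q1 i x" for i by (rule has_pd_imp_pderiv)
  then show ?thesis
    by (simp add: grad_def vec_eq_iff forall_3 dE_def E_def kron_def axis_def s_def numeral_eq_Suc algebra_simps)
qed

lemma divergence_u:
  assumes x: "x \<in> W"
  defines "s \<equiv> cosang x"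
  shows "divergence u x = R x ^ 2 * (A s - ((1 - s\<^sup>2) * B1 s - s * B s))"
proof -
  define r where "r = R x"
  have x3: "x $ 3 * r = s" using x3_R[OF W(1)[OF x]] by (simp add: r_def s_def)
  have sq: "(x $ 1)\<^sup>2 * r\<^sup>2 + (x $ 2)\<^sup>2 * r\<^sup>2 + (x $ 3)\<^sup>2 * r\<^sup>2 = 1" using sq_R[OF W(1)[OF x]] by (simp only: r_def)
  have "has_pd (\<lambda>y. u y $ i) (du i x $ i) i x" for i
    by (rule has_pd_bounded_linear[OF bounded_linear_vec_nth has_pd_u[OF x]])
  then have "pderiv_at i (\<lambda>y. u y $ i) x = du i x $ i" for i by (rule has_pd_imp_pderiv)
  then have "divergence u x = du 1 x $ 1 + du 2 x $ 2 + du 3 x $ 3" by (simp add: divergence_def sum_3)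
  also have "\<dots> = 3 * (A s * r\<^sup>2) + (x $ 3 * r) * (r\<^sup>2 * A1 s)
      - ((x $ 1)\<^sup>2 * r\<^sup>2 + (x $ 2)\<^sup>2 * r\<^sup>2 + (x $ 3)\<^sup>2 * r\<^sup>2) * (r\<^sup>2 * (2 * A s + s * A1 s))
      - (r\<^sup>2 * B1 s - (x $ 3 * r) * (r\<^sup>2 * (B s + s * B1 s)))"
    by (simp add: du_def dE_def E_def kron_def axis_def rotz_nth s_def r_def power2_eq_square numeral_eq_Suc algebra_simps)
  also have "\<dots> = r\<^sup>2 * (A s - ((1 - s\<^sup>2) * B1 s - s * B s))"
    unfolding x3 sq by (simp add: power2_eq_square algebra_simps)
  finally show ?thesis by (simp add: r_def)
qed

end

section \<open>The angular profiles of the force\<close>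

locale cone_force =
  fixes \<phi>0 :: real and F :: "real^3 \<Rightarrow> real^3" and X Y :: "real \<Rightarrow> real"
  assumes \<phi>0: "0 < \<phi>0" "\<phi>0 < pi" and F_C1: "C_upto 1 (solid_cone \<phi>0) F"
    and F_eq: "\<forall>(\<rho>, \<phi>, \<theta>)\<in>cone_coords \<phi>0.
           F (spherical \<rho> \<phi> \<theta>) = (\<rho> powi (-3)) *\<^sub>R (X \<phi> *\<^sub>R e_rho \<phi> \<theta> + Y \<phi> *\<^sub>R e_phi \<phi> \<theta>)"
begin

definition "x0 = cos \<phi>0"

lemma x0: "- 1 < x0" "x0 < 1"
  unfolding x0_def
  using cos_monotone_0_pi[of 0 \<phi>0] cos_monotone_0_pi[of \<phi>0 pi] \<phi>0 by auto

lemma cone_eq: "solid_cone \<phi>0 = pcone x0"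
  unfolding x0_def by (rule solid_cone_eq[OF \<phi>0])

lemma arccos_mem: "s \<in> {x0..1} \<Longrightarrow> arccos s \<in> {0..\<phi>0}"
proof -
  assume s: "s \<in> {x0..1}"
  then have "arccos s \<le> arccos x0" using x0 by (intro arccos_le_arccos) auto
  also have "\<dots> = \<phi>0" unfolding x0_def using \<phi>0 by (intro arccos_cos) auto
  finally show ?thesis using s x0 arccos_lbound[of s] by auto
qed

lemma cos_arccos_mem: "s \<in> {x0..1} \<Longrightarrow> cos (arccos s) = s"
  using x0 by (intro cos_arccos) auto

lemma cos_mem: "\<phi> \<in> {0..\<phi>0} \<Longrightarrow> cos \<phi> \<in> {x0..1}"
  unfolding x0_def using \<phi>0 by (auto intro!: cos_monotone_0_pi_le)

lemma arccos_cos_mem: "\<phi> \<in> {0..\<phi>0} \<Longrightarrow> arccos (cos \<phi>) = \<phi>"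
  using \<phi>0 by (intro arccos_cos) auto

lemma sin_arccos_mem: "s \<in> {x0..1} \<Longrightarrow> sin (arccos s) = sqrt (1 - s\<^sup>2)"
  using x0 by (intro sin_arccos_abs) auto

lemma mer_spherical: "s \<in> {x0..1} \<Longrightarrow> spherical 1 (arccos s) (2 * pi) = mer s"
  by (simp add: vec_eq_iff forall_3 sin_arccos_mem cos_arccos_mem)

lemma mer_coords: "s \<in> {x0..1} \<Longrightarrow> (1, arccos s, 2 * pi) \<in> cone_coords \<phi>0"
  using arccos_mem[of s] by (auto simp: cone_coords_def)

definition "Xs s = X (arccos s)"
definition "Ys s = Y (arccos s)"
definition "Ps s = integral {0..arccos s} Y"
definition "CC = C_const \<phi>0 X Y"
definition "Gam s = Xs s + 2 * Ps s + 2 * CC"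

lemma F_mer: "s \<in> {x0..1} \<Longrightarrow> F (mer s) $ 1 = Xs s * sqrt (1 - s\<^sup>2) + Ys s * s"
  "s \<in> {x0..1} \<Longrightarrow> F (mer s) $ 3 = Xs s * s - Ys s * sqrt (1 - s\<^sup>2)"
proof -
  assume s: "s \<in> {x0..1}"
  have "F (mer s) = Xs s *\<^sub>R e_rho (arccos s) (2 * pi) + Ys s *\<^sub>R e_phi (arccos s) (2 * pi)"
    using F_eq mer_coords[OF s] unfolding mer_spherical[OF s, symmetric] Xs_def Ys_def by fastforce
  then show "F (mer s) $ 1 = Xs s * sqrt (1 - s\<^sup>2) + Ys s * s"
    "F (mer s) $ 3 = Xs s * s - Ys s * sqrt (1 - s\<^sup>2)"
    by (simp_all add: e_rho_def e_phi_eq sin_arccos_mem[OF s] cos_arccos_mem[OF s])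
qed

text \<open>Regularity is assumed for \<open>F\<close>, not for \<open>X\<close> and
  \<open>Y\<close>; inverting the rotation by the polar angle transfers it to them.\<close>

lemma Xs_eq: "s \<in> {x0..1} \<Longrightarrow> Xs s = F (mer s) $ 1 * sqrt (1 - s\<^sup>2) + F (mer s) $ 3 * s"
  and Ys_eq: "s \<in> {x0..1} \<Longrightarrow> Ys s = F (mer s) $ 1 * s - F (mer s) $ 3 * sqrt (1 - s\<^sup>2)"
proof -
  assume s: "s \<in> {x0..1}"
  define w where "w = sqrt (1 - s\<^sup>2)"
  have "s\<^sup>2 \<le> 1" using s x0 by (simp add: abs_square_le_1 abs_le_iff)
  then have "w\<^sup>2 = 1 - s\<^sup>2" by (simp add: w_def)
  then have w: "w * w = 1 - s * s" by (simp add: power2_eq_square)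
  have "F (mer s) $ 1 * w + F (mer s) $ 3 * s = Xs s * (w * w) + Xs s * (s * s)"
    unfolding F_mer[OF s] w_def[symmetric] by (simp add: algebra_simps)
  then show "Xs s = F (mer s) $ 1 * sqrt (1 - s\<^sup>2) + F (mer s) $ 3 * s"
    unfolding w w_def[symmetric] by (simp add: algebra_simps)
  have "F (mer s) $ 1 * s - F (mer s) $ 3 * w = Ys s * (w * w) + Ys s * (s * s)"
    unfolding F_mer[OF s] w_def[symmetric] by (simp add: algebra_simps)
  then show "Ys s = F (mer s) $ 1 * s - F (mer s) $ 3 * sqrt (1 - s\<^sup>2)"
    unfolding w w_def[symmetric] by (simp add: algebra_simps)
qed

lemma LD_F: "LD x0 (\<lambda>s. F (mer s) $ i)"
  by (rule LD_nth[OF LD_meridian[OF x0 F_C1[unfolded cone_eq]]])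

lemma LD_Xs: "LD x0 Xs"
  by (rule LD_cong[OF Xs_eq[symmetric]]) (assumption, intro LD_add LD_mult LD_F LD_sqrt_sin LD_id x0)

lemma LD_Ys: "LD x0 Ys"
  by (rule LD_cong[OF Ys_eq[symmetric]]) (assumption, intro LD_diff LD_mult LD_F LD_sqrt_sin LD_id x0)

text \<open>On the axis \<open>e_phi\<close> depends on the longitude, which forces \<open>Y 0 = 0\<close>.\<close>

lemma Ys_1: "Ys 1 = 0"
proof -
  have "(1, 0, pi) \<in> cone_coords \<phi>0" "(1, 0, 2 * pi) \<in> cone_coords \<phi>0"
    using \<phi>0 by (auto simp: cone_coords_def)
  then have "F (spherical 1 0 pi) = X 0 *\<^sub>R e_rho 0 pi + Y 0 *\<^sub>R e_phi 0 pi"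
    "F (spherical 1 0 (2 * pi)) = X 0 *\<^sub>R e_rho 0 (2 * pi) + Y 0 *\<^sub>R e_phi 0 (2 * pi)"
    using F_eq by fastforce+
  moreover have "spherical 1 0 pi = spherical 1 0 (2 * pi)" by (simp add: vec_eq_iff forall_3)
  ultimately have "(X 0 *\<^sub>R e_rho 0 pi + Y 0 *\<^sub>R e_phi 0 pi) $ 1 =
      (X 0 *\<^sub>R e_rho 0 (2 * pi) + Y 0 *\<^sub>R e_phi 0 (2 * pi)) $ 1"
    by (simp only:)
  then show ?thesis by (simp add: e_rho_def e_phi_eq Ys_def)
qed

lemma Y_cont: "continuous_on {0..\<phi>0} Y"
proof -
  have "continuous_on {0..\<phi>0} (\<lambda>\<phi>. Ys (cos \<phi>))"
    by (rule continuous_on_compose2[OF LD_continuous[OF LD_Ys]]) (auto intro!: continuous_intros simp del: atLeastAtMost_iff dest: cos_mem)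
  then show ?thesis
    by (rule continuous_on_eq) (simp add: Ys_def arccos_cos_mem del: atLeastAtMost_iff)
qed

lemma dPs: "x0 < s \<Longrightarrow> s < 1 \<Longrightarrow> (Ps has_real_derivative - Ys s / sqrt (1 - s\<^sup>2)) (at s)"
proof -
  assume s: "x0 < s" "s < 1"
  have "0 < arccos s" using s x0 arccos_less_arccos[of s 1] by simp
  moreover have "arccos s < arccos x0" using s x0 by (intro arccos_less_arccos) auto
  then have "arccos s < \<phi>0" unfolding x0_def using \<phi>0 by (simp add: arccos_cos)
  ultimately have in_: "arccos s \<in> {0..\<phi>0}" "0 < arccos s" "arccos s < \<phi>0" by auto
  have "((\<lambda>u. integral {0..u} Y) has_real_derivative Y (arccos s)) (at (arccos s) within {0..\<phi>0})"
    unfolding has_real_derivative_iff_has_vector_derivative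
    by (rule integral_has_vector_derivative[OF Y_cont in_(1)])
  then have "((\<lambda>u. integral {0..u} Y) has_real_derivative Y (arccos s)) (at (arccos s))"
    using in_ by (simp add: at_within_Icc_at)
  from DERIV_chain2[OF this DERIV_arccos] s x0
  have "(Ps has_real_derivative Y (arccos s) * inverse (- sqrt (1 - s\<^sup>2))) (at s)"
    unfolding Ps_def[abs_def] by simp
  then show ?thesis by (rule DERIV_cong) (simp add: Ys_def divide_inverse)
qed

lemma Ps_cont: "continuous_on {x0..1} Ps"
proof -
  have "continuous_on {0..\<phi>0} (\<lambda>u. integral {0..u} Y)"
    by (intro indefinite_integral_continuous_1 integrable_continuous_interval Y_cont)
  moreover have "continuous_on {x0..1} arccos"
    by (rule continuous_on_subset[OF continuous_on_arccos']) (use x0 in auto)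
  ultimately show ?thesis
    unfolding Ps_def[abs_def] by (rule continuous_on_compose2) (rule image_subsetI[OF arccos_mem])
qed

text \<open>\<open>Ys\<close> is \<open>LD\<close> and vanishes at 1, so it is bounded by a multiple
  of \<open>sqrt (1 - s)\<close>, which cancels the singular factor of \<open>dPs\<close>. Lipschitz
  continuity in \<open>s\<close> itself is the flatness that \<open>CL1_angular_flat\<close> asks
  for.\<close>

lemma Ps_lipschitz:
  obtains B where "\<And>s t. s \<in> {x0..1} \<Longrightarrow> t \<in> {x0..1} \<Longrightarrow> norm (Ps s - Ps t) \<le> B * \<bar>s - t\<bar>"
proof -
  obtain L where L: "0 \<le> L" "\<And>s t. s \<in> {x0..1} \<Longrightarrow> t \<in> {x0..1} \<Longrightarrow>
      norm (Ys s - Ys t) \<le> L * \<bar>sqrt (1 - s) - sqrt (1 - t)\<bar>"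
    using LD_obtain[OF LD_Ys] by metis
  have bound: "norm (- Ys s / sqrt (1 - s\<^sup>2)) \<le> L / sqrt (1 + x0)" if s: "x0 < s" "s < 1" for s
  proof -
    have pos: "0 < sqrt (1 - s)" "0 < sqrt (1 + x0)" using s x0 by auto
    have "\<bar>Ys s\<bar> \<le> L * sqrt (1 - s)" using L(2)[of s 1] s Ys_1 by simp
    then have "\<bar>Ys s\<bar> * sqrt (1 + x0) \<le> (L * sqrt (1 - s)) * sqrt (1 + s)"
      using L(1) s x0 by (intro mult_mono) auto
    also have "\<dots> = L * sqrt (1 - s\<^sup>2)" unfolding sqrt_sin_eq by (simp add: mult.assoc)
    finally have "\<bar>Ys s\<bar> * sqrt (1 + x0) \<le> L * sqrt (1 - s\<^sup>2)" .
    moreover have "0 < sqrt (1 - s\<^sup>2)" unfolding sqrt_sin_eq using s x0 by simp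
    ultimately show ?thesis using pos by (simp add: abs_divide pos_divide_le_eq pos_le_divide_eq)
  qed
  show ?thesis
    by (rule that[of "L / sqrt (1 + x0)"])
      (rule lipschitz_open_interval[OF Ps_cont dPs[unfolded has_real_derivative_iff_has_vector_derivative] bound])
qed

lemma LD_Ps: "LD x0 Ps"
proof -
  obtain B where "\<And>s t. s \<in> {x0..1} \<Longrightarrow> t \<in> {x0..1} \<Longrightarrow> norm (Ps s - Ps t) \<le> B * \<bar>s - t\<bar>"
    using Ps_lipschitz by metis
  then show ?thesis by (rule LD_lipschitz)
qed

lemma CL1_Ps: "CL 1 (pcone x0) (\<lambda>x. Ps (cosang x))"
proof -
  obtain B where B: "\<And>s t. s \<in> {x0..1} \<Longrightarrow> t \<in> {x0..1} \<Longrightarrow> norm (Ps s - Ps t) \<le> B * \<bar>s - t\<bar>"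
    using Ps_lipschitz by metis
  have "LD x0 (\<lambda>s. (- 1) * Ys s)" by (intro LD_mult LD_const LD_Ys)
  then have LD: "LD x0 (\<lambda>s. - Ys s)" by simp
  show ?thesis
  proof (rule CL1_angular_flat[OF x0 LD_Ps LD _ dPs])
    show "- Ys 1 = 0" by (simp add: Ys_1)
    show "\<bar>Ps s - Ps 1\<bar> \<le> B * (1 - s)" if "s \<in> {x0..1}" for s using B[OF that, of 1] that x0 by simp
  qed
qed

lemma LD_Gam: "LD x0 Gam"
  unfolding Gam_def[abs_def] by (intro LD_add LD_mult LD_const LD_Xs LD_Ps)

sublocale angular_mean x0 Gam
  by unfold_locales (use x0 LD_Gam in auto)

section \<open>The function \<open>N_fun\<close> in the variable \<open>s\<close>\<close>

lemma G_cos: "\<phi> \<in> {0..\<phi>0} \<Longrightarrow> G_profile X Y \<phi> = Xs (cos \<phi>) + 2 * Ps (cos \<phi>)"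
  by (simp add: G_profile_def Xs_def Ps_def arccos_cos_mem del: atLeastAtMost_iff)

lemma substitute_cos:
  fixes f :: "real \<Rightarrow> real"
  assumes f: "continuous_on {x0..1} f" and \<phi>: "\<phi> \<in> {0..\<phi>0}"
  shows "integral {0..\<phi>} (\<lambda>t. sin t * f (cos t)) = integral {cos \<phi>..1} f"
proof -
  have "((\<lambda>t. (- sin t) *\<^sub>R f (cos t)) has_integral (integral {cos 0..cos \<phi>} f - integral {cos \<phi>..cos 0} f)) {0..\<phi>}"
  proof (rule has_integral_substitution_general[where s = "{}" and c = x0 and d = 1, OF _ _ _ f])
    show "cos ` {0..\<phi>} \<subseteq> {x0..1}" by (rule image_subsetI) (rule cos_mem, use \<phi> in auto)
    show "(cos has_field_derivative - sin x) (at x within {0..\<phi>})" for x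
      by (rule has_field_derivative_at_within[OF DERIV_cos])
  qed (use \<phi> in \<open>auto intro!: continuous_intros\<close>)
  \<comment> \<open>The substitution rule keeps track of orientation by a second integral; here its
    interval is empty or the single point 1.\<close>
  moreover have "integral {cos 0..cos \<phi>} f = 0"
  proof (cases "cos \<phi> = 1")
    case False
    then have "\<not> 1 \<le> cos \<phi>" using cos_le_one[of \<phi>] by linarith
    then show ?thesis by simp
  qed simp
  ultimately have "((\<lambda>t. - (sin t * f (cos t))) has_integral - integral {cos \<phi>..1} f) {0..\<phi>}" by simp
  then have "((\<lambda>t. sin t * f (cos t)) has_integral integral {cos \<phi>..1} f) {0..\<phi>}"
    by (simp add: has_integral_neg_iff)
  then show ?thesis by (rule integral_unique)
qed

lemma N_fun_eq:
  assumes \<phi>: "\<phi> \<in> {0..\<phi>0}" shows "N_fun \<phi>0 X Y \<phi> = NN (cos \<phi>)"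
proof -
  have "N_fun \<phi>0 X Y \<phi> = integral {0..\<phi>} (\<lambda>t. sin t * (Gam (cos t) * (cos \<phi> - cos t)))"
    unfolding N_fun_def
  proof (rule integral_cong)
    fix t assume "t \<in> {0..\<phi>}"
    then have "t \<in> {0..\<phi>0}" using \<phi> by auto
    then show "(G_profile X Y t + 2 * C_const \<phi>0 X Y) * sin t * (cos \<phi> - cos t) = sin t * (Gam (cos t) * (cos \<phi> - cos t))"
      by (simp add: G_cos Gam_def CC_def del: atLeastAtMost_iff)
  qed
  also have "\<dots> = NN (cos \<phi>)"
    unfolding NN_def by (rule substitute_cos[OF _ \<phi>]) (intro continuous_intros Gam_cont)
  finally show ?thesis .
qed

lemma XP_cont: "continuous_on {x0..1} (\<lambda>t. Xs t + 2 * Ps t)"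
  by (intro continuous_intros LD_continuous[OF LD_Xs] Ps_cont)

lemma integral_linear: "integral {x0..1} (\<lambda>t. t - x0) = (1 - x0)\<^sup>2 / 2"
proof -
  have "((\<lambda>t. t - x0) has_integral ((1 - x0)\<^sup>2 / 2 - (x0 - x0)\<^sup>2 / 2)) {x0..1}"
    by (rule fundamental_theorem_of_calculus)
      (use x0 in \<open>auto intro!: derivative_eq_intros simp flip: has_real_derivative_iff_has_vector_derivative\<close>)
  then show ?thesis by (simp add: integral_unique)
qed

lemma NN_split: "integral {x0..1} (\<lambda>t. (Xs t + 2 * Ps t + 2 * k) * (x0 - t)) =
    - integral {x0..1} (\<lambda>t. (Xs t + 2 * Ps t) * (t - x0)) - k * (1 - x0)\<^sup>2"
proof -
  have "integral {x0..1} (\<lambda>t. (Xs t + 2 * Ps t + 2 * k) * (x0 - t)) =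
      integral {x0..1} (\<lambda>t. - ((Xs t + 2 * Ps t) * (t - x0)) - (2 * k) * (t - x0))"
    by (rule arg_cong[where f = "integral {x0..1}"]) (auto simp: algebra_simps)
  also have "\<dots> = integral {x0..1} (\<lambda>t. - ((Xs t + 2 * Ps t) * (t - x0))) - integral {x0..1} (\<lambda>t. (2 * k) * (t - x0))"
    by (intro integral_diff integrable_continuous_interval continuous_intros XP_cont)
  also have "integral {x0..1} (\<lambda>t. (2 * k) * (t - x0)) = k * (1 - x0)\<^sup>2"
    by (simp add: integral_linear)
  finally show ?thesis by simp
qed

text \<open>\<open>C_const\<close> is the unique integration constant for which \<open>NN\<close> vanishes on the lateral boundary.\<close>

lemma integration_constant: "integral {x0..1} (\<lambda>t. (Xs t + 2 * Ps t + 2 * k) * (x0 - t)) = (CC - k) * (1 - x0)\<^sup>2"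
proof -
  have "integral {0..\<phi>0} (\<lambda>t. G_profile X Y t * sin t * (cos t - cos \<phi>0)) =
      integral {0..\<phi>0} (\<lambda>t. sin t * ((Xs (cos t) + 2 * Ps (cos t)) * (cos t - x0)))"
    by (rule integral_cong) (simp add: G_cos x0_def del: atLeastAtMost_iff)
  also have "\<dots> = integral {cos \<phi>0..1} (\<lambda>t. (Xs t + 2 * Ps t) * (t - x0))"
    using \<phi>0 by (intro substitute_cos continuous_intros XP_cont) auto
  finally have "CC = - (1 / (1 - x0)\<^sup>2) * integral {x0..1} (\<lambda>t. (Xs t + 2 * Ps t) * (t - x0))"
    unfolding CC_def C_const_def x0_def by simp
  moreover have "(1 - x0)\<^sup>2 \<noteq> 0" using x0 by simp
  ultimately have "CC * (1 - x0)\<^sup>2 = - integral {x0..1} (\<lambda>t. (Xs t + 2 * Ps t) * (t - x0))" by simp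
  then show ?thesis unfolding NN_split by (simp add: left_diff_distrib)
qed

lemma NN_x0: "NN x0 = 0"
  using integration_constant[of CC] unfolding NN_def Gam_def by simp

lemma NN_1: "NN 1 = 0"
  by (simp add: NN_def)

text \<open>Inside the interval \<open>NN\<close> and \<open>nn\<close> differ by the positive
  factor \<open>(1 - s^2)^2\<close>. At the end points \<open>nn\<close> need not vanish, but
  \<open>NN\<close> does, so they impose no sign condition.\<close>

lemma N_fun_sign:
  "(\<forall>\<phi>\<in>{0..\<phi>0}. 0 \<le> N_fun \<phi>0 X Y \<phi>) \<longleftrightarrow> (\<forall>s. x0 < s \<longrightarrow> s < 1 \<longrightarrow> 0 \<le> nn s)"
  "(\<forall>\<phi>\<in>{0..\<phi>0}. N_fun \<phi>0 X Y \<phi> \<le> 0) \<longleftrightarrow> (\<forall>s. x0 < s \<longrightarrow> s < 1 \<longrightarrow> nn s \<le> 0)"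
proof -
  have NN: "NN s = (1 - s\<^sup>2)\<^sup>2 * nn s \<and> 0 < (1 - s\<^sup>2)\<^sup>2" if "x0 < s" "s < 1" for s
    using NN_mm[of s] one_minus_square_pos[OF that] that by (simp add: mm_def power2_eq_square)
  have ends: "s = x0 \<or> s = 1 \<or> (x0 < s \<and> s < 1)" if "s \<in> {x0..1}" for s using that by auto
  have iff: "(\<forall>\<phi>\<in>{0..\<phi>0}. P (N_fun \<phi>0 X Y \<phi>)) \<longleftrightarrow> (\<forall>s\<in>{x0..1}. P (NN s))" for P
  proof
    assume L: "\<forall>\<phi>\<in>{0..\<phi>0}. P (N_fun \<phi>0 X Y \<phi>)"
    show "\<forall>s\<in>{x0..1}. P (NN s)"
    proof
      fix s assume s: "s \<in> {x0..1}"
      show "P (NN s)"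
        using L[rule_format, OF arccos_mem[OF s]] unfolding N_fun_eq[OF arccos_mem[OF s]] cos_arccos_mem[OF s] .
    qed
  next
    assume L: "\<forall>s\<in>{x0..1}. P (NN s)"
    show "\<forall>\<phi>\<in>{0..\<phi>0}. P (N_fun \<phi>0 X Y \<phi>)"
    proof
      fix \<phi> assume \<phi>: "\<phi> \<in> {0..\<phi>0}"
      show "P (N_fun \<phi>0 X Y \<phi>)" using L[rule_format, OF cos_mem[OF \<phi>]] unfolding N_fun_eq[OF \<phi>] .
    qed
  qed
  have nn: "(0 \<le> NN s \<longleftrightarrow> 0 \<le> nn s) \<and> (NN s \<le> 0 \<longleftrightarrow> nn s \<le> 0)" if "x0 < s" "s < 1" for s
  proof -
    from NN[OF that] have eq: "NN s = (1 - s\<^sup>2)\<^sup>2 * nn s" and pos: "0 < (1 - s\<^sup>2)\<^sup>2" by auto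
    show ?thesis unfolding eq using pos by (simp only: zero_le_mult_iff mult_le_0_iff) auto
  qed
  show "(\<forall>\<phi>\<in>{0..\<phi>0}. 0 \<le> N_fun \<phi>0 X Y \<phi>) \<longleftrightarrow> (\<forall>s. x0 < s \<longrightarrow> s < 1 \<longrightarrow> 0 \<le> nn s)"
    unfolding iff[of "\<lambda>z. 0 \<le> z"]
  proof (intro iffI allI impI ballI)
    fix s assume "\<forall>s\<in>{x0..1}. 0 \<le> NN s" "x0 < s" "s < 1"
    then show "0 \<le> nn s" using nn[of s] by auto
  next
    fix s assume *: "\<forall>s. x0 < s \<longrightarrow> s < 1 \<longrightarrow> 0 \<le> nn s" and s: "s \<in> {x0..1}"
    from ends[OF s] show "0 \<le> NN s" using * nn[of s] NN_x0 NN_1 by auto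
  qed
  show "(\<forall>\<phi>\<in>{0..\<phi>0}. N_fun \<phi>0 X Y \<phi> \<le> 0) \<longleftrightarrow> (\<forall>s. x0 < s \<longrightarrow> s < 1 \<longrightarrow> nn s \<le> 0)"
    unfolding iff[of "\<lambda>z. z \<le> 0"]
  proof (intro iffI allI impI ballI)
    fix s assume "\<forall>s\<in>{x0..1}. NN s \<le> 0" "x0 < s" "s < 1"
    then show "nn s \<le> 0" using nn[of s] by auto
  next
    fix s assume *: "\<forall>s. x0 < s \<longrightarrow> s < 1 \<longrightarrow> nn s \<le> 0" and s: "s \<in> {x0..1}"
    from ends[OF s] show "NN s \<le> 0" using * nn[of s] NN_x0 NN_1 by auto
  qed
qed

text \<open>Off the axis \<open>e_phi\<close> equals \<open>(s e_rho - e_3) / sin \<phi>\<close>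
  with \<open>e_3\<close> the third axis, which brings the force into the frame of
  \<open>angular_field\<close>.\<close>

lemma F_off_axis:
  assumes x: "x \<noteq> 0" "x0 < cosang x" "cosang x < 1"
  defines "s \<equiv> cosang x"
  shows "F x = R x ^ 3 *\<^sub>R ((Xs s + s * (Ys s / sqrt (1 - s\<^sup>2))) *\<^sub>R (R x *\<^sub>R x) - (Ys s / sqrt (1 - s\<^sup>2)) *\<^sub>R axis 3 1)"
proof -
  have s: "s \<in> {x0..1}" "s < 1" "x0 < s" using x by (auto simp: s_def)
  obtain \<theta> where \<theta>: "0 < \<theta>" "\<theta> \<le> 2 * pi" "x = spherical (norm x) (arccos s) \<theta>"
    unfolding s_def by (rule spherical_coordinates[OF x(1)])
  have "(norm x, arccos s, \<theta>) \<in> cone_coords \<phi>0"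
    using arccos_mem[OF s(1)] \<theta> x(1) by (auto simp: cone_coords_def)
  then have "F (spherical (norm x) (arccos s) \<theta>) = (norm x powi (-3)) *\<^sub>R (Xs s *\<^sub>R e_rho (arccos s) \<theta> + Ys s *\<^sub>R e_phi (arccos s) \<theta>)"
    using F_eq unfolding Xs_def Ys_def by fast
  moreover have e: "e_rho (arccos s) \<theta> = R x *\<^sub>R x"
    using e_rho_eq[of "norm x" "arccos s" \<theta>] x(1) \<theta>(3) by simp
  moreover have "e_phi (arccos s) \<theta> = (s / sqrt (1 - s\<^sup>2)) *\<^sub>R e_rho (arccos s) \<theta> - (1 / sqrt (1 - s\<^sup>2)) *\<^sub>R axis 3 1"
  proof -
    define w where "w = sqrt (1 - s\<^sup>2)"
    have w: "0 < w" "w * w = 1 - s * s" using one_minus_square_pos[OF s(3,2)] by (simp_all add: w_def power2_eq_square)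
    have "s / w * s - 1 / w = - w" using w by (simp add: divide_simps)
    then show ?thesis
      unfolding w_def[symmetric] using w
      by (simp add: vec_eq_iff forall_3 e_phi_eq e_rho_def sin_arccos_mem[OF s(1)] cos_arccos_mem[OF s(1)] axis_def w_def[symmetric])
  qed
  moreover have "norm x powi (-3) = R x ^ 3" by (simp add: power_int_minus power_inverse)
  ultimately have "F x = R x ^ 3 *\<^sub>R (Xs s *\<^sub>R (R x *\<^sub>R x) + Ys s *\<^sub>R ((s / sqrt (1 - s\<^sup>2)) *\<^sub>R (R x *\<^sub>R x) - (1 / sqrt (1 - s\<^sup>2)) *\<^sub>R axis 3 1))"
    using \<theta>(3) by (simp only:)
  also have "Xs s *\<^sub>R v + Ys s *\<^sub>R ((s / sqrt (1 - s\<^sup>2)) *\<^sub>R v - (1 / sqrt (1 - s\<^sup>2)) *\<^sub>R axis 3 1) =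
      (Xs s + s * (Ys s / sqrt (1 - s\<^sup>2))) *\<^sub>R v - (Ys s / sqrt (1 - s\<^sup>2)) *\<^sub>R axis 3 1" for v :: "real^3"
    by (simp add: algebra_simps)
  finally show ?thesis .
qed

end

text \<open>The radial momentum balance of the constructed flow as a polynomial identity.
  \<open>b\<close>, \<open>bd\<close> stand for \<open>y\<close>, \<open>y'\<close>;
  \<open>z\<close> and \<open>wadd\<close> for \<open>1 - s^2\<close> times \<open>y''\<close> and
  \<open>A''\<close>; \<open>md\<close>, \<open>G\<close>, \<open>g\<close> for
  \<open>\<lambda>\<close> times \<open>mm1\<close>, \<open>Gam\<close>, \<open>Xs\<close>;
  \<open>l\<close> for \<open>\<lambda>\<close> times \<open>Ys\<close> over the sine. Treating the
  products with \<open>1 - s^2\<close> as variables avoids all divisions.\<close>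

lemma alpha_identity:
  fixes s w b bd z md G g a ad wadd q qd l :: real
  assumes "w = 1 - s * s" "z = md + 2 * s * (bd + b * b / 2) - w * (b * bd)"
    "a = w * bd - s * b" "ad = md - (w * (b * bd) - 2 * s * (b * b / 2)) - (s * bd + b)"
    "wadd = 2 * (w * (bd + b * b / 2)) + 4 * s * md - G
      - (w * (b * z + w * (bd * bd) - 2 * s * (b * bd)) - w * (2 * s * (b * bd) + b * b)) - (s * z + 2 * (w * bd))"
    "2 * q = 2 * (a - s * b) - w * (b * b) + (G - g)" "qd = - l + (ad - (s * bd + b) - (w * (b * bd) - 2 * s * (b * b / 2)))"
  shows "- (wadd - 4 * s * ad - 2 * a) + (- (a * a) - b * (w * ad - 2 * s * a)) - (2 * q + s * qd) = g + s * l"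
  unfolding assms(6) assms(7) assms(5) unfolding assms(2-4) unfolding assms(1)
  by (simp add: field_simps)

section \<open>Passing from a dense set to the axis and the boundary\<close>

lemma eq_on_closure:
  fixes f g :: "'a::metric_space \<Rightarrow> 'b::metric_space"
  assumes "continuous_on S f" "continuous_on S g" "W \<subseteq> S" "\<And>w. w \<in> W \<Longrightarrow> f w = g w"
    and x: "x \<in> S" "x \<in> closure W"
  shows "f x = g x"
proof -
  obtain w where w: "\<forall>n. w n \<in> W" "w \<longlonglongrightarrow> x" using x(2) unfolding closure_sequential by blast
  have wS: "\<forall>n. w n \<in> S" using w(1) assms(3) by blast
  have 1: "(f \<circ> w) \<longlonglongrightarrow> f x" using assms(1) x(1) wS w(2) unfolding continuous_on_sequentially by blast
  have 2: "(g \<circ> w) \<longlonglongrightarrow> g x" using assms(2) x(1) wS w(2) unfolding continuous_on_sequentially by blast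
  have "f \<circ> w = g \<circ> w" using w(1) assms(4) by (simp add: fun_eq_iff)
  then show ?thesis using LIMSEQ_unique 1 2 by metis
qed

lemma C_upto_pderiv:
  assumes "C_upto (Suc k) S f"
  shows "continuous_on (interior S) (pderiv_at i f)"
    and "x \<in> interior S \<Longrightarrow> has_pd f (pderiv_at i f x) i x"
proof -
  obtain g where g: "\<forall>i. C_upto k S (g i)" "\<forall>i. \<forall>x\<in>interior S. has_pd f (g i x) i x"
    using C_upto_SucD[OF assms] by (elim exE conjE) (rule that, assumption+)
  have eq: "g i y = pderiv_at i f y" if "y \<in> interior S" for y
    using has_pd_imp_pderiv[OF g(2)[rule_format, OF that]] by simp
  have "continuous_on (interior S) (g i)"
    using C_upto_continuous[OF g(1)[rule_format]] by (rule continuous_on_subset[OF _ interior_subset])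
  then show "continuous_on (interior S) (pderiv_at i f)" by (rule continuous_on_eq) (rule eq)
  show "x \<in> interior S \<Longrightarrow> has_pd f (pderiv_at i f x) i x" using g(2) eq by metis
qed

lemma C_upto_pderiv2:
  assumes "C_upto (Suc (Suc k)) S f"
  shows "continuous_on (interior S) (pderiv_at j (pderiv_at i f))"
proof -
  obtain g where g: "\<forall>i. C_upto (Suc k) S (g i)" "\<forall>i. \<forall>x\<in>interior S. has_pd f (g i x) i x"
    using C_upto_SucD[OF assms] by (elim exE conjE) (rule that, assumption+)
  have eq: "g i y = pderiv_at i f y" if "y \<in> interior S" for y
    using has_pd_imp_pderiv[OF g(2)[rule_format, OF that]] by simp
  have "pderiv_at j (g i) y = pderiv_at j (pderiv_at i f) y" if y: "y \<in> interior S" for y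
    by (rule has_pd_imp_pderiv[symmetric],
        rule has_pd_transform[OF C_upto_pderiv(2)[OF g(1)[rule_format] y] open_interior y], rule eq)
  then show ?thesis
    by (rule continuous_on_eq[OF C_upto_pderiv(1)[OF g(1)[rule_format]]])
qed

text \<open>By continuity the equations need to be verified only off the axis, where the profiles
  are twice differentiable.\<close>

lemma continuous_operators:
  fixes u :: "real^3 \<Rightarrow> real^3" and p :: "real^3 \<Rightarrow> real"
  assumes u: "C_upto 2 S u" and p: "C_upto 1 S p"
  shows "continuous_on (interior S) (\<lambda>x. - laplacian u x + convection u u x + grad p x)"
    and "continuous_on (interior S) (divergence u)"
proof -
  have u2: "C_upto (Suc (Suc 0)) S u" using u by (simp only: numeral_2_eq_2)
  have p1: "C_upto (Suc 0) S p" using p by (simp only: One_nat_def)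
  have uc: "continuous_on (interior S) u"
    by (rule continuous_on_subset[OF C_upto_continuous[OF u] interior_subset])
  have "continuous_on (interior S) (laplacian u)"
    unfolding laplacian_def[abs_def] by (intro continuous_on_sum C_upto_pderiv2[OF u2])
  moreover have "continuous_on (interior S) (\<lambda>x. convection u u x)"
    unfolding convection_def by (intro continuous_on_sum continuous_on_scaleR continuous_on_component uc C_upto_pderiv(1)[OF u2])
  moreover have "continuous_on (interior S) (grad p)"
    unfolding grad_def[abs_def] by (intro continuous_on_vec_lambda C_upto_pderiv(1)[OF p1])
  ultimately show "continuous_on (interior S) (\<lambda>x. - laplacian u x + convection u u x + grad p x)"
    by (intro continuous_on_add continuous_on_minus)
  have "continuous_on (interior S) (\<lambda>x. \<Sum>i\<in>UNIV. pderiv_at i u x $ i)"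
    by (intro continuous_on_sum continuous_on_component C_upto_pderiv(1)[OF u2])
  then show "continuous_on (interior S) (divergence u)"
  proof (rule continuous_on_eq)
    fix x assume x: "x \<in> interior S"
    show "(\<Sum>i\<in>UNIV. pderiv_at i u x $ i) = divergence u x"
      unfolding divergence_def
      by (intro sum.cong refl)
        (rule has_pd_imp_pderiv[symmetric], rule has_pd_bounded_linear[OF bounded_linear_vec_nth C_upto_pderiv(2)[OF u2 x]])
  qed
qed

context cone_force
begin

definition "Woff = {x. x \<noteq> 0 \<and> cosang x \<in> {x0<..<1}}"

lemma Woff_interior: "Woff \<subseteq> interior (pcone x0)"
  unfolding interior_cone[OF x0] Woff_def by auto

text \<open>With radius and longitude fixed, the polar angle is moved into the open interval between
  0 and \<open>\<phi>0\<close>. The end points of this arc lie on the axis and on the lateral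
  boundary.\<close>

lemma Woff_dense: "x \<in> pcone x0 \<Longrightarrow> x \<in> closure Woff"
proof -
  assume x: "x \<in> pcone x0"
  then have x': "x \<in> solid_cone \<phi>0" unfolding cone_eq .
  then obtain \<rho> \<phi> \<theta> where X: "x = spherical \<rho> \<phi> \<theta>" "0 < \<rho>" "0 \<le> \<phi>" "\<phi> \<le> \<phi>0"
    by (auto simp: solid_cone_def cone_coords_def)
  let ?p = "\<lambda>t. spherical \<rho> t \<theta>"
  have "continuous_on (closure {0<..<\<phi>0}) ?p"
    unfolding spherical_axis by (intro continuous_intros)
  then have "?p ` closure {0<..<\<phi>0} \<subseteq> closure Woff"
  proof (rule image_closure_subset[OF _ closed_closure])
    have "?p t \<in> Woff" if "t \<in> {0<..<\<phi>0}" for t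
    proof -
      have "norm (?p t) = \<rho>" by (rule norm_spherical[OF X(2)])
      then have "?p t \<noteq> 0" using X(2) by auto
      moreover have "cos \<phi>0 < cos t" using that \<phi>0 by (intro cos_monotone_0_pi) auto
      moreover have "cos t < cos 0" using that \<phi>0 by (intro cos_monotone_0_pi) auto
      ultimately show ?thesis unfolding Woff_def using X(2) by (simp add: cosang_spherical x0_def)
    qed
    then show "?p ` {0<..<\<phi>0} \<subseteq> closure Woff" using closure_subset by blast
  qed
  moreover have "\<phi> \<in> closure {0<..<\<phi>0}" using X \<phi>0 by simp
  ultimately show ?thesis using X(1) by blast
qed

end

section \<open>The flow built from a solution of the Riccati problem\<close>

locale riccati_solution = cone_force +
  fixes lam :: real and y :: "real \<Rightarrow> real"
  assumes ric: "riccati x0 1 nn lam y"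
begin

text \<open>The velocity field below is \<open>((A - s y) e_rho + y sin \<phi> e_phi) / \<rho>\<close>. In \<open>A\<close>, the derivative of \<open>y\<close> has
  been eliminated by the Riccati equation.\<close>

definition "y1 s = lam * nn s - y s * y s / 2"
definition "y2 s = lam * nn1 s - y s * y1 s"
definition "A s = lam * mm s - (1 - s\<^sup>2) * (y s * y s / 2) - s * y s"
definition "A1 s = lam * mm1 s - ((1 - s\<^sup>2) * (y s * y1 s) - 2 * s * (y s * y s / 2)) - (s * y1 s + y s)"
definition "A2 s = lam * mm2 s - (((1 - s\<^sup>2) * (y s * y2 s + y1 s * y1 s) - 2 * s * (y s * y1 s)) -
   (2 * s * (y s * y1 s) + 2 * (y s * y s / 2))) - (s * y2 s + y1 s + y1 s)"
text \<open>With radial profile \<open>f = A - s y\<close> and polar profile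
  \<open>g = sin \<phi> y\<close>, the pressure profile is
  \<open>f - g^2 / 2 + \<lambda> (Ps + CC)\<close>. \<open>Ps\<close> is kept apart because its
  derivative in \<open>s\<close> need not have a limit at the axis, while that of \<open>QQ\<close>
  is \<open>LD\<close>.\<close>

definition "QQ s = A s - s * y s - (1 - s\<^sup>2) * (y s * y s / 2) + lam * CC"
definition "QQ1 s = A1 s - (s * y1 s + y s) - ((1 - s\<^sup>2) * (y s * y1 s) - 2 * s * (y s * y s / 2))"
definition "Q s = lam * Ps s + QQ s"
definition "Q1 s = lam * (- Ys s / sqrt (1 - s\<^sup>2)) + QQ1 s"
definition "u x = E 2 A x *\<^sub>R x - E 1 y x *\<^sub>R axis 3 1"
definition "p x = E 2 Q x"

lemma y_x0: "y x0 = 0"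
  using ric by (simp add: riccati_def)

lemma dy: "s \<in> {x0..1} \<Longrightarrow> (y has_real_derivative y1 s) (at s within {x0..1})"
  using ric unfolding riccati_def y1_def power2_eq_square by blast

lemma dsq: "((\<lambda>s::real. 1 - s\<^sup>2) has_real_derivative - 2 * s) (at s within S)"
  by (auto intro!: derivative_eq_intros)

lemma dyy: "s \<in> {x0..1} \<Longrightarrow> ((\<lambda>s. y s * y s / 2) has_real_derivative y s * y1 s) (at s within {x0..1})"
  by (rule DERIV_cong[OF DERIV_cdivide[OF DERIV_mult[OF dy dy]]]) simp_all

lemma dA: "s \<in> {x0..1} \<Longrightarrow> (A has_real_derivative A1 s) (at s within {x0..1})"
proof -
  assume s: "s \<in> {x0..1}"
  have "(A has_real_derivative (lam * mm1 s - ((- 2 * s) * (y s * y s / 2) + (y s * y1 s) * (1 - s\<^sup>2)) - (1 * y s + y1 s * s)))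
      (at s within {x0..1})"
    unfolding A_def[abs_def]
    by (intro DERIV_diff DERIV_cmult dmm[OF s] DERIV_mult[OF dsq dyy[OF s]] DERIV_mult[OF DERIV_ident dy[OF s]])
  then show ?thesis by (rule DERIV_cong) (simp add: A1_def algebra_simps)
qed

lemma y1_cont: "continuous_on {x0..1} y1"
  unfolding y1_def[abs_def]
  by (intro continuous_intros LD_continuous[OF LD_nn] riccati_continuous[OF ric]) simp

lemma LD_y: "LD x0 y"
  by (rule LD_C1[OF dy y1_cont])

lemma LD_half: "LD x0 a \<Longrightarrow> LD x0 (\<lambda>s. a s / 2)" for a :: "real \<Rightarrow> real"
  using LD_mult[OF _ LD_const[of x0 "1 / 2"], of a] by simp

lemma LD_y1: "LD x0 y1"
  unfolding y1_def[abs_def] by (intro LD_diff LD_mult LD_half LD_const LD_nn LD_y)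

lemma LD_A1: "LD x0 A1"
  unfolding A1_def[abs_def]
  by (intro LD_diff LD_add LD_mult LD_half LD_const LD_mm1 LD_y LD_y1 LD_id LD_power2)

lemma at_of_within: "x0 < s \<Longrightarrow> s < 1 \<Longrightarrow> (a has_real_derivative D) (at s within {x0..1}) \<Longrightarrow> (a has_real_derivative D) (at s)"
  by (rule within_at)

lemma dy_at: "x0 < s \<Longrightarrow> s < 1 \<Longrightarrow> (y has_real_derivative y1 s) (at s)"
  and dA_at: "x0 < s \<Longrightarrow> s < 1 \<Longrightarrow> (A has_real_derivative A1 s) (at s)"
  and dyy_at: "x0 < s \<Longrightarrow> s < 1 \<Longrightarrow> ((\<lambda>s. y s * y s / 2) has_real_derivative y s * y1 s) (at s)"
  by (rule at_of_within, assumption+, rule dy, simp)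
     (rule at_of_within, assumption+, rule dA, simp,
      rule at_of_within, assumption+, rule dyy, simp)

lemma dy1: "x0 < s \<Longrightarrow> s < 1 \<Longrightarrow> (y1 has_real_derivative y2 s) (at s)"
proof -
  assume s: "x0 < s" "s < 1"
  have eq: "y1 = (\<lambda>s. lam * nn s - y s * y s / 2)" by (rule ext) (rule y1_def)
  have "((\<lambda>s. lam * nn s - y s * y s / 2) has_real_derivative lam * nn1 s - y s * y1 s) (at s)"
    by (intro DERIV_diff DERIV_cmult dnn[OF s] dyy_at[OF s])
  from this[folded eq] show ?thesis unfolding y2_def .
qed

lemma dA1: "x0 < s \<Longrightarrow> s < 1 \<Longrightarrow> (A1 has_real_derivative A2 s) (at s)"
proof -
  assume s: "x0 < s" "s < 1"
  have "(A1 has_real_derivative (lam * mm2 s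
      - (((- 2 * s) * (y s * y1 s) + (y1 s * y1 s + y2 s * y s) * (1 - s\<^sup>2)) - ((2 * 1) * (y s * y s / 2) + (y s * y1 s) * (2 * s)))
      - ((1 * y1 s + y2 s * s) + y1 s))) (at s)"
    unfolding A1_def[abs_def]
    by (intro DERIV_diff DERIV_add DERIV_cmult[OF dmm1[OF s]] DERIV_mult[OF dsq DERIV_mult[OF dy_at[OF s] dy1[OF s]]]
        DERIV_mult[OF DERIV_cmult[OF DERIV_ident] dyy_at[OF s]] DERIV_mult[OF DERIV_ident dy1[OF s]] dy_at[OF s])
  then show ?thesis by (rule DERIV_cong) (simp add: A2_def algebra_simps)
qed

lemma dQQ: "s \<in> {x0..1} \<Longrightarrow> (QQ has_real_derivative QQ1 s) (at s within {x0..1})"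
proof -
  assume s: "s \<in> {x0..1}"
  have "(QQ has_real_derivative ((A1 s - (1 * y s + y1 s * s)) - ((- 2 * s) * (y s * y s / 2) + (y s * y1 s) * (1 - s\<^sup>2)) + 0))
      (at s within {x0..1})"
    unfolding QQ_def[abs_def]
    by (intro DERIV_diff DERIV_add dA[OF s] DERIV_mult[OF dsq dyy[OF s]] DERIV_mult[OF DERIV_ident dy[OF s]] DERIV_const)
  then show ?thesis by (rule DERIV_cong) (simp add: QQ1_def algebra_simps)
qed

lemma LD_QQ1: "LD x0 QQ1"
  unfolding QQ1_def[abs_def]
  by (intro LD_diff LD_add LD_mult LD_half LD_const LD_A1 LD_y LD_y1 LD_id LD_power2)

lemma dQ: "x0 < s \<Longrightarrow> s < 1 \<Longrightarrow> (Q has_real_derivative Q1 s) (at s)"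
  unfolding Q_def[abs_def] Q1_def
  by (intro DERIV_add DERIV_cmult dPs at_of_within[OF _ _ dQQ]) auto

text \<open>\<open>y2\<close> and \<open>A2\<close> contain the singular terms \<open>nn1\<close>
  and \<open>mm2\<close>. Multiplied by \<open>1 - s^2\<close> they become regular by
  \<open>nn1_eq\<close> and \<open>mm2_eq\<close>, as \<open>CL2_angular\<close> demands.\<close>

lemma wy2: "s \<in> {x0..1} \<Longrightarrow> (1 - s\<^sup>2) * y2 s = lam * (mm1 s + 2 * s * nn s) - (1 - s\<^sup>2) * (y s * y1 s)"
  using nn1_eq[of s] by (simp add: y2_def right_diff_distrib mult.left_commute[of _ lam])

lemma wA2: "s \<in> {x0..1} \<Longrightarrow> (1 - s\<^sup>2) * A2 s = lam * (2 * mm s + 4 * s * mm1 s - Gam s)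
   - ((1 - s\<^sup>2) * (y s * ((1 - s\<^sup>2) * y2 s) + (1 - s\<^sup>2) * (y1 s * y1 s) - 2 * s * (y s * y1 s))
    - (1 - s\<^sup>2) * (2 * s * (y s * y1 s) + y s * y s)) - (s * ((1 - s\<^sup>2) * y2 s) + 2 * ((1 - s\<^sup>2) * y1 s))"
proof -
  assume s: "s \<in> {x0..1}"
  define w where "w = 1 - s\<^sup>2"
  have m: "w * (lam * mm2 s) = lam * (2 * mm s + 4 * s * mm1 s - Gam s)"
    using mm2_eq[OF s] by (simp add: w_def mult.left_commute)
  have "w * A2 s = w * (lam * mm2 s) - (w * (y s * (w * y2 s) + w * (y1 s * y1 s) - 2 * s * (y s * y1 s))
      - w * (2 * s * (y s * y1 s) + y s * y s)) - (s * (w * y2 s) + 2 * (w * y1 s))"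
    unfolding A2_def w_def[symmetric] by (simp add: algebra_simps)
  then show ?thesis unfolding m unfolding w_def .
qed

lemma LD_wy2: "LD x0 (\<lambda>s. (1 - s\<^sup>2) * y2 s)"
  by (rule LD_cong[OF wy2[symmetric]], assumption)
    (intro LD_diff LD_add LD_mult LD_const LD_mm1 LD_nn LD_y LD_y1 LD_id LD_power2)

lemma LD_wA2: "LD x0 (\<lambda>s. (1 - s\<^sup>2) * A2 s)"
  by (rule LD_cong[OF wA2[symmetric]], assumption)
    (intro LD_diff LD_add LD_mult LD_const LD_mm LD_mm1 LD_Gam LD_wy2 LD_y LD_y1 LD_id LD_power2)

lemma CL_E:
  assumes "CL j (pcone x0) (\<lambda>x. a (cosang x))" shows "CL j (pcone x0) (E k a)"
  unfolding E_def[abs_def] by (intro CL_mult CL_power CL_inverse_norm zero_notin_cone assms)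

lemma CL_u: "CL 2 (pcone x0) u"
  unfolding u_def[abs_def]
  by (intro CL_diff CL_scaleR CL_id CL_const CL_E CL2_angular[OF x0 dA LD_A1 dA1 LD_wA2]
      CL2_angular[OF x0 dy LD_y1 dy1 LD_wy2])

lemma CL_p: "CL 1 (pcone x0) p"
  unfolding p_def[abs_def] Q_def[abs_def]
  by (intro CL_E CL_add CL_mult CL_const CL1_Ps CL1_angular[OF x0 dQQ LD_QQ1])

text \<open>In this form \<open>A\<close> expresses that the divergence is 0. The form in
  \<open>A_def\<close> shows its regularity: it contains \<open>mm\<close>, which is
  \<open>C^1\<close> up to the axis, instead of \<open>nn\<close>.\<close>

lemma A_eq: "A s = (1 - s\<^sup>2) * y1 s - s * y s"
  by (simp add: A_def y1_def mm_def algebra_simps)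

sublocale field: angular_field x0 A A1 A2 y y1 y2 "\<lambda>s. 0" "\<lambda>s. 0" "\<lambda>s. 0" Q Q1 u p
  by unfold_locales (use x0 dA_at dA1 dy_at dy1 dQ in \<open>auto simp: u_def p_def E_def\<close>)

lemma pde_off_axis:
  assumes x: "x \<in> Woff"
  shows "- laplacian u x + convection u u x + grad p x = lam *\<^sub>R F x" "divergence u x = 0"
proof -
  define s where "s = cosang x"
  have xW: "x \<in> field.W" using x unfolding field.W_def Woff_def .
  have s: "x0 < s" "s < 1" using field.W[OF xW] by (auto simp: s_def)
  then have s': "s \<in> {x0..1}" by simp
  show "divergence u x = 0"
    using field.divergence_u[OF xW] A_eq[of s] by (simp add: s_def)
  define q where "q = lam * (Ys s / sqrt (1 - s\<^sup>2))"
  have ln: "lam * nn s = y1 s + y s * y s / 2" by (simp add: y1_def)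
  have lmm: "lam * mm s = (1 - s\<^sup>2) * (y1 s + y s * y s / 2)"
    unfolding ln[symmetric] mm_def by (simp add: ac_simps)
  have z: "(1 - s\<^sup>2) * y2 s = lam * mm1 s + 2 * s * (y1 s + y s * y s / 2) - (1 - s\<^sup>2) * (y s * y1 s)"
    unfolding wy2[OF s'] ln[symmetric] by (simp add: algebra_simps)
  have Q1s: "Q1 s = - q + QQ1 s" by (simp add: Q1_def q_def)
  \<comment> \<open>\<open>alpha\<close> is the coefficient of the radial vector and
    \<open>beta\<close> that of the third axis. The force enters \<open>beta\<close> only through
    \<open>q\<close>.\<close>
  have alpha: "- ((1 - s\<^sup>2) * A2 s - 4 * s * A1 s - 2 * A s) + (- (A s)\<^sup>2 - y s * ((1 - s\<^sup>2) * A1 s - 2 * s * A s))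
      - (2 * Q s + s * Q1 s) = lam * Xs s + s * q"
    unfolding power2_eq_square[of "A s"]
  proof (rule alpha_identity[where w = "1 - s\<^sup>2" and z = "(1 - s\<^sup>2) * y2 s" and md = "lam * mm1 s"
        and G = "lam * Gam s" and bd = "y1 s"])
    show "1 - s\<^sup>2 = 1 - s * s" by (simp add: power2_eq_square)
    show "(1 - s\<^sup>2) * y2 s = lam * mm1 s + 2 * s * (y1 s + y s * y s / 2) - (1 - s\<^sup>2) * (y s * y1 s)" by (rule z)
    show "A s = (1 - s\<^sup>2) * y1 s - s * y s" by (rule A_eq)
    show "A1 s = lam * mm1 s - ((1 - s\<^sup>2) * (y s * y1 s) - 2 * s * (y s * y s / 2)) - (s * y1 s + y s)" by (rule A1_def)
    show "(1 - s\<^sup>2) * A2 s = 2 * ((1 - s\<^sup>2) * (y1 s + y s * y s / 2)) + 4 * s * (lam * mm1 s) - lam * Gam s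
      - ((1 - s\<^sup>2) * (y s * ((1 - s\<^sup>2) * y2 s) + (1 - s\<^sup>2) * (y1 s * y1 s) - 2 * s * (y s * y1 s)) - (1 - s\<^sup>2) * (2 * s * (y s * y1 s) + y s * y s))
      - (s * ((1 - s\<^sup>2) * y2 s) + 2 * ((1 - s\<^sup>2) * y1 s))"
      unfolding wA2[OF s'] lmm[symmetric] by (simp only: right_diff_distrib distrib_left mult.left_commute[of lam])
    show "2 * Q s = 2 * (A s - s * y s) - (1 - s\<^sup>2) * (y s * y s) + (lam * Gam s - lam * Xs s)"
      by (simp add: Q_def QQ_def Gam_def field_simps)
    show "Q1 s = - q + (A1 s - (s * y1 s + y s) - ((1 - s\<^sup>2) * (y s * y1 s) - 2 * s * (y s * y s / 2)))"
      unfolding Q1s QQ1_def ..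
  qed
  have beta: "- (2 * A1 s - ((1 - s\<^sup>2) * y2 s - 2 * s * y1 s)) + y s * ((1 - s\<^sup>2) * y1 s - s * y s) + Q1 s = - q"
    unfolding Q1s QQ1_def z A1_def by (simp add: field_simps)
  have "- laplacian u x + convection u u x + grad p x = R x ^ 3 *\<^sub>R
      ((- ((1 - s\<^sup>2) * A2 s - 4 * s * A1 s - 2 * A s) + (- (A s)\<^sup>2 - y s * ((1 - s\<^sup>2) * A1 s - 2 * s * A s)) - (2 * Q s + s * Q1 s)) *\<^sub>R (R x *\<^sub>R x)
     + (- (2 * A1 s - ((1 - s\<^sup>2) * y2 s - 2 * s * y1 s)) + y s * ((1 - s\<^sup>2) * y1 s - s * y s) + Q1 s) *\<^sub>R axis 3 1)"
  proof -
    have fr: "- (r *\<^sub>R (a *\<^sub>R v + b *\<^sub>R e)) + r *\<^sub>R (a' *\<^sub>R v + b' *\<^sub>R e) + r *\<^sub>R (- a'' *\<^sub>R v + b'' *\<^sub>R e) =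
        r *\<^sub>R ((- a + a' - a'') *\<^sub>R v + (- b + b' + b'') *\<^sub>R e)"
      for r a b a' b' a'' b'' and v e :: "real^3" by (simp add: algebra_simps)
    have "laplacian u x = R x ^ 3 *\<^sub>R (((1 - s\<^sup>2) * A2 s - 4 * s * A1 s - 2 * A s) *\<^sub>R (R x *\<^sub>R x) +
        (2 * A1 s - ((1 - s\<^sup>2) * y2 s - 2 * s * y1 s)) *\<^sub>R axis 3 1)"
      unfolding field.laplacian_u[OF xW] s_def[symmetric] by simp
    moreover have "convection u u x = R x ^ 3 *\<^sub>R ((- (A s)\<^sup>2 - y s * ((1 - s\<^sup>2) * A1 s - 2 * s * A s)) *\<^sub>R (R x *\<^sub>R x) +
        (y s * ((1 - s\<^sup>2) * y1 s - s * y s)) *\<^sub>R axis 3 1)"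
      unfolding field.convection_u[OF xW] s_def[symmetric] by simp
    moreover have "grad p x = R x ^ 3 *\<^sub>R ((- (2 * Q s + s * Q1 s)) *\<^sub>R (R x *\<^sub>R x) + Q1 s *\<^sub>R axis 3 1)"
      unfolding field.grad_p[OF xW] s_def[symmetric] by simp
    ultimately show ?thesis by (simp only: fr)
  qed
  also have "\<dots> = R x ^ 3 *\<^sub>R ((lam * Xs s + s * q) *\<^sub>R (R x *\<^sub>R x) + (- q) *\<^sub>R axis 3 1)"
    unfolding alpha beta ..
  also have "\<dots> = lam *\<^sub>R F x"
  proof -
    have Fx: "F x = R x ^ 3 *\<^sub>R ((Xs s + s * (Ys s / sqrt (1 - s\<^sup>2))) *\<^sub>R (R x *\<^sub>R x) - (Ys s / sqrt (1 - s\<^sup>2)) *\<^sub>R axis 3 1)"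
      unfolding s_def by (rule F_off_axis[OF field.W[OF xW]])
    have 1: "lam * Xs s + s * q = lam * (Xs s + s * (Ys s / sqrt (1 - s\<^sup>2)))"
      unfolding q_def by (simp only: distrib_left mult.left_commute)
    have "lam *\<^sub>R r *\<^sub>R (a *\<^sub>R v - b *\<^sub>R e) = r *\<^sub>R ((lam * a) *\<^sub>R v + (- (lam * b)) *\<^sub>R e)"
      for r a b and v e :: "real^3" by (simp add: scaleR_diff_right ac_simps)
    then show ?thesis unfolding Fx 1 unfolding q_def by simp
  qed
  finally show "- laplacian u x + convection u u x + grad p x = lam *\<^sub>R F x" .
qed

lemma homogeneous: "homogeneous_on S (-1) u" "homogeneous_on S (-2) p"
proof -
  have ca: "cosang (m *\<^sub>R x) = cosang x" if "m > 0" for m x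
    using that by (simp add: cosang_def)
  have "m powi (-1) = inverse m" "m powi (-2) = inverse m * inverse m" for m :: real
    by (simp_all add: power_int_minus power2_eq_square)
  then show "homogeneous_on S (-1) u" "homogeneous_on S (-2) p"
    unfolding homogeneous_on_def u_def p_def E_def
    by (auto simp: ca power2_eq_square algebra_simps)
qed

lemma axisymmetric: "axisymmetric_vector \<phi>0 u" "axisymmetric_scalar \<phi>0 p"
proof -
  show "axisymmetric_scalar \<phi>0 p"
    unfolding axisymmetric_scalar_def
    by (rule exI[of _ "\<lambda>\<rho> \<phi>. Q (cos \<phi>) * inverse \<rho> ^ 2"])
      (auto simp: cone_coords_def p_def E_def cosang_spherical norm_spherical)
  show "axisymmetric_vector \<phi>0 u"
    unfolding axisymmetric_vector_def
  proof (intro exI ballI)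
    let ?a = "\<lambda>\<rho> \<phi>. (A (cos \<phi>) - cos \<phi> * y (cos \<phi>)) * inverse \<rho>"
    let ?b = "\<lambda>\<rho> \<phi>. sin \<phi> * y (cos \<phi>) * inverse \<rho>"
    fix z assume z: "z \<in> cone_coords \<phi>0"
    obtain \<rho> \<phi> \<theta> where z': "z = (\<rho>, \<phi>, \<theta>)" by (cases z) auto
    have \<rho>: "0 < \<rho>" using z z' by (simp add: cone_coords_def)
    have "u (spherical \<rho> \<phi> \<theta>) = ?a \<rho> \<phi> *\<^sub>R e_rho \<phi> \<theta> + ?b \<rho> \<phi> *\<^sub>R e_phi \<phi> \<theta> + 0 *\<^sub>R e_theta \<theta>"
    proof -
      have sp: "spherical \<rho> \<phi> \<theta> = \<rho> *\<^sub>R e_rho \<phi> \<theta>" using e_rho_eq[OF \<rho>, of \<phi> \<theta>] \<rho> by simp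
      have e3: "axis 3 1 = cos \<phi> *\<^sub>R e_rho \<phi> \<theta> - sin \<phi> *\<^sub>R e_phi \<phi> \<theta>"
      proof -
        have "cos \<phi> * cos \<phi> + sin \<phi> * sin \<phi> = 1" using sin_cos_squared_add[of \<phi>] by (simp add: power2_eq_square)
        then show ?thesis by (simp add: vec_eq_iff forall_3 axis_def e_rho_def e_phi_eq)
      qed
      have "u (spherical \<rho> \<phi> \<theta>) = (A (cos \<phi>) * (inverse \<rho>)\<^sup>2) *\<^sub>R (\<rho> *\<^sub>R e_rho \<phi> \<theta>) - (y (cos \<phi>) * inverse \<rho>) *\<^sub>R axis 3 1"
        unfolding u_def E_def cosang_spherical[OF \<rho>] norm_spherical[OF \<rho>] unfolding sp by simp
      also have "(A (cos \<phi>) * (inverse \<rho>)\<^sup>2) *\<^sub>R (\<rho> *\<^sub>R e_rho \<phi> \<theta>) = (A (cos \<phi>) * inverse \<rho>) *\<^sub>R e_rho \<phi> \<theta>"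
        using \<rho> by (simp add: power2_eq_square)
      finally show ?thesis unfolding e3 by (simp add: algebra_simps)
    qed
    then show "case z of (\<rho>, \<phi>, \<theta>) \<Rightarrow> u (spherical \<rho> \<phi> \<theta>) =
        ?a \<rho> \<phi> *\<^sub>R e_rho \<phi> \<theta> + ?b \<rho> \<phi> *\<^sub>R e_phi \<phi> \<theta> + (\<lambda>\<rho> \<phi>. 0) \<rho> \<phi> *\<^sub>R e_theta \<theta>"
      unfolding z' by simp
  qed
qed

text \<open>Here \<open>C_const\<close> acts: it makes \<open>NN\<close>, hence \<open>mm\<close>,
  vanish at \<open>x0\<close>, so no-slip holds for the radial component as well.\<close>

lemma A_x0: "A x0 = 0"
proof -
  have "(1 - x0\<^sup>2) * mm x0 = 0" using NN_mm[of x0] NN_x0 x0 by simp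
  moreover have "1 - x0\<^sup>2 \<noteq> 0" using one_minus_square_pos'[of x0] x0 by auto
  ultimately have "mm x0 = 0" by simp
  then show ?thesis by (simp add: A_def y_x0)
qed

lemma solution: "axisym_selfsimilar_solution \<phi>0 F lam u p"
  unfolding axisym_selfsimilar_solution_def
proof (intro conjI)
  have u2: "C_upto 2 (pcone x0) u" by (rule CL_imp_C_upto[OF CL_u])
  have p1: "C_upto 1 (pcone x0) p" by (rule CL_imp_C_upto[OF CL_p])
  show "C_upto 2 (solid_cone \<phi>0) u" "C_upto 1 (solid_cone \<phi>0) p" unfolding cone_eq by (rule u2, rule p1)
  show "axisymmetric_vector \<phi>0 u" "axisymmetric_scalar \<phi>0 p" by (rule axisymmetric)+
  show "homogeneous_on (solid_cone \<phi>0) (-1) u" "homogeneous_on (solid_cone \<phi>0) (-2) p" by (rule homogeneous)+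
  have Fc: "continuous_on (interior (pcone x0)) (\<lambda>x. lam *\<^sub>R F x)"
    by (intro continuous_intros continuous_on_subset[OF C_upto_continuous[OF F_C1[unfolded cone_eq]] interior_subset])
  show "\<forall>x\<in>interior (solid_cone \<phi>0). - laplacian u x + convection u u x + grad p x = lam *\<^sub>R F x \<and> divergence u x = 0"
    unfolding cone_eq
  proof (intro ballI conjI)
    fix x assume x: "x \<in> interior (pcone x0)"
    have cl: "x \<in> closure Woff" by (rule Woff_dense[OF subsetD[OF interior_subset x]])
    show "- laplacian u x + convection u u x + grad p x = lam *\<^sub>R F x"
      by (rule eq_on_closure[OF continuous_operators(1)[OF u2 p1] Fc Woff_interior pde_off_axis(1) x cl])
    show "divergence u x = 0"
      by (rule eq_on_closure[OF continuous_operators(2)[OF u2 p1] continuous_on_const Woff_interior pde_off_axis(2) x cl])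
  qed
  show "\<forall>x\<in>frontier (solid_cone \<phi>0) - {0}. u x = 0"
    unfolding cone_eq frontier_cone[OF x0] by (simp add: u_def E_def A_x0 y_x0)
qed

end

section \<open>Every solution comes from the Riccati equation\<close>

text \<open>By Rolle the derivative of \<open>w\<close> vanishes somewhere. It solves a homogeneous
  linear equation of first order, so by an integrating factor it vanishes everywhere, and
  \<open>w\<close> is constant. No sign or end-point behaviour of \<open>b\<close> enters.\<close>

lemma linear_ode_zero:
  fixes w wd b :: "real \<Rightarrow> real"
  assumes "p < q" and w: "continuous_on {p..q} w" "w p = 0" "w q = 0"
    and d: "\<And>t. p < t \<Longrightarrow> t < q \<Longrightarrow> (w has_real_derivative wd t) (at t)"
    and d1: "\<And>t. p < t \<Longrightarrow> t < q \<Longrightarrow> (wd has_real_derivative - (b t * wd t)) (at t)"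
    and b: "continuous_on {p<..<q} b" and t: "t \<in> {p..q}"
  shows "w t = 0"
proof -
  obtain z where z: "p < z" "z < q" "(w has_real_derivative 0) (at z)"
    using Rolle[OF \<open>p < q\<close> _ w(1)] w(2,3) d real_differentiable_def by metis
  have wz: "wd z = 0" using DERIV_unique[OF z(3) d[OF z(1,2)]] by simp
  have same: "wd r = 0 \<longleftrightarrow> wd s = 0" if rs: "p < r" "r < s" "s < q" for r s
  proof -
    have bc: "continuous_on {r..s} b" by (rule continuous_on_subset[OF b]) (use rs in auto)
    define g where "g t = integral {r..t} b" for t
    have g: "(g has_real_derivative b t) (at t)" if "r < t" "t < s" for t
      using integral_has_vector_derivative[OF bc, of t] that
      unfolding g_def[abs_def] has_real_derivative_iff_has_vector_derivative by (simp add: at_within_Icc_at)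
    have gc: "continuous_on {r..s} g"
      unfolding g_def[abs_def] by (intro indefinite_integral_continuous_1 integrable_continuous_interval bc)
    have w1c: "continuous_on {r..s} wd"
      by (rule DERIV_continuous_on[where D = "\<lambda>t. - (b t * wd t)"], rule has_field_derivative_at_within, rule d1)
        (use rs in auto)
    have "wd s * exp (g s) = wd r * exp (g r)"
    proof (rule DERIV_isconst_end[where f = "\<lambda>t. wd t * exp (g t)"])
      show "continuous_on {r..s} (\<lambda>t. wd t * exp (g t))" by (intro continuous_intros gc w1c)
      fix t assume t: "r < t" "t < s"
      have "((\<lambda>t. exp (g t)) has_real_derivative exp (g t) * b t) (at t)"
        by (rule DERIV_chain2[OF DERIV_exp g[OF t]])
      from DERIV_mult[OF d1[of t] this]
      show "((\<lambda>t. wd t * exp (g t)) has_real_derivative 0) (at t)"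
        by (rule DERIV_cong) (use t rs in auto)
    qed (use rs in auto)
    then show ?thesis by auto
  qed
  have wd: "wd t = 0" if "p < t" "t < q" for t
  proof -
    consider "t < z" | "t = z" | "z < t" by linarith
    then show ?thesis using same[of t z] same[of z t] wz z that by cases auto
  qed
  show ?thesis
  proof (cases "t = p")
    case False
    then have "p < t" using t by simp
    then have "w t = w p"
    proof (rule DERIV_isconst_end)
      show "continuous_on {p..t} w" by (rule continuous_on_subset[OF w(1)]) (use t in auto)
      show "(w has_real_derivative 0) (at r)" if "p < r" "r < t" for r
        using d[of r] wd[of r] that t by simp
    qed
    then show ?thesis using w by simp
  qed (use w in simp)
qed

lemma constant_on_open:
  fixes f :: "real \<Rightarrow> real"
  assumes "\<And>t. p < t \<Longrightarrow> t < q \<Longrightarrow> (f has_real_derivative 0) (at t)"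
  shows "\<exists>k. \<forall>t\<in>{p<..<q}. f t = k"
proof (rule has_field_derivative_zero_constant[OF convex_real_interval(8)])
  fix t assume "t \<in> {p<..<q}"
  then have "(f has_real_derivative 0) (at t)" using assms[of t] by simp
  then show "(f has_real_derivative 0) (at t within {p<..<q})" by (rule has_field_derivative_at_within)
qed

text \<open>The second derivative is left as the product rule yields it, because its value is never
  evaluated.\<close>

lemma inverse_sin_derivatives:
  fixes s :: real
  assumes "\<bar>s\<bar> < 1"
  shows "((\<lambda>s. inverse (sqrt (1 - s\<^sup>2))) has_real_derivative s * inverse (sqrt (1 - s\<^sup>2)) ^ 3) (at s)"
    and "((\<lambda>s. s * inverse (sqrt (1 - s\<^sup>2)) ^ 3) has_real_derivative
      (1 * inverse (sqrt (1 - s\<^sup>2)) ^ 3 + (of_nat 3 * (s * inverse (sqrt (1 - s\<^sup>2)) ^ 3 * inverse (sqrt (1 - s\<^sup>2)) ^ (3 - Suc 0))) * s)) (at s)"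
proof -
  have pos: "0 < 1 - s\<^sup>2" using assms by (simp add: abs_square_less_1)
  have "((\<lambda>s. 1 - s\<^sup>2) has_real_derivative - (2 * s)) (at s)" by (auto intro!: derivative_eq_intros)
  from DERIV_chain2[where f = sqrt and g = "\<lambda>s. 1 - s\<^sup>2" and x = s and s = UNIV, OF DERIV_real_sqrt[OF pos] this]
  have sq: "((\<lambda>s. sqrt (1 - s\<^sup>2)) has_real_derivative inverse (sqrt (1 - s\<^sup>2)) / 2 * - (2 * s)) (at s)" .
  have nz: "sqrt (1 - s\<^sup>2) \<noteq> 0" using pos by simp
  show 1: "((\<lambda>s. inverse (sqrt (1 - s\<^sup>2))) has_real_derivative s * inverse (sqrt (1 - s\<^sup>2)) ^ 3) (at s)"
  proof (rule DERIV_cong[OF DERIV_inverse_fun[OF sq nz]])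
    have "- (inverse w / 2 * - (2 * s) * inverse (w ^ Suc (Suc 0))) = s * inverse w ^ 3" for w :: real
      by (simp add: power3_eq_cube)
    then show "- (inverse (sqrt (1 - s\<^sup>2)) / 2 * - (2 * s) * inverse (sqrt (1 - s\<^sup>2) ^ Suc (Suc 0))) =
      s * inverse (sqrt (1 - s\<^sup>2)) ^ 3" .
  qed
  show "((\<lambda>s. s * inverse (sqrt (1 - s\<^sup>2)) ^ 3) has_real_derivative
      (1 * inverse (sqrt (1 - s\<^sup>2)) ^ 3 + (of_nat 3 * (s * inverse (sqrt (1 - s\<^sup>2)) ^ 3 * inverse (sqrt (1 - s\<^sup>2)) ^ (3 - Suc 0))) * s)) (at s)"
    by (rule DERIV_mult[OF DERIV_ident DERIV_power[OF 1]])
qed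

lemma C_upto_Suc_imp:
  fixes f :: "real^3 \<Rightarrow> 'b::real_normed_vector"
  shows "C_upto (Suc k) S f \<Longrightarrow> C_upto k S f"
proof (induction k arbitrary: f)
  case 0
  then show ?case by (simp only: C_upto.simps)
next
  case (Suc k)
  have "C_upto k S g" if "C_upto (Suc k) S g" for g :: "real^3 \<Rightarrow> 'b" by (rule Suc.IH[OF that])
  then show ?case using Suc.prems C_upto.simps(2)[of "Suc k" S f] C_upto.simps(2)[of k S f] by metis
qed

text \<open>Apart from the force, the coefficient of the third axis is an exact derivative:
  \<open>B (w B' - s B)\<close> is the derivative of \<open>w B^2 / 2\<close> for
  \<open>w = 1 - s^2\<close>. So the pressure can be found by integration.\<close>

lemma pressure_identity:
  fixes s w A A1 B B1 wB2 q Q1 :: real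
  assumes "- (2 * A1 - (wB2 - 2 * s * B1)) + B * (w * B1 - s * B) + Q1 = - q"
    "A = w * B1 - s * B" "A1 = wB2 - 2 * s * B1 - (B + s * B1)"
  shows "Q1 = - q + (A1 - (B + s * B1)) - (w * (B * B1) - 2 * s * (B * B / 2)) + 0"
proof -
  have "B * (w * B1 - s * B) = w * (B * B1) - 2 * s * (B * B / 2)" by (simp add: algebra_simps)
  moreover have "2 * A1 - (wB2 - 2 * s * B1) = A1 - (B + s * B1)" using assms(3) by linarith
  ultimately show ?thesis using assms(1) by linarith
qed

text \<open>Elimination of the pressure from the radial balance. With \<open>f = A - s B\<close> and
  \<open>\<psi> = w B\<close>, the left side is the derivative of
  \<open>w f' + \<psi> f + 2 \<psi>\<close>.\<close>

lemma momentum_identity: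
  fixes s w A A1 A2 B B1 B2 q Q Q1 X P k :: real
  assumes alpha: "- (w * A2 - 4 * s * A1 - 2 * A) + (- A\<^sup>2 - B * (w * A1 - 2 * s * A)) - (2 * Q + s * Q1) = X + s * q"
    and A: "w * B1 = A + s * B" and A1: "w * B2 = A1 + 3 * s * B1 + B"
    and Q1: "Q1 = - q + (A1 - (B + s * B1)) - B * A"
    and Q: "Q = (A - s * B) - w * (B * B / 2) + P + k"
  shows "(w * (A2 - (B1 + (B1 + s * B2))) - 2 * s * (A1 - (B + s * B1))) +
    (w * B * (A1 - (B + s * B1)) + (A - s * B) * (A - s * B)) + 2 * (A - s * B) = - (X + 2 * P + 2 * k)"
proof -
  have "X = - (w * A2 - 4 * s * A1 - 2 * A) + (- A\<^sup>2 - B * (w * A1 - 2 * s * A)) - (2 * Q + s * Q1) - s * q"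
    using alpha by linarith
  then have X: "X = - (w * A2) + 4 * s * A1 + 2 * A - A * A - B * (w * A1) + 2 * s * A * B
      - 2 * (A - s * B) + w * (B * B) - 2 * P - 2 * k - s * (A1 - (B + s * B1)) + s * B * A"
    unfolding Q Q1 by (simp add: power2_eq_square algebra_simps)
  have "(w * (A2 - (B1 + (B1 + s * B2))) - 2 * s * (A1 - (B + s * B1))) +
      (w * B * (A1 - (B + s * B1)) + (A - s * B) * (A - s * B)) + 2 * (A - s * B) =
      w * A2 - 2 * (w * B1) - s * (w * B2) - 2 * s * (A1 - (B + s * B1))
      + (B * (w * A1) - w * (B * B) - s * B * (w * B1)) + (A - s * B) * (A - s * B) + 2 * (A - s * B)"
    by (simp add: algebra_simps)
  also have "\<dots> = - (X + 2 * P + 2 * k)"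
    unfolding A A1 X by (simp add: algebra_simps)
  finally show ?thesis .
qed

context cone_force
begin

lemma solution_riccati:
  assumes sol: "axisym_selfsimilar_solution \<phi>0 F lam u p"
  shows "\<exists>y. riccati x0 1 nn lam y \<and> (\<forall>x\<in>Woff.
    u x = E 2 (\<lambda>s. lam * mm s - (1 - s\<^sup>2) * (y s * y s / 2) - s * y s) x *\<^sub>R x - E 1 y x *\<^sub>R axis 3 1 \<and>
    p x = E 2 (\<lambda>s. (lam * mm s - (1 - s\<^sup>2) * (y s * y s / 2) - s * y s - s * y s) - (1 - s\<^sup>2) * (y s * y s / 2)
      + lam * Ps s + lam * CC) x)"
proof -
  have u2: "C_upto 2 (pcone x0) u" and p1: "C_upto 1 (pcone x0) p"
    and ax: "axisymmetric_vector \<phi>0 u" "axisymmetric_scalar \<phi>0 p"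
    and hom: "homogeneous_on (pcone x0) (-1) u" "homogeneous_on (pcone x0) (-2) p"
    and pde: "\<And>x. x \<in> interior (pcone x0) \<Longrightarrow> - laplacian u x + convection u u x + grad p x = lam *\<^sub>R F x"
    and div: "\<And>x. x \<in> interior (pcone x0) \<Longrightarrow> divergence u x = 0"
    and bd: "\<And>x. x \<in> frontier (pcone x0) - {0} \<Longrightarrow> u x = 0"
    using sol unfolding axisym_selfsimilar_solution_def cone_eq by blast+
  have u1: "C_upto 1 (pcone x0) u" using C_upto_Suc_imp[of 1 "pcone x0" u] u2 by (simp only: Suc_1)
  define U where "U i s = u (mer s) $ i" for i s
  define \<sigma> where "\<sigma> s = sqrt (1 - s\<^sup>2)" for s :: real
  have LDU: "LD x0 (U i)" for i
    unfolding U_def[abs_def] by (rule LD_nth[OF LD_meridian[OF x0 u1]])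
  have Uc: "continuous_on {x0..1} (U i)" for i by (rule LD_continuous[OF LDU])
  have \<sigma>c: "continuous_on {x0..1} \<sigma>" unfolding \<sigma>_def[abs_def] by (intro continuous_intros)
  have \<sigma>pos: "0 < \<sigma> s" "\<sigma> s * \<sigma> s = 1 - s\<^sup>2" if "x0 \<le> s" "s < 1" for s
    using one_minus_square_pos'[of s] that by (simp_all add: \<sigma>_def)
  obtain a b d where abd: "\<forall>(\<rho>, \<phi>, \<theta>)\<in>cone_coords \<phi>0.
        u (spherical \<rho> \<phi> \<theta>) = a \<rho> \<phi> *\<^sub>R e_rho \<phi> \<theta> + b \<rho> \<phi> *\<^sub>R e_phi \<phi> \<theta> + d \<rho> \<phi> *\<^sub>R e_theta \<theta>"
    using ax(1) unfolding axisymmetric_vector_def by blast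
  have abd: "u (spherical \<rho> \<phi> \<theta>) = a \<rho> \<phi> *\<^sub>R e_rho \<phi> \<theta> + b \<rho> \<phi> *\<^sub>R e_phi \<phi> \<theta> + d \<rho> \<phi> *\<^sub>R e_theta \<theta>"
    if "(\<rho>, \<phi>, \<theta>) \<in> cone_coords \<phi>0" for \<rho> \<phi> \<theta>
    using abd that by fast
  obtain pq where pq: "\<forall>(\<rho>, \<phi>, \<theta>)\<in>cone_coords \<phi>0. p (spherical \<rho> \<phi> \<theta>) = pq \<rho> \<phi>"
    using ax(2) unfolding axisymmetric_scalar_def by blast
  have pq: "p (spherical \<rho> \<phi> \<theta>) = pq \<rho> \<phi>" if "(\<rho>, \<phi>, \<theta>) \<in> cone_coords \<phi>0" for \<rho> \<phi> \<theta>
    using pq that by fast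
  have Ucomp: "U 1 s = a 1 (arccos s) * \<sigma> s + b 1 (arccos s) * s" "U 2 s = d 1 (arccos s)"
      "U 3 s = a 1 (arccos s) * s - b 1 (arccos s) * \<sigma> s" if s: "s \<in> {x0..1}" for s
    unfolding U_def mer_spherical[OF s, symmetric] abd[OF mer_coords[OF s]]
    by (simp_all add: e_rho_def e_phi_eq e_theta_def sin_arccos_mem[OF s] cos_arccos_mem[OF s] \<sigma>_def)
  \<comment> \<open>A point of the axis has every longitude, while \<open>e_phi\<close> and
    \<open>e_theta\<close> change sign between \<open>pi\<close> and \<open>2 * pi\<close>; hence
    the transversal components vanish there.\<close>
  have U_1: "U 1 1 = 0" "U 2 1 = 0"
  proof -
    have cc: "(1, 0, pi) \<in> cone_coords \<phi>0" "(1, 0, 2 * pi) \<in> cone_coords \<phi>0"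
      using \<phi>0 by (auto simp: cone_coords_def)
    have "spherical 1 0 pi = spherical 1 0 (2 * pi)" by (simp add: vec_eq_iff forall_3)
    then have "a 1 0 *\<^sub>R e_rho 0 pi + b 1 0 *\<^sub>R e_phi 0 pi + d 1 0 *\<^sub>R e_theta pi =
        a 1 0 *\<^sub>R e_rho 0 (2 * pi) + b 1 0 *\<^sub>R e_phi 0 (2 * pi) + d 1 0 *\<^sub>R e_theta (2 * pi)"
      using abd[OF cc(1)] abd[OF cc(2)] by (simp only:)
    then have "b 1 0 = 0" "d 1 0 = 0"
      by (auto simp: vec_eq_iff forall_3 e_rho_def e_phi_eq e_theta_def)
    then show "U 1 1 = 0" "U 2 1 = 0" using Ucomp[of 1] x0 by (simp_all add: \<sigma>_def)
  qed
  have U_x0: "U i x0 = 0" for i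
  proof -
    have "mer x0 \<in> frontier (pcone x0) - {0}"
      unfolding frontier_cone[OF x0] using cosang_mer[of x0] mer_nonzero[of x0] x0 by simp
    from bd[OF this] show ?thesis by (simp add: U_def)
  qed
  \<comment> \<open>At \<open>mer s\<close> the field \<open>A x - B e_3 + D rotz x\<close> has the
    components \<open>\<sigma> A\<close>, \<open>\<sigma> D\<close> and \<open>s A - B\<close>; the
    three definitions solve for the profiles.\<close>
  define A where "A s = U 1 s * inverse (\<sigma> s)" for s
  define D where "D s = U 2 s * inverse (\<sigma> s)" for s
  define B where "B s = s * A s - U 3 s" for s
  define Q where "Q s = p (mer s)" for s
  have urep: "u x = E 2 A x *\<^sub>R x - E 1 B x *\<^sub>R axis 3 1 + E 2 D x *\<^sub>R rotz x"
    and prep: "p x = E 2 Q x" if x: "x \<noteq> 0" "x0 < cosang x" "cosang x < 1" for x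
  proof -
    define s where "s = cosang x"
    define r where "r = norm x"
    have r: "0 < r" using x by (simp add: r_def)
    have s: "s \<in> {x0..1}" "x0 \<le> s" "s < 1" using x by (auto simp: s_def)
    obtain \<theta> where \<theta>: "0 < \<theta>" "\<theta> \<le> 2 * pi" "x = spherical r (arccos s) \<theta>"
      unfolding s_def r_def by (rule spherical_coordinates[OF x(1)])
    have cc: "(1, arccos s, \<theta>) \<in> cone_coords \<phi>0" using arccos_mem[OF s(1)] \<theta> by (auto simp: cone_coords_def)
    have er: "e_rho (arccos s) \<theta> = inverse r *\<^sub>R x" unfolding e_rho_eq[OF r] using \<theta>(3) by simp
    have sp: "spherical 1 (arccos s) \<theta> = inverse r *\<^sub>R x" using er by (simp add: e_rho_def)
    have inK: "inverse r *\<^sub>R x \<in> pcone x0"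
      using x r by (simp add: cosang_def)
    have rr: "r *\<^sub>R (inverse r *\<^sub>R x) = x" using r by simp
    have "u x = (r powi (-1)) *\<^sub>R u (inverse r *\<^sub>R x)"
      using hom(1)[unfolded homogeneous_on_def, rule_format, OF inK r] unfolding rr .
    then have ux: "u x = inverse r *\<^sub>R (a 1 (arccos s) *\<^sub>R e_rho (arccos s) \<theta> + b 1 (arccos s) *\<^sub>R e_phi (arccos s) \<theta> + d 1 (arccos s) *\<^sub>R e_theta \<theta>)"
      unfolding sp[symmetric] abd[OF cc] by (simp add: power_int_minus)
    have "p x = (r powi (-2)) *\<^sub>R p (inverse r *\<^sub>R x)"
      using hom(2)[unfolded homogeneous_on_def, rule_format, OF inK r] unfolding rr .
    also have "p (inverse r *\<^sub>R x) = Q s"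
      unfolding Q_def mer_spherical[OF s(1), symmetric] sp[symmetric] pq[OF cc] pq[OF mer_coords[OF s(1)]] ..
    finally show "p x = E 2 Q x"
      by (simp add: E_def power_int_minus s_def r_def power_inverse)
    define w where "w = \<sigma> s"
    have w: "0 < w" "w * w = 1 - s * s" using \<sigma>pos[OF s(2,3)] by (simp_all add: w_def power2_eq_square)
    have Bs: "B s = b 1 (arccos s) * inverse w"
    proof -
      have "B s * w = b 1 (arccos s) * (s * s + w * w)"
        unfolding B_def A_def Ucomp[OF s(1)] w_def[symmetric] using w(1) by (simp add: field_simps)
      then have "B s * w = b 1 (arccos s)" unfolding w(2) by simp
      then show ?thesis using w(1) by (simp add: field_simps)
    qed
    have As: "A s = a 1 (arccos s) + b 1 (arccos s) * s * inverse w"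
      unfolding A_def Ucomp[OF s(1)] w_def[symmetric] using w(1) by (simp add: field_simps)
    have Ds: "D s * w = d 1 (arccos s)" unfolding D_def Ucomp[OF s(1)] w_def[symmetric] using w(1) by simp
    have sn: "sin (arccos s) = w" "cos (arccos s) = s"
      using sin_arccos_mem[OF s(1)] cos_arccos_mem[OF s(1)] by (simp_all add: w_def \<sigma>_def)
    have e3: "axis 3 1 = s *\<^sub>R e_rho (arccos s) \<theta> - w *\<^sub>R e_phi (arccos s) \<theta>"
      by (simp add: vec_eq_iff forall_3 axis_def e_rho_def e_phi_eq sn w(2))
    have rot: "rotz (e_rho (arccos s) \<theta>) = w *\<^sub>R e_theta \<theta>"
      by (simp add: vec_eq_iff forall_3 rotz_nth e_rho_def e_theta_def sn)
    have rotx: "rotz x = r *\<^sub>R (w *\<^sub>R e_theta \<theta>)"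
      unfolding rot[symmetric] er using r
      by (simp add: linear_scale[OF bounded_linear.linear[OF bounded_linear_rotz]])
    have xr: "x = r *\<^sub>R e_rho (arccos s) \<theta>" unfolding er using r by simp
    have "E 2 A x *\<^sub>R x = (A s * inverse r) *\<^sub>R e_rho (arccos s) \<theta>"
      by (subst (2) xr) (use r in \<open>simp add: E_def s_def[symmetric] r_def[symmetric] power2_eq_square\<close>)
    moreover have "E 2 D x *\<^sub>R rotz x = inverse r *\<^sub>R ((D s * w) *\<^sub>R e_theta \<theta>)"
      unfolding rotx using r by (simp add: E_def s_def[symmetric] r_def[symmetric] power2_eq_square)
    moreover have "E 1 B x *\<^sub>R axis 3 1 = (B s * inverse r) *\<^sub>R (s *\<^sub>R e_rho (arccos s) \<theta> - w *\<^sub>R e_phi (arccos s) \<theta>)"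
      unfolding e3 by (simp add: E_def s_def[symmetric] r_def[symmetric])
    ultimately have "E 2 A x *\<^sub>R x - E 1 B x *\<^sub>R axis 3 1 + E 2 D x *\<^sub>R rotz x =
       inverse r *\<^sub>R ((A s - B s * s) *\<^sub>R e_rho (arccos s) \<theta> + (B s * w) *\<^sub>R e_phi (arccos s) \<theta> + d 1 (arccos s) *\<^sub>R e_theta \<theta>)"
      unfolding Ds by (simp add: algebra_simps)
    also have "A s - B s * s = a 1 (arccos s)" unfolding As Bs by simp
    also have "B s * w = b 1 (arccos s)" unfolding Bs using w(1) by simp
    finally show "u x = E 2 A x *\<^sub>R x - E 1 B x *\<^sub>R axis 3 1 + E 2 D x *\<^sub>R rotz x" unfolding ux ..
  qed
  from meridian_C2[OF x0 u2] obtain v1 v2 :: "real \<Rightarrow> real^3" where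
    v: "\<forall>s. x0 < s \<longrightarrow> s < 1 \<longrightarrow> ((\<lambda>s. u (mer s)) has_vector_derivative v1 s) (at s) \<and> (v1 has_vector_derivative v2 s) (at s)"
    by (elim exE) (rule that)
  have dU: "(U i has_real_derivative v1 s $ i) (at s)" "((\<lambda>s. v1 s $ i) has_real_derivative v2 s $ i) (at s)"
    if "x0 < s" "s < 1" for i s
    using v that unfolding U_def[abs_def] has_real_derivative_iff_has_vector_derivative
    by (auto intro: bounded_linear.has_vector_derivative[OF bounded_linear_vec_nth])
  define i0 where "i0 s = inverse (sqrt (1 - s\<^sup>2))" for s :: real
  define i1 where "i1 s = s * inverse (sqrt (1 - s\<^sup>2)) ^ 3" for s :: real
  define i2 where "i2 s = (1 * inverse (sqrt (1 - s\<^sup>2)) ^ 3 + (of_nat 3 * (s * inverse (sqrt (1 - s\<^sup>2)) ^ 3 * inverse (sqrt (1 - s\<^sup>2)) ^ (3 - Suc 0))) * s)" for s :: real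
  have di: "(i0 has_real_derivative i1 s) (at s)" "(i1 has_real_derivative i2 s) (at s)" if "x0 < s" "s < 1" for s
    using inverse_sin_derivatives[of s] that x0 unfolding i0_def[abs_def] i1_def[abs_def] i2_def by auto
  define quo1 where "quo1 i s = v1 s $ i * i0 s + i1 s * U i s" for i s
  define quo2 where "quo2 i s = (v2 s $ i * i0 s + i1 s * v1 s $ i) + (i2 s * U i s + v1 s $ i * i1 s)" for i s
  have quo: "((\<lambda>s. U i s * inverse (\<sigma> s)) has_real_derivative quo1 i s) (at s)" "(quo1 i has_real_derivative quo2 i s) (at s)"
    if s: "x0 < s" "s < 1" for i s
    unfolding quo1_def[abs_def] quo2_def \<sigma>_def i0_def[symmetric]
    by (intro DERIV_mult[OF dU(1)[OF s] di(1)[OF s]])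
      (intro DERIV_add DERIV_mult[OF dU(2)[OF s] di(1)[OF s]] DERIV_mult[OF di(2)[OF s] dU(1)[OF s]])
  define A1 where "A1 = quo1 1"
  define A2 where "A2 = quo2 1"
  define B1 where "B1 s = (1 * A s + A1 s * s) - v1 s $ 3" for s
  define B2 where "B2 s = (A1 s + (1 * A1 s + A2 s * s)) - v2 s $ 3" for s
  have dA: "(A has_real_derivative A1 s) (at s)" "(A1 has_real_derivative A2 s) (at s)" if s: "x0 < s" "s < 1" for s
    unfolding A_def[abs_def] A1_def A2_def by (rule quo[OF s])+
  have dB: "(B has_real_derivative B1 s) (at s)" if s: "x0 < s" "s < 1" for s
    unfolding B_def[abs_def] B1_def by (intro DERIV_diff DERIV_mult[OF DERIV_ident dA(1)[OF s]] dU(1)[OF s])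
  have dB1: "(B1 has_real_derivative B2 s) (at s)" if s: "x0 < s" "s < 1" for s
  proof -
    have "(B1 has_real_derivative (A1 s + (A1 s * 1 + A2 s * s)) - v2 s $ 3) (at s)"
      unfolding B1_def[abs_def] mult_1_left
      by (intro DERIV_diff DERIV_add dA(1)[OF s] dU(2)[OF s] DERIV_cong[OF DERIV_mult[OF dA(2)[OF s] DERIV_ident]]) simp
    then show ?thesis by (simp add: B2_def)
  qed
  obtain Q1 where dQ: "\<And>s. x0 < s \<Longrightarrow> s < 1 \<Longrightarrow> (Q has_real_derivative Q1 s) (at s)"
  proof -
    have p1': "C_upto (Suc 0) (pcone x0) p" using p1 by (simp only: One_nat_def)
    from meridian_C1[OF x0 p1'] obtain g :: "3 \<Rightarrow> real^3 \<Rightarrow> real" where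
      "\<forall>s. x0 < s \<longrightarrow> s < 1 \<longrightarrow> ((\<lambda>s. p (mer s)) has_vector_derivative (- s / sqrt (1 - s\<^sup>2)) *\<^sub>R g 1 (mer s) + g 3 (mer s)) (at s)"
      by (elim exE conjE) (rule that, assumption)
    then have "(Q has_real_derivative (- s / sqrt (1 - s\<^sup>2)) *\<^sub>R g 1 (mer s) + g 3 (mer s)) (at s)" if "x0 < s" "s < 1" for s
      using that unfolding Q_def[abs_def] has_real_derivative_iff_has_vector_derivative by blast
    then show thesis by (rule that)
  qed
  interpret fld: angular_field x0 A A1 A2 B B1 B2 D "quo1 2" "quo2 2" Q Q1 u p
    by unfold_locales (use x0 dA dB dB1 dQ quo[of _ 2] urep prep in \<open>auto simp: D_def[abs_def]\<close>)
  define q where "q s = lam * (Ys s / \<sigma> s)" for s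
  have eqs: "- ((1 - s\<^sup>2) * A2 s - 4 * s * A1 s - 2 * A s) + (- (A s)\<^sup>2 - B s * ((1 - s\<^sup>2) * A1 s - 2 * s * A s) - (D s)\<^sup>2)
        - (2 * Q s + s * Q1 s) = lam * Xs s + s * q s"
      "- (2 * A1 s - ((1 - s\<^sup>2) * B2 s - 2 * s * B1 s)) + (B s * ((1 - s\<^sup>2) * B1 s - s * B s) + s * (D s)\<^sup>2) + Q1 s = - q s"
      "- ((1 - s\<^sup>2) * quo2 2 s - 4 * s * quo1 2 s - 2 * D s) - B s * ((1 - s\<^sup>2) * quo1 2 s - 2 * s * D s) = 0"
      "A s = (1 - s\<^sup>2) * B1 s - s * B s"
    if s: "x0 < s" "s < 1" for s
  proof -
    define x where "x = mer s"
    have as: "\<bar>s\<bar> \<le> 1" using s x0 by (simp add: abs_le_iff)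
    have cx: "cosang x = s" and nx: "norm x = 1" and x0': "x \<noteq> 0"
      unfolding x_def using cosang_mer[OF as] norm_mer[OF as] mer_nonzero[OF as] by auto
    have xW: "x \<in> fld.W" using cx x0' s by (simp add: fld.W_def)
    have xi: "x \<in> interior (pcone x0)" unfolding x_def by (rule mer_interior[OF x0(1) s(1) less_imp_le[OF s(2)]])
    have "divergence u x = 0" by (rule div[OF xi])
    then show "A s = (1 - s\<^sup>2) * B1 s - s * B s" using fld.divergence_u[OF xW] by (simp add: cx nx)
    define \<alpha> where "\<alpha> = - ((1 - s\<^sup>2) * A2 s - 4 * s * A1 s - 2 * A s) + (- (A s)\<^sup>2 - B s * ((1 - s\<^sup>2) * A1 s - 2 * s * A s) - (D s)\<^sup>2)
        - (2 * Q s + s * Q1 s)"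
    define \<beta> where "\<beta> = - (2 * A1 s - ((1 - s\<^sup>2) * B2 s - 2 * s * B1 s)) + (B s * ((1 - s\<^sup>2) * B1 s - s * B s) + s * (D s)\<^sup>2) + Q1 s"
    define \<gamma> where "\<gamma> = - ((1 - s\<^sup>2) * quo2 2 s - 4 * s * quo1 2 s - 2 * D s) - B s * ((1 - s\<^sup>2) * quo1 2 s - 2 * s * D s)"
    have "lam *\<^sub>R F x = \<alpha> *\<^sub>R x + \<beta> *\<^sub>R axis 3 1 + \<gamma> *\<^sub>R rotz x"
      unfolding pde[OF xi, symmetric] fld.laplacian_u[OF xW] fld.convection_u[OF xW] fld.grad_p[OF xW] cx nx \<alpha>_def \<beta>_def \<gamma>_def
      by (simp add: scaleR_add_left scaleR_diff_left algebra_simps)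
    moreover have "lam *\<^sub>R F x = (lam * Xs s + s * q s) *\<^sub>R x + (- q s) *\<^sub>R axis 3 1"
    proof -
      have FX: "F x = (Xs s + s * (Ys s / \<sigma> s)) *\<^sub>R x - (Ys s / \<sigma> s) *\<^sub>R axis 3 1"
        using F_off_axis[OF x0'] s unfolding cx nx \<sigma>_def by simp
      show ?thesis unfolding FX q_def by (simp add: algebra_simps)
    qed
    ultimately have eq: "\<alpha> *\<^sub>R x + \<beta> *\<^sub>R axis 3 1 + \<gamma> *\<^sub>R rotz x = (lam * Xs s + s * q s) *\<^sub>R x + (- q s) *\<^sub>R axis 3 1"
      by simp
    have w: "0 < \<sigma> s" using \<sigma>pos(1)[of s] s by simp
    have xc: "x $ 1 = \<sigma> s" "x $ 2 = 0" "x $ 3 = s" by (simp_all add: x_def \<sigma>_def)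
    \<comment> \<open>At a point of the meridian the second component sees only
      \<open>rotz x\<close> and the first only \<open>x\<close>, so the three coefficients can be
      compared separately.\<close>
    have "\<alpha> * \<sigma> s = (lam * Xs s + s * q s) * \<sigma> s"
      using arg_cong[OF eq, of "\<lambda>v. v $ 1"] by (simp add: xc rotz_nth axis_def)
    then have \<alpha>: "\<alpha> = lam * Xs s + s * q s" using w by simp
    have "\<gamma> * \<sigma> s = 0" using arg_cong[OF eq, of "\<lambda>v. v $ 2"] by (simp add: xc rotz_nth axis_def)
    then have \<gamma>: "\<gamma> = 0" using w by simp
    have "\<alpha> * s + \<beta> = (lam * Xs s + s * q s) * s - q s"
      using arg_cong[OF eq, of "\<lambda>v. v $ 3"] by (simp add: xc rotz_nth axis_def)
    then have \<beta>: "\<beta> = - q s" unfolding \<alpha> by simp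
    show "- ((1 - s\<^sup>2) * A2 s - 4 * s * A1 s - 2 * A s) + (- (A s)\<^sup>2 - B s * ((1 - s\<^sup>2) * A1 s - 2 * s * A s) - (D s)\<^sup>2)
        - (2 * Q s + s * Q1 s) = lam * Xs s + s * q s" using \<alpha> unfolding \<alpha>_def .
    show "- (2 * A1 s - ((1 - s\<^sup>2) * B2 s - 2 * s * B1 s)) + (B s * ((1 - s\<^sup>2) * B1 s - s * B s) + s * (D s)\<^sup>2) + Q1 s = - q s"
      using \<beta> unfolding \<beta>_def .
    show "- ((1 - s\<^sup>2) * quo2 2 s - 4 * s * quo1 2 s - 2 * D s) - B s * ((1 - s\<^sup>2) * quo1 2 s - 2 * s * D s) = 0"
      using \<gamma> unfolding \<gamma>_def .
  qed
  have dsq: "((\<lambda>s::real. 1 - s\<^sup>2) has_real_derivative - 2 * s) (at s)" for s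
    by (auto intro!: derivative_eq_intros)
  have Bc: "continuous_on {x0..<1} B"
    unfolding B_def[abs_def] A_def using \<sigma>pos(1)
    by (intro continuous_intros continuous_on_subset[OF Uc] continuous_on_subset[OF \<sigma>c]) force+
  \<comment> \<open>The third equation says \<open>w'' = - B w'\<close> for
    \<open>w = (1 - s^2) D = \<sigma> U 2\<close>. This function vanishes at \<open>x0\<close> by
    no-slip and at 1 by symmetry.\<close>
  have D0: "D s = 0" if s: "x0 < s" "s < 1" for s
  proof -
    have "\<sigma> s * U 2 s = 0"
    proof (rule linear_ode_zero[where p = x0 and q = 1 and w = "\<lambda>s. \<sigma> s * U 2 s" and b = B
          and wd = "\<lambda>s. (1 - s\<^sup>2) * quo1 2 s - 2 * s * D s"])
      show "continuous_on {x0..1} (\<lambda>s. \<sigma> s * U 2 s)" by (intro continuous_intros \<sigma>c Uc)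
      show "\<sigma> x0 * U 2 x0 = 0" "\<sigma> 1 * U 2 1 = 0" by (simp_all add: U_x0 U_1)
      show "continuous_on {x0<..<1} B" by (rule continuous_on_subset[OF Bc]) auto
      show "((\<lambda>s. \<sigma> s * U 2 s) has_real_derivative (1 - t\<^sup>2) * quo1 2 t - 2 * t * D t) (at t)" if t: "x0 < t" "t < 1" for t
      proof (rule has_field_derivative_transform_within_open[where S = "{x0<..<1}"])
        have "((\<lambda>s. (1 - s\<^sup>2) * D s) has_real_derivative (- 2 * t) * D t + quo1 2 t * (1 - t\<^sup>2)) (at t)"
          unfolding D_def[abs_def] by (rule DERIV_mult[OF dsq quo(1)[OF t]])
        then show "((\<lambda>s. (1 - s\<^sup>2) * D s) has_real_derivative (1 - t\<^sup>2) * quo1 2 t - 2 * t * D t) (at t)"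
          by (rule DERIV_cong) simp
        show "(1 - r\<^sup>2) * D r = \<sigma> r * U 2 r" if "r \<in> {x0<..<1}" for r
          using \<sigma>pos[of r] that unfolding D_def by (simp flip: \<sigma>pos(2))
      qed (use t in auto)
      show "((\<lambda>s. (1 - s\<^sup>2) * quo1 2 s - 2 * s * D s) has_real_derivative - (B t * ((1 - t\<^sup>2) * quo1 2 t - 2 * t * D t))) (at t)"
        if t: "x0 < t" "t < 1" for t
      proof -
        have "((\<lambda>s. (1 - s\<^sup>2) * quo1 2 s - 2 * s * D s) has_real_derivative
            ((- 2 * t) * quo1 2 t + quo2 2 t * (1 - t\<^sup>2)) - ((2 * 1) * D t + quo1 2 t * (2 * t))) (at t)"
          unfolding D_def[abs_def]
          by (rule DERIV_diff[OF DERIV_mult[OF dsq quo(2)[OF t]] DERIV_mult[OF DERIV_cmult[OF DERIV_ident] quo(1)[OF t]]])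
        then show ?thesis by (rule DERIV_cong) (use eqs(3)[OF t] in \<open>simp add: algebra_simps\<close>)
      qed
    qed (use s x0 in auto)
    then show ?thesis using \<sigma>pos(1)[of s] s by (simp add: D_def)
  qed
  \<comment> \<open>\<open>f\<close> is the radial profile and \<open>ps\<close> the stream function
    \<open>(1 - s^2) B\<close>. They are written through the components \<open>U\<close> to make
    them continuous up to the axis.\<close>
  define f where "f s = \<sigma> s * U 1 s + s * U 3 s" for s
  define f1 where "f1 s = A1 s - (B s + s * B1 s)" for s
  define f2 where "f2 s = A2 s - (B1 s + (B1 s + s * B2 s))" for s
  define ps where "ps s = \<sigma> s * (s * U 1 s) - (1 - s\<^sup>2) * U 3 s" for s
  have f_eq: "f s = A s - s * B s" and ps_eq: "ps s = (1 - s\<^sup>2) * B s" if s: "x0 < s" "s < 1" for s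
  proof -
    have "0 < \<sigma> s" "\<sigma> s * \<sigma> s = 1 - s\<^sup>2" using \<sigma>pos[of s] s by auto
    then have UA: "U 1 s = \<sigma> s * A s" and w: "\<sigma> s * \<sigma> s = 1 - s * s" unfolding A_def by (simp_all add: power2_eq_square)
    have "f s = (\<sigma> s * \<sigma> s) * A s + s * U 3 s" unfolding f_def UA by (simp add: ac_simps)
    then show "f s = A s - s * B s" unfolding w B_def by (simp add: algebra_simps)
    have "ps s = (\<sigma> s * \<sigma> s) * (s * A s) - (1 - s\<^sup>2) * U 3 s" unfolding ps_def UA by (simp add: ac_simps)
    then show "ps s = (1 - s\<^sup>2) * B s" unfolding w B_def by (simp add: power2_eq_square algebra_simps)
  qed
  have LDf: "LD x0 f"
    unfolding f_def[abs_def] \<sigma>_def by (intro LD_add LD_mult LD_sqrt_sin LD_id LDU x0)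
  have fc: "continuous_on {x0..1} f" by (rule LD_continuous[OF LDf])
  have psc: "continuous_on {x0..1} ps" unfolding ps_def[abs_def] by (intro continuous_intros \<sigma>c Uc)
  have \<sigma>1: "\<sigma> 1 = 0" by (simp add: \<sigma>_def)
  have ps1: "ps 1 = 0" by (simp add: ps_def \<sigma>1)
  have opn: "(g has_real_derivative d') (at s)" if "x0 < s" "s < 1" "(h has_real_derivative d') (at s)"
      "\<And>t. x0 < t \<Longrightarrow> t < 1 \<Longrightarrow> h t = g t" for g h d' s
    by (rule has_field_derivative_transform_within_open[where S = "{x0<..<1}", OF that(3)]) (use that in auto)
  have df: "(f has_real_derivative f1 s) (at s)" if s: "x0 < s" "s < 1" for s
  proof (rule opn[OF s])
    show "((\<lambda>s. A s - s * B s) has_real_derivative f1 s) (at s)"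
      unfolding f1_def by (rule DERIV_cong[OF DERIV_diff[OF dA(1)[OF s] DERIV_mult[OF DERIV_ident dB[OF s]]]]) simp
  qed (simp add: f_eq)
  have df1: "(f1 has_real_derivative f2 s) (at s)" if s: "x0 < s" "s < 1" for s
    unfolding f1_def[abs_def] f2_def
    by (rule DERIV_cong[OF DERIV_diff[OF dA(2)[OF s] DERIV_add[OF dB[OF s] DERIV_mult[OF DERIV_ident dB1[OF s]]]]]) simp
  have A1_eq: "A1 s = (1 - s\<^sup>2) * B2 s - 2 * s * B1 s - (B s + s * B1 s)" if s: "x0 < s" "s < 1" for s
  proof -
    have "((\<lambda>s. (1 - s\<^sup>2) * B1 s - s * B s) has_real_derivative (1 - s\<^sup>2) * B2 s - 2 * s * B1 s - (B s + s * B1 s)) (at s)"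
      by (rule DERIV_cong[OF DERIV_diff[OF DERIV_mult[OF dsq dB1[OF s]] DERIV_mult[OF DERIV_ident dB[OF s]]]]) simp
    then have "(A has_real_derivative (1 - s\<^sup>2) * B2 s - 2 * s * B1 s - (B s + s * B1 s)) (at s)"
      by (rule opn[OF s]) (simp add: eqs(4))
    then show ?thesis by (rule DERIV_unique[OF dA(1)[OF s]])
  qed
  \<comment> \<open>This is incompressibility: the divergence equation is
    \<open>A = (1 - s^2) B' - s B\<close>, so \<open>f = A - s B\<close> is the derivative of
    \<open>(1 - s^2) B\<close>.\<close>
  have dps: "(ps has_real_derivative f s) (at s)" if s: "x0 < s" "s < 1" for s
  proof (rule opn[OF s])
    have "(- 2 * s) * B s + B1 s * (1 - s\<^sup>2) = f s"
      using f_eq[OF s] eqs(4)[OF s] by (simp add: algebra_simps)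
    then show "((\<lambda>s. (1 - s\<^sup>2) * B s) has_real_derivative f s) (at s)"
      by (rule DERIV_cong[OF DERIV_mult[OF dsq dB[OF s]]])
  qed (simp add: ps_eq)
  have Q1_eq: "Q1 s = - q s + f1 s - ((1 - s\<^sup>2) * (B s * B1 s) - 2 * s * (B s * B s / 2))" if s: "x0 < s" "s < 1" for s
  proof -
    have "- (2 * A1 s - ((1 - s\<^sup>2) * B2 s - 2 * s * B1 s)) + B s * ((1 - s\<^sup>2) * B1 s - s * B s) + Q1 s = - q s"
      using eqs(2)[OF s] D0[OF s] by simp
    from pressure_identity[OF this eqs(4)[OF s] A1_eq[OF s]] show ?thesis by (simp add: f1_def)
  qed
  \<comment> \<open>The integrated axial equation determines the pressure up to the constant
    \<open>k\<close>, which the no-slip condition fixes later.\<close>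
  have "\<exists>k. \<forall>s\<in>{x0<..<1}. Q s - f s + (1 - s\<^sup>2) * (B s * B s / 2) - lam * Ps s = k"
  proof (rule constant_on_open[where f = "\<lambda>s. Q s - f s + (1 - s\<^sup>2) * (B s * B s / 2) - lam * Ps s"])
    fix s assume s: "x0 < s" "s < 1"
    have "((\<lambda>s. Q s - f s + (1 - s\<^sup>2) * (B s * B s / 2) - lam * Ps s) has_real_derivative
        Q1 s - f1 s + ((- 2 * s) * (B s * B s / 2) + ((B1 s * B s + B1 s * B s) / 2) * (1 - s\<^sup>2)) - lam * (- Ys s / sqrt (1 - s\<^sup>2))) (at s)"
      by (intro DERIV_diff DERIV_add dQ[OF s] df[OF s] DERIV_mult[OF dsq DERIV_cdivide[OF DERIV_mult[OF dB[OF s] dB[OF s]]]]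
          DERIV_cmult[OF dPs[OF s]])
    then show "((\<lambda>s. Q s - f s + (1 - s\<^sup>2) * (B s * B s / 2) - lam * Ps s) has_real_derivative 0) (at s)"
      by (rule DERIV_cong) (simp add: Q1_eq[OF s] q_def \<sigma>_def field_simps)
  qed
  then obtain k where k: "\<forall>s\<in>{x0<..<1}. Q s - f s + (1 - s\<^sup>2) * (B s * B s / 2) - lam * Ps s = k" ..
  have Q_eq: "Q s = f s - (1 - s\<^sup>2) * (B s * B s / 2) + lam * Ps s + k" if s: "x0 < s" "s < 1" for s
    using k[rule_format, of s] s by simp
  define \<Gamma>k where "\<Gamma>k t = lam * (Xs t + 2 * Ps t) + 2 * k" for t
  interpret M: angular_mean x0 \<Gamma>k
    by unfold_locales (use x0 in \<open>auto simp: \<Gamma>k_def[abs_def] intro!: LD_add LD_mult LD_const LD_Xs LD_Ps\<close>)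
  define \<Phi> where "\<Phi> s = (1 - s\<^sup>2) * f1 s + ps s * f s + 2 * ps s" for s
  have d\<Phi>: "(\<Phi> has_real_derivative - \<Gamma>k s) (at s)" if s: "x0 < s" "s < 1" for s
  proof -
    have "(\<Phi> has_real_derivative (((- 2 * s) * f1 s + f2 s * (1 - s\<^sup>2)) + (f s * f s + f1 s * ps s)) + 2 * f s) (at s)"
      unfolding \<Phi>_def[abs_def]
      by (intro DERIV_add DERIV_mult[OF dsq df1[OF s]] DERIV_mult[OF dps[OF s] df[OF s]] DERIV_cmult[OF dps[OF s]])
    moreover have "(((- 2 * s) * f1 s + f2 s * (1 - s\<^sup>2)) + (f s * f s + f1 s * ps s)) + 2 * f s = - \<Gamma>k s"
    proof -
      have "((1 - s\<^sup>2) * (A2 s - (B1 s + (B1 s + s * B2 s))) - 2 * s * (A1 s - (B s + s * B1 s))) +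
          ((1 - s\<^sup>2) * B s * (A1 s - (B s + s * B1 s)) + (A s - s * B s) * (A s - s * B s)) + 2 * (A s - s * B s) = - (lam * Xs s + 2 * (lam * Ps s) + 2 * k)"
      proof (rule momentum_identity)
        show "- ((1 - s\<^sup>2) * A2 s - 4 * s * A1 s - 2 * A s) + (- (A s)\<^sup>2 - B s * ((1 - s\<^sup>2) * A1 s - 2 * s * A s)) - (2 * Q s + s * Q1 s) = lam * Xs s + s * q s"
          using eqs(1)[OF s] D0[OF s] by simp
        show "(1 - s\<^sup>2) * B1 s = A s + s * B s" using eqs(4)[OF s] by simp
        show "(1 - s\<^sup>2) * B2 s = A1 s + 3 * s * B1 s + B s" using A1_eq[OF s] by simp
        have "(1 - s\<^sup>2) * (B s * B1 s) - 2 * s * (B s * B s / 2) = B s * A s"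
          unfolding eqs(4)[OF s] by (simp add: algebra_simps)
        then show "Q1 s = - q s + (A1 s - (B s + s * B1 s)) - B s * A s"
          using Q1_eq[OF s] by (simp only: f1_def)
        show "Q s = (A s - s * B s) - (1 - s\<^sup>2) * (B s * B s / 2) + lam * Ps s + k"
          using Q_eq[OF s] unfolding f_eq[OF s] .
      qed
      moreover have "f2 s * (1 - s\<^sup>2) = (1 - s\<^sup>2) * (A2 s - (B1 s + (B1 s + s * B2 s)))" by (simp add: f2_def)
      moreover have "f1 s * ps s = (1 - s\<^sup>2) * B s * (A1 s - (B s + s * B1 s))" unfolding f1_def ps_eq[OF s] by simp
      moreover have "\<Gamma>k s = lam * Xs s + 2 * (lam * Ps s) + 2 * k" by (simp add: \<Gamma>k_def algebra_simps)
      ultimately show ?thesis unfolding f_eq[OF s] f1_def by linarith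
    qed
    ultimately show ?thesis by (rule DERIV_cong)
  qed
  have "\<exists>\<kappa>. \<forall>s\<in>{x0<..<1}. \<Phi> s - M.J1 s = \<kappa>"
  proof (rule constant_on_open[where f = "\<lambda>s. \<Phi> s - M.J1 s"])
    fix s assume s: "x0 < s" "s < 1"
    have "(M.J1 has_real_derivative - \<Gamma>k s) (at s)"
      by (rule M.within_at[OF s M.dJ1]) (use s in simp)
    from DERIV_diff[OF d\<Phi>[OF s] this]
    show "((\<lambda>s. \<Phi> s - M.J1 s) has_real_derivative 0) (at s)" by simp
  qed
  then obtain \<kappa> where \<kappa>': "\<forall>s\<in>{x0<..<1}. \<Phi> s - M.J1 s = \<kappa>" ..
  have \<kappa>: "\<Phi> s - M.J1 s = \<kappa>" if "x0 < s" "s < 1" for s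
    by (rule \<kappa>'[rule_format]) (use that in simp)
  have "\<kappa> = 0"
  proof -
    obtain L where L: "0 \<le> L" "\<And>s t. s \<in> {x0..1} \<Longrightarrow> t \<in> {x0..1} \<Longrightarrow> norm (f s - f t) \<le> L * \<bar>sqrt (1 - s) - sqrt (1 - t)\<bar>"
      using LD_obtain[OF LDf] by metis
    \<comment> \<open>\<open>(1 - s^2) * f1 s\<close> is at most \<open>L * sqrt (1 - s)\<close>,
      but \<open>f1\<close> has no value at the axis. The continuous function \<open>H\<close>
      bypasses this: it is nonnegative off the axis and equals \<open>- \<bar>\<kappa>\<bar>\<close>
      at 1.\<close>
    define H where "H s = L * sqrt (1 - s) + \<bar>ps s * f s + 2 * ps s\<bar> + \<bar>M.J1 s\<bar> - \<bar>\<kappa>\<bar>" for s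
    have J1c: "continuous_on {x0..1} M.J1" by (rule DERIV_continuous_on[OF M.dJ1])
    have Hc: "continuous_on {x0..1} H"
      unfolding H_def[abs_def] by (intro continuous_intros psc fc J1c)
    have "0 \<le> H s" if s: "x0 < s" "s < 1" for s
    proof -
      have "\<bar>f1 s\<bar> \<le> L / (2 * sqrt (1 - s))"
        by (rule LD_derivative_bound[OF _ s df[OF s]]) (use L(2) in simp)
      then have "(1 - s\<^sup>2) * \<bar>f1 s\<bar> \<le> (1 - s\<^sup>2) * (L / (2 * sqrt (1 - s)))"
        using one_minus_square_pos[OF s] by (intro mult_left_mono) auto
      also have "\<dots> = (1 + s) / 2 * L * ((1 - s) / sqrt (1 - s))"
        by (simp add: power2_eq_square algebra_simps add_divide_distrib diff_divide_distrib)
      also have "\<dots> = (1 + s) / 2 * L * sqrt (1 - s)" using s by (simp add: real_div_sqrt)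
      also have "\<dots> \<le> 1 * L * sqrt (1 - s)" using s L(1) x0 by (intro mult_right_mono) auto
      finally have w: "\<bar>(1 - s\<^sup>2) * f1 s\<bar> \<le> L * sqrt (1 - s)" using one_minus_square_pos[OF s] by (simp add: abs_mult)
      have "\<kappa> = (1 - s\<^sup>2) * f1 s + (ps s * f s + 2 * ps s) - M.J1 s" using \<kappa>[OF s] unfolding \<Phi>_def by simp
      then show ?thesis using w unfolding H_def by linarith
    qed
    note H0 = this
    have cl: "closure {x0<..<1} = {x0..1}" using x0 by simp
    have "0 \<le> H 1"
    proof (rule continuous_ge_on_closure[where f = H and S = "{x0<..<1}" and x = 1])
      show "continuous_on (closure {x0<..<1}) H" unfolding cl by (rule Hc)
      show "1 \<in> closure {x0<..<1}" unfolding cl using x0 by simp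
      show "0 \<le> H t" if "t \<in> {x0<..<1}" for t using H0[of t] that by simp
    qed
    then show ?thesis by (simp add: H_def ps1 M.J1_def)
  qed
  \<comment> \<open>A primitive of \<open>\<Phi>\<close>: since \<open>ps' = f\<close>, the terms
    \<open>- 2 s f\<close> and \<open>2 s f\<close> cancel. In terms of \<open>B\<close> it is
    \<open>(1 - s^2)^2 (B' + B^2 / 2)\<close>, which brings in the Riccati expression.\<close>
  define \<Psi> where "\<Psi> s = (1 - s\<^sup>2) * f s + 2 * s * ps s + ps s * ps s / 2" for s
  have d\<Psi>: "(\<Psi> has_real_derivative M.J1 s) (at s)" if s: "x0 < s" "s < 1" for s
  proof -
    have "(\<Psi> has_real_derivative (((- 2 * s) * f s + f1 s * (1 - s\<^sup>2)) + ((2 * 1) * ps s + f s * (2 * s))) + (f s * ps s + f s * ps s) / 2) (at s)"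
      unfolding \<Psi>_def[abs_def]
      by (intro DERIV_add DERIV_mult[OF dsq df[OF s]] DERIV_mult[OF DERIV_cmult[OF DERIV_ident] dps[OF s]]
          DERIV_cdivide[OF DERIV_mult[OF dps[OF s] dps[OF s]]])
    moreover have "(((- 2 * s) * f s + f1 s * (1 - s\<^sup>2)) + ((2 * 1) * ps s + f s * (2 * s))) + (f s * ps s + f s * ps s) / 2 = M.J1 s"
      using \<kappa>[OF s] \<open>\<kappa> = 0\<close> unfolding \<Phi>_def by (simp add: algebra_simps)
    ultimately show ?thesis by (rule DERIV_cong)
  qed
  have \<Psi>c: "continuous_on {x0..1} \<Psi>" unfolding \<Psi>_def[abs_def] by (intro continuous_intros fc psc) simp
  have NNc: "continuous_on {x0..1} M.NN" by (rule DERIV_continuous_on[OF M.dNN])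
  have \<Psi>_eq: "\<Psi> s = M.NN s" if s: "s \<in> {x0..1}" for s
  proof (cases "s = 1")
    case True
    then show ?thesis by (simp add: \<Psi>_def ps1 M.NN_def)
  next
    case False
    then have "s < 1" using s by simp
    then have "\<Psi> 1 - M.NN 1 = \<Psi> s - M.NN s"
    proof (rule DERIV_isconst_end)
      show "continuous_on {s..1} (\<lambda>s. \<Psi> s - M.NN s)"
        by (rule continuous_on_subset[of "{x0..1}"]) (use s in \<open>auto intro!: continuous_intros \<Psi>c NNc\<close>)
      fix t assume "s < t" "t < 1"
      then have t: "x0 < t" "t < 1" using s by auto
      have "(M.NN has_real_derivative M.J1 t) (at t)" by (rule M.within_at[OF t M.dNN]) (use t in simp)
      from DERIV_diff[OF d\<Psi>[OF t] this] show "((\<lambda>s. \<Psi> s - M.NN s) has_real_derivative 0) (at t)" by simp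
    qed
    then show ?thesis by (simp add: \<Psi>_def ps1 M.NN_def)
  qed
  \<comment> \<open>No-slip makes \<open>\<Psi>\<close> vanish at \<open>x0\<close>, so the double
    integral with the unknown constant vanishes there; by \<open>integration_constant\<close> only
    one value of \<open>k\<close> achieves this.\<close>
  have kC: "k = lam * CC"
  proof -
    have "f x0 = 0" "ps x0 = 0" by (simp_all add: f_def ps_def U_x0)
    then have "M.NN x0 = 0" using \<Psi>_eq[of x0] x0 by (simp add: \<Psi>_def)
    moreover have "M.NN x0 = integral {x0..1} (\<lambda>t. lam * ((Xs t + 2 * Ps t + 2 * 0) * (x0 - t)) + (- 2 * k) * (t - x0))"
      unfolding M.NN_def \<Gamma>k_def by (rule arg_cong[where f = "integral {x0..1}"]) (auto simp: algebra_simps)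
    also have "\<dots> = integral {x0..1} (\<lambda>t. lam * ((Xs t + 2 * Ps t + 2 * 0) * (x0 - t))) + integral {x0..1} (\<lambda>t. (- 2 * k) * (t - x0))"
      by (intro integral_add integrable_continuous_interval continuous_intros LD_continuous[OF LD_Xs] Ps_cont)
    also have "\<dots> = lam * ((CC - 0) * (1 - x0)\<^sup>2) + (- 2 * k) * ((1 - x0)\<^sup>2 / 2)"
      using integration_constant[of 0] integral_linear by simp
    also have "\<dots> = (lam * CC - k) * (1 - x0)\<^sup>2" by (simp add: algebra_simps)
    ultimately show ?thesis using x0 by simp
  qed
  have MNN: "M.NN s = lam * NN s" for s
  proof -
    have "M.NN s = integral {s..1} (\<lambda>t. lam * (Gam t * (s - t)))"
      unfolding M.NN_def \<Gamma>k_def kC Gam_def by (rule arg_cong[where f = "integral {s..1}"]) (auto simp: algebra_simps)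
    then show ?thesis by (simp add: NN_def)
  qed
  have ode: "B1 s = lam * nn s - (B s)\<^sup>2 / 2" if s: "x0 < s" "s < 1" for s
  proof -
    define w where "w = 1 - s\<^sup>2"
    have w: "0 < w" using one_minus_square_pos[OF s] by (simp add: w_def)
    have fs: "f s = w * B1 s - 2 * s * B s" using f_eq[OF s] eqs(4)[OF s] by (simp add: w_def)
    have pss: "ps s = w * B s" using ps_eq[OF s] by (simp add: w_def)
    have "\<Psi> s = w * w * (B1 s + (B s)\<^sup>2 / 2)"
      unfolding \<Psi>_def fs pss w_def[symmetric] by (simp add: power2_eq_square field_simps)
    moreover have "\<Psi> s = lam * (w * (w * nn s))"
      using \<Psi>_eq[of s] NN_mm[of s] s unfolding MNN by (simp add: mm_def w_def)
    ultimately have "(w * w) * (B1 s + (B s)\<^sup>2 / 2) = (w * w) * (lam * nn s)" by (simp only: ac_simps)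
    then have "B1 s + (B s)\<^sup>2 / 2 = lam * nn s" using w by (simp only: mult_cancel_left) simp
    then show ?thesis by simp
  qed
  have B_x0: "B x0 = 0" by (simp add: B_def A_def U_x0)
  \<comment> \<open>\<open>U 1\<close> vanishes on the axis and is Lipschitz in
    \<open>sqrt (1 - s)\<close>, so its quotient \<open>A\<close> by
    \<open>\<sigma> s = sqrt (1 - s) * sqrt (1 + s)\<close> stays bounded, and so does
    \<open>B\<close>.\<close>
  obtain Bb where Bb: "\<And>s. s \<in> {x0..<1} \<Longrightarrow> \<bar>B s\<bar> \<le> Bb"
  proof -
    obtain L where L: "0 \<le> L" "\<And>s t. s \<in> {x0..1} \<Longrightarrow> t \<in> {x0..1} \<Longrightarrow> norm (U 1 s - U 1 t) \<le> L * \<bar>sqrt (1 - s) - sqrt (1 - t)\<bar>"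
      using LD_obtain[OF LDU[of 1]] by metis
    obtain K where K: "0 \<le> K" "\<And>s. s \<in> {x0..1} \<Longrightarrow> norm (U 3 s) \<le> K" using LD_bounded[OF LDU[of 3]] by metis
    have "\<bar>B s\<bar> \<le> L / sqrt (1 + x0) + K" if s: "s \<in> {x0..<1}" for s
    proof -
      have pos: "0 < sqrt (1 - s)" "0 < sqrt (1 + x0)" using s x0 by auto
      have "\<bar>U 1 s\<bar> \<le> L * sqrt (1 - s)" using L(2)[of s 1] s by (simp add: U_1)
      then have "\<bar>U 1 s\<bar> * sqrt (1 + x0) \<le> (L * sqrt (1 - s)) * sqrt (1 + s)"
        using L(1) s x0 by (intro mult_mono) auto
      also have "\<dots> = L * \<sigma> s" unfolding \<sigma>_def sqrt_sin_eq by (simp add: mult.assoc)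
      finally have "\<bar>U 1 s\<bar> * sqrt (1 + x0) \<le> L * \<sigma> s" .
      then have "\<bar>A s\<bar> \<le> L / sqrt (1 + x0)"
        using pos \<sigma>pos(1)[of s] s unfolding A_def
        by (simp add: abs_mult pos_le_divide_eq field_simps)
      moreover have "\<bar>s\<bar> * \<bar>A s\<bar> \<le> 1 * \<bar>A s\<bar>" using s x0 by (intro mult_right_mono) auto
      moreover have "\<bar>U 3 s\<bar> \<le> K" using K(2)[of s] s by simp
      moreover have "\<bar>B s\<bar> \<le> \<bar>s\<bar> * \<bar>A s\<bar> + \<bar>U 3 s\<bar>" unfolding B_def abs_mult[symmetric] by (rule abs_triangle_ineq4)
      ultimately show ?thesis by linarith
    qed
    then show thesis by (rule that)
  qed
  have dB': "(B has_real_derivative lam * nn s - (B s)\<^sup>2 / 2) (at s)" if s: "x0 < s" "s < 1" for s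
    using dB[OF s] unfolding ode[OF s] .
  \<comment> \<open>Being bounded, \<open>B\<close> itself serves as the subsolution. Uniqueness
    then shows that the solution obtained extends \<open>B\<close> to the axis.\<close>
  have "\<exists>y. riccati x0 1 nn lam y"
    by (rule riccati_of_subsolution[OF x0(2) LD_continuous[OF LD_nn] Bc _ Bb]) (use dB' B_x0 in auto)
  then obtain y where y: "riccati x0 1 nn lam y" ..
  have By: "B s = y s" if "s \<in> {x0..<1}" for s
    by (rule riccati_unique[OF y Bc B_x0 Bb dB' that])
  have Ay: "A s = lam * mm s - (1 - s\<^sup>2) * (y s * y s / 2) - s * y s" if s: "x0 < s" "s < 1" for s
    unfolding eqs(4)[OF s] ode[OF s] mm_def using By[of s] s by (simp add: power2_eq_square algebra_simps)
  have "u x = E 2 (\<lambda>s. lam * mm s - (1 - s\<^sup>2) * (y s * y s / 2) - s * y s) x *\<^sub>R x - E 1 y x *\<^sub>R axis 3 1 \<and>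
    p x = E 2 (\<lambda>s. (lam * mm s - (1 - s\<^sup>2) * (y s * y s / 2) - s * y s - s * y s) - (1 - s\<^sup>2) * (y s * y s / 2)
      + lam * Ps s + lam * CC) x" if "x \<in> Woff" for x
  proof -
    have x: "x \<noteq> 0" "x0 < cosang x" "cosang x < 1" using that by (auto simp: Woff_def)
    have "E 2 D x = 0" "E 2 A x = E 2 (\<lambda>s. lam * mm s - (1 - s\<^sup>2) * (y s * y s / 2) - s * y s) x" "E 1 B x = E 1 y x"
      using D0[OF x(2,3)] Ay[OF x(2,3)] By[of "cosang x"] x by (simp_all add: E_def)
    moreover have "E 2 Q x = E 2 (\<lambda>s. (lam * mm s - (1 - s\<^sup>2) * (y s * y s / 2) - s * y s - s * y s) - (1 - s\<^sup>2) * (y s * y s / 2)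
      + lam * Ps s + lam * CC) x"
      unfolding E_def Q_eq[OF x(2,3)] f_eq[OF x(2,3)] Ay[OF x(2,3)] kC using By[of "cosang x"] x by simp
    ultimately show ?thesis unfolding urep[OF x] prep[OF x] by simp
  qed
  then show ?thesis using y by blast
qed

section \<open>Uniqueness, existence and the range of the parameter\<close>

lemma solution_unique:
  assumes "axisym_selfsimilar_solution \<phi>0 F lam u p" "axisym_selfsimilar_solution \<phi>0 F lam u' p'" "x \<in> solid_cone \<phi>0"
  shows "u' x = u x" "p' x = p x"
proof -
  have x: "x \<in> pcone x0" using assms(3) unfolding cone_eq .
  obtain y where y: "riccati x0 1 nn lam y" "\<forall>x\<in>Woff.
    u x = E 2 (\<lambda>s. lam * mm s - (1 - s\<^sup>2) * (y s * y s / 2) - s * y s) x *\<^sub>R x - E 1 y x *\<^sub>R axis 3 1 \<and>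
    p x = E 2 (\<lambda>s. (lam * mm s - (1 - s\<^sup>2) * (y s * y s / 2) - s * y s - s * y s) - (1 - s\<^sup>2) * (y s * y s / 2)
      + lam * Ps s + lam * CC) x"
    using solution_riccati[OF assms(1)] by (elim exE conjE) (rule that)
  obtain z where z: "riccati x0 1 nn lam z" "\<forall>x\<in>Woff.
    u' x = E 2 (\<lambda>s. lam * mm s - (1 - s\<^sup>2) * (z s * z s / 2) - s * z s) x *\<^sub>R x - E 1 z x *\<^sub>R axis 3 1 \<and>
    p' x = E 2 (\<lambda>s. (lam * mm s - (1 - s\<^sup>2) * (z s * z s / 2) - s * z s - s * z s) - (1 - s\<^sup>2) * (z s * z s / 2)
      + lam * Ps s + lam * CC) x"
    using solution_riccati[OF assms(2)] by (elim exE conjE) (rule that)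
  obtain R where R: "1 \<le> R" "\<And>s. s \<in> {x0..1} \<Longrightarrow> \<bar>z s\<bar> \<le> R"
    using continuous_abs_bound[OF riccati_continuous[OF z(1)]] by metis
  \<comment> \<open>Both flows are given off the axis by the same formulas in a Riccati solution.
    That solution is unique, and continuity extends the equality to the whole cone.\<close>
  have zy: "z s = y s" if "s \<in> {x0..<1}" for s
  proof (rule riccati_unique[OF y(1) _ _ _ _ that])
    show "continuous_on {x0..<1} z" by (rule continuous_on_subset[OF riccati_continuous[OF z(1)]]) auto
    show "z x0 = 0" using z(1) by (simp add: riccati_def)
    show "\<bar>z s\<bar> \<le> R" if "s \<in> {x0..<1}" for s using R(2)[of s] that by simp
  qed (rule riccati_deriv_at[OF z(1)])
  have eq: "u' w = u w" "p' w = p w" if w: "w \<in> Woff" for w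
  proof -
    have "z (cosang w) = y (cosang w)" using w by (intro zy) (simp add: Woff_def)
    then show "u' w = u w" "p' w = p w"
      using y(2)[rule_format, OF w] z(2)[rule_format, OF w] by (simp_all add: E_def)
  qed
  have c: "continuous_on (pcone x0) u" "continuous_on (pcone x0) u'" "continuous_on (pcone x0) p" "continuous_on (pcone x0) p'"
    using assms(1,2) C_upto_continuous unfolding axisym_selfsimilar_solution_def cone_eq by blast+
  have sub: "Woff \<subseteq> pcone x0" using Woff_interior interior_subset by blast
  show "u' x = u x" by (rule eq_on_closure[OF c(2,1) sub eq(1) x Woff_dense[OF x]])
  show "p' x = p x" by (rule eq_on_closure[OF c(4,3) sub eq(2) x Woff_dense[OF x]])
qed

lemma riccati_gives_solution:
  assumes "riccati x0 1 nn lam y"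
  shows "\<exists>u p. axisym_selfsimilar_solution \<phi>0 F lam u p \<and>
    (\<forall>\<alpha>. 0 < \<alpha> \<and> \<alpha> < 1 \<longrightarrow> C_holder_upto 2 \<alpha> (solid_cone \<phi>0) u \<and> C_holder_upto 1 \<alpha> (solid_cone \<phi>0) p)"
proof -
  interpret S: riccati_solution \<phi>0 F X Y lam y
    by unfold_locales (rule assms)
  show ?thesis
  proof (intro exI conjI allI impI)
    show "axisym_selfsimilar_solution \<phi>0 F lam S.u S.p" by (rule S.solution)
    fix \<alpha> :: real assume "0 < \<alpha> \<and> \<alpha> < 1"
    then show "C_holder_upto 2 \<alpha> (solid_cone \<phi>0) S.u" "C_holder_upto 1 \<alpha> (solid_cone \<phi>0) S.p"
      unfolding cone_eq using CL_imp_C_holder S.CL_u S.CL_p by blast+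
  qed
qed

lemma selfsimilar_range:
  shows "\<exists>lo hi :: ereal. lo < 0 \<and> 0 < hi \<and>
    (\<forall>lam::real. lo < ereal lam \<and> ereal lam < hi \<longrightarrow>
       (\<exists>u p. axisym_selfsimilar_solution \<phi>0 F lam u p \<and>
          (\<forall>u' p'. axisym_selfsimilar_solution \<phi>0 F lam u' p' \<longrightarrow>
             (\<forall>x\<in>solid_cone \<phi>0. u' x = u x \<and> p' x = p x)) \<and>
          (\<forall>\<alpha>::real. 0 < \<alpha> \<and> \<alpha> < 1 \<longrightarrow>
             C_holder_upto 2 \<alpha> (solid_cone \<phi>0) u \<and> C_holder_upto 1 \<alpha> (solid_cone \<phi>0) p))) \<and>
    (\<forall>lam::real. \<not> (lo < ereal lam \<and> ereal lam < hi) \<longrightarrow>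
       \<not> (\<exists>u p. axisym_selfsimilar_solution \<phi>0 F lam u p)) \<and>
    ((\<forall>\<phi>\<in>{0..\<phi>0}. 0 \<le> N_fun \<phi>0 X Y \<phi>) \<and> (\<exists>\<phi>\<in>{0..\<phi>0}. N_fun \<phi>0 X Y \<phi> \<noteq> 0) \<longrightarrow>
       - \<infinity> < lo \<and> hi = \<infinity>) \<and>
    ((\<forall>\<phi>\<in>{0..\<phi>0}. N_fun \<phi>0 X Y \<phi> \<le> 0) \<and> (\<exists>\<phi>\<in>{0..\<phi>0}. N_fun \<phi>0 X Y \<phi> \<noteq> 0) \<longrightarrow>
       lo = - \<infinity> \<and> hi < \<infinity>) \<and>
    ((\<exists>\<phi>\<in>{0..\<phi>0}. 0 < N_fun \<phi>0 X Y \<phi>) \<and> (\<exists>\<phi>\<in>{0..\<phi>0}. N_fun \<phi>0 X Y \<phi> < 0) \<longrightarrow>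
       - \<infinity> < lo \<and> hi < \<infinity>) \<and>
    ((\<forall>\<phi>\<in>{0..\<phi>0}. N_fun \<phi>0 X Y \<phi> = 0) \<longrightarrow> lo = - \<infinity> \<and> hi = \<infinity>)"
proof -
  have "\<exists>lo hi :: ereal. lo < 0 \<and> 0 < hi \<and> (\<forall>l. (\<exists>y. riccati x0 1 nn l y) \<longleftrightarrow> lo < ereal l \<and> ereal l < hi) \<and>
      (lo = - \<infinity> \<longleftrightarrow> (\<forall>s. x0 < s \<longrightarrow> s < 1 \<longrightarrow> nn s \<le> 0)) \<and>
      (hi = \<infinity> \<longleftrightarrow> (\<forall>s. x0 < s \<longrightarrow> s < 1 \<longrightarrow> 0 \<le> nn s))"
  proof (rule riccati_thresholds[OF x0(2) LD_continuous[OF LD_nn]])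
    fix lo hi :: ereal
    assume "lo < 0" "0 < hi" "\<And>l. (\<exists>y. riccati x0 1 nn l y) \<longleftrightarrow> lo < ereal l \<and> ereal l < hi"
      "lo = - \<infinity> \<longleftrightarrow> (\<forall>s. x0 < s \<longrightarrow> s < 1 \<longrightarrow> nn s \<le> 0)"
      "hi = \<infinity> \<longleftrightarrow> (\<forall>s. x0 < s \<longrightarrow> s < 1 \<longrightarrow> 0 \<le> nn s)"
    then show ?thesis by (intro exI[of _ lo] exI[of _ hi] conjI allI)
  qed
  then obtain lo hi :: ereal where lo: "lo < 0" and hi: "0 < hi"
    and iff: "\<forall>l. (\<exists>y. riccati x0 1 nn l y) \<longleftrightarrow> lo < ereal l \<and> ereal l < hi"
    and lo_iff: "lo = - \<infinity> \<longleftrightarrow> (\<forall>s. x0 < s \<longrightarrow> s < 1 \<longrightarrow> nn s \<le> 0)"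
    and hi_iff: "hi = \<infinity> \<longleftrightarrow> (\<forall>s. x0 < s \<longrightarrow> s < 1 \<longrightarrow> 0 \<le> nn s)"
    by (elim exE conjE) (rule that, assumption+)
  let ?N = "N_fun \<phi>0 X Y"
  have lo_inf: "lo = - \<infinity> \<longleftrightarrow> (\<forall>\<phi>\<in>{0..\<phi>0}. ?N \<phi> \<le> 0)" unfolding lo_iff N_fun_sign(2) ..
  have hi_inf: "hi = \<infinity> \<longleftrightarrow> (\<forall>\<phi>\<in>{0..\<phi>0}. 0 \<le> ?N \<phi>)" unfolding hi_iff N_fun_sign(1) ..
  have lo_fin: "- \<infinity> < lo \<longleftrightarrow> (\<exists>\<phi>\<in>{0..\<phi>0}. 0 < ?N \<phi>)"
  proof -
    have "- \<infinity> < lo \<longleftrightarrow> lo \<noteq> - \<infinity>" by simp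
    then show ?thesis unfolding lo_inf by (simp add: not_le)
  qed
  have hi_fin: "hi < \<infinity> \<longleftrightarrow> (\<exists>\<phi>\<in>{0..\<phi>0}. ?N \<phi> < 0)"
  proof -
    have "hi < \<infinity> \<longleftrightarrow> hi \<noteq> \<infinity>" by simp
    then show ?thesis unfolding hi_inf by (simp add: not_le)
  qed
  have in_range: "\<exists>u p. axisym_selfsimilar_solution \<phi>0 F lam u p \<and>
          (\<forall>u' p'. axisym_selfsimilar_solution \<phi>0 F lam u' p' \<longrightarrow>
             (\<forall>x\<in>solid_cone \<phi>0. u' x = u x \<and> p' x = p x)) \<and>
          (\<forall>\<alpha>::real. 0 < \<alpha> \<and> \<alpha> < 1 \<longrightarrow>
             C_holder_upto 2 \<alpha> (solid_cone \<phi>0) u \<and> C_holder_upto 1 \<alpha> (solid_cone \<phi>0) p)"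
    if "lo < ereal lam \<and> ereal lam < hi" for lam
  proof -
    have "\<exists>y. riccati x0 1 nn lam y" by (rule iff[rule_format, THEN iffD2, OF that])
    then obtain y where "riccati x0 1 nn lam y" ..
    from riccati_gives_solution[OF this] obtain u p where sol: "axisym_selfsimilar_solution \<phi>0 F lam u p"
      and reg: "\<forall>\<alpha>. 0 < \<alpha> \<and> \<alpha> < 1 \<longrightarrow> C_holder_upto 2 \<alpha> (solid_cone \<phi>0) u \<and> C_holder_upto 1 \<alpha> (solid_cone \<phi>0) p"
      by (elim exE conjE) (rule that)
    have uniq: "\<forall>u' p'. axisym_selfsimilar_solution \<phi>0 F lam u' p' \<longrightarrow> (\<forall>x\<in>solid_cone \<phi>0. u' x = u x \<and> p' x = p x)"
      by (intro allI impI ballI conjI; rule solution_unique[OF sol]; assumption)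
    show ?thesis by (rule exI[of _ u], rule exI[of _ p], rule conjI[OF sol conjI[OF uniq reg]])
  qed
  have out_of_range: "\<not> (\<exists>u p. axisym_selfsimilar_solution \<phi>0 F lam u p)"
    if n: "\<not> (lo < ereal lam \<and> ereal lam < hi)" for lam
  proof
    assume "\<exists>u p. axisym_selfsimilar_solution \<phi>0 F lam u p"
    then obtain u p where "axisym_selfsimilar_solution \<phi>0 F lam u p" by blast
    from solution_riccati[OF this] have "\<exists>y. riccati x0 1 nn lam y" by (elim exE conjE) (rule exI)
    then have "lo < ereal lam \<and> ereal lam < hi" by (rule iff[rule_format, THEN iffD1])
    with n show False ..
  qed
  have pos: "\<exists>\<phi>\<in>S. 0 < g \<phi>" if "\<forall>\<phi>\<in>S. 0 \<le> g \<phi>" "\<exists>\<phi>\<in>S. g \<phi> \<noteq> 0" for g :: "real \<Rightarrow> real" and S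
    using that by (metis order_le_less)
  have neg: "\<exists>\<phi>\<in>S. g \<phi> < 0" if "\<forall>\<phi>\<in>S. g \<phi> \<le> 0" "\<exists>\<phi>\<in>S. g \<phi> \<noteq> 0" for g :: "real \<Rightarrow> real" and S
    using that by (metis order_le_less)
  have case1: "(\<forall>\<phi>\<in>{0..\<phi>0}. 0 \<le> ?N \<phi>) \<and> (\<exists>\<phi>\<in>{0..\<phi>0}. ?N \<phi> \<noteq> 0) \<longrightarrow> - \<infinity> < lo \<and> hi = \<infinity>"
  proof
    assume "(\<forall>\<phi>\<in>{0..\<phi>0}. 0 \<le> ?N \<phi>) \<and> (\<exists>\<phi>\<in>{0..\<phi>0}. ?N \<phi> \<noteq> 0)"
    then show "- \<infinity> < lo \<and> hi = \<infinity>"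
      unfolding lo_fin hi_inf by (elim conjE) (rule conjI[OF pos], assumption+)
  qed
  have case2: "(\<forall>\<phi>\<in>{0..\<phi>0}. ?N \<phi> \<le> 0) \<and> (\<exists>\<phi>\<in>{0..\<phi>0}. ?N \<phi> \<noteq> 0) \<longrightarrow> lo = - \<infinity> \<and> hi < \<infinity>"
  proof
    assume "(\<forall>\<phi>\<in>{0..\<phi>0}. ?N \<phi> \<le> 0) \<and> (\<exists>\<phi>\<in>{0..\<phi>0}. ?N \<phi> \<noteq> 0)"
    then show "lo = - \<infinity> \<and> hi < \<infinity>"
      unfolding lo_inf hi_fin by (elim conjE) (rule conjI[OF _ neg], assumption+)
  qed
  have case3: "(\<exists>\<phi>\<in>{0..\<phi>0}. 0 < ?N \<phi>) \<and> (\<exists>\<phi>\<in>{0..\<phi>0}. ?N \<phi> < 0) \<longrightarrow> - \<infinity> < lo \<and> hi < \<infinity>"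
    unfolding lo_fin hi_fin by (rule impI)
  have case4: "(\<forall>\<phi>\<in>{0..\<phi>0}. ?N \<phi> = 0) \<longrightarrow> lo = - \<infinity> \<and> hi = \<infinity>"
    unfolding lo_inf hi_inf by simp
  show ?thesis
    by (rule exI[of _ lo], rule exI[of _ hi], rule conjI[OF lo], rule conjI[OF hi],
      rule conjI, intro allI impI, rule in_range, assumption, rule conjI, intro allI impI,
      rule out_of_range, assumption, rule conjI[OF case1], rule conjI[OF case2],
      rule conjI[OF case3], rule case4)
qed

end

theorem theorem5p2:
  fixes \<phi>0 :: real and F :: "real^3 \<Rightarrow> real^3" and X Y :: "real \<Rightarrow> real"
  assumes "0 < \<phi>0" and "\<phi>0 < pi"
    and "axisymmetric_vector \<phi>0 F" and "swirl_free \<phi>0 F"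
    and "C_upto 1 (solid_cone \<phi>0) F"
    and "homogeneous_on (solid_cone \<phi>0) (-3) F"
    and "\<forall>(\<rho>, \<phi>, \<theta>)\<in>cone_coords \<phi>0.
           F (spherical \<rho> \<phi> \<theta>) = (\<rho> powi (-3)) *\<^sub>R (X \<phi> *\<^sub>R e_rho \<phi> \<theta> + Y \<phi> *\<^sub>R e_phi \<phi> \<theta>)"
  shows "\<exists>lo hi :: ereal. lo < 0 \<and> 0 < hi \<and>
    (\<forall>lam::real. lo < ereal lam \<and> ereal lam < hi \<longrightarrow>
       (\<exists>u p. axisym_selfsimilar_solution \<phi>0 F lam u p \<and>
          (\<forall>u' p'. axisym_selfsimilar_solution \<phi>0 F lam u' p' \<longrightarrow>
             (\<forall>x\<in>solid_cone \<phi>0. u' x = u x \<and> p' x = p x)) \<and>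
          (\<forall>\<alpha>::real. 0 < \<alpha> \<and> \<alpha> < 1 \<longrightarrow>
             C_holder_upto 2 \<alpha> (solid_cone \<phi>0) u \<and> C_holder_upto 1 \<alpha> (solid_cone \<phi>0) p))) \<and>
    (\<forall>lam::real. \<not> (lo < ereal lam \<and> ereal lam < hi) \<longrightarrow>
       \<not> (\<exists>u p. axisym_selfsimilar_solution \<phi>0 F lam u p)) \<and>
    ((\<forall>\<phi>\<in>{0..\<phi>0}. 0 \<le> N_fun \<phi>0 X Y \<phi>) \<and> (\<exists>\<phi>\<in>{0..\<phi>0}. N_fun \<phi>0 X Y \<phi> \<noteq> 0) \<longrightarrow>
       - \<infinity> < lo \<and> hi = \<infinity>) \<and>
    ((\<forall>\<phi>\<in>{0..\<phi>0}. N_fun \<phi>0 X Y \<phi> \<le> 0) \<and> (\<exists>\<phi>\<in>{0..\<phi>0}. N_fun \<phi>0 X Y \<phi> \<noteq> 0) \<longrightarrow>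
       lo = - \<infinity> \<and> hi < \<infinity>) \<and>
    ((\<exists>\<phi>\<in>{0..\<phi>0}. 0 < N_fun \<phi>0 X Y \<phi>) \<and> (\<exists>\<phi>\<in>{0..\<phi>0}. N_fun \<phi>0 X Y \<phi> < 0) \<longrightarrow>
       - \<infinity> < lo \<and> hi < \<infinity>) \<and>
    ((\<forall>\<phi>\<in>{0..\<phi>0}. N_fun \<phi>0 X Y \<phi> = 0) \<longrightarrow> lo = - \<infinity> \<and> hi = \<infinity>)"
  by (rule cone_force.selfsimilar_range[OF cone_force.intro[OF assms(1,2,5,7)]])

end
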